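(* Let $\lambda>0$, $\rho\in(2,\infty)$, and let $\{t_j\}_{j\ge1}\subset(0,\infty)$ be a fixed decreasing sequence converging to zero, used to define the oscillation operator. The oscillation operator $\mathcal{O}(P^{[\lambda]}_\ast)$ and the variation operator $\mathcal{V}_\rho(P^{[\lambda]}_\ast)$ are both bounded from $H^1(\mathbb{R}_+,dm_\lambda)$ to $L^1(\mathbb{R}_+,dm_\lambda)$; that is, for each of these operators $T$ there is a constant $C>0$ such that $\|Tf\|_{L^1(\mathbb{R}_+,dm_\lambda)}\le C\|f\|_{H^1(\mathbb{R}_+,dm_\lambda)}$ for all $f\in H^1(\mathbb{R}_+,dm_\lambda)$.
   Context: $\mathbb{R}_+:=(0,\infty)$, $dm_\lambda(x):=x^{2\lambda}\,dx$ with $dx$ Lebesgue measure. The Bessel operator is $\triangle_\lambda f(x):=-f''(x)-\frac{2\lambda}{x}f'(x)$ on $\mathbb{R}_+$. Its Poisson semigroup $P^{[\lambda]}_\ast=\{P^{[\lambda]}_t\}_{t>0}$, $P_t^{[\lambda]}=e^{-t\sqrt{\triangle_\lambda}}$, is given by $$P_t^{[\lambda]}f(x)=\int_0^\infty P_t^{[\lambda]}(x,y)f(y)\,y^{2\lambda}dy,\qquad P_t^{[\lambda]}(x,y)=\frac{2\lambda t}{\pi}\int_0^\pi\frac{(\sin\theta)^{2\lambda-1}}{(x^2+y^2+t^2-2xy\cos\theta)^{\lambda+1}}\,d\theta,\quad t,x,y\in(0,\infty).$$ The $\rho$-variation operator is $$\mathcal{V}_\rho(P^{[\lambda]}_\ast)f(x):=\sup_{s_j\searrow0}\Big(\sum_{j=1}^\infty|P^{[\lambda]}_{s_{j+1}}f(x)-P^{[\lambda]}_{s_j}f(x)|^\rho\Big)^{1/\rho},$$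 the supremum being over all sequences $\{s_j\}_{j\ge 1}$ of positive numbers decreasing to zero. The oscillation operator associated with the fixed sequence $\{t_j\}$ is $$\mathcal{O}(P^{[\lambda]}_\ast)f(x):=\Big(\sum_{j=1}^\infty\ \sup_{t_{j+1}\le\epsilon_{j+1}<\epsilon_j\le t_j}|P^{[\lambda]}_{\epsilon_{j+1}}f(x)-P^{[\lambda]}_{\epsilon_j}f(x)|^2\Big)^{1/2}.$$ Hardy space: a measurable function $a$ is an $H^1(\mathbb{R}_+,dm_\lambda)$-atom if there is a bounded interval $I\subset[0,\infty)$ with $\operatorname{supp}a\subset I$, $\|a\|_{L^\infty(\mathbb{R}_+,dm_\lambda)}\le 1/m_\lambda(I)$ and $\int_0^\infty a(x)\,dm_\lambda(x)=0$. A function $f\in L^1(\mathbb{R}_+,dm_\lambda)$ is in $H^1(\mathbb{R}_+,dm_\lambda)$ if and only if $f=\sum_{j=1}^\infty\alpha_ja_j$ in $L^1(\mathbb{R}_+,dm_\lambda)$, where each $a_j$ is an $H^1(\mathbb{R}_+,dm_\lambda)$-atom, $\alpha_j\in\mathbb{C}$ and $\sum_{j=1}^\infty|\alpha_j|<\infty$; $\|f\|_{H^1(\mathbb{R}_+,dm_\lambda)}:=\inf\sum_{j=1}^\infty|\alpha_j|$, the infimum being over all such decompositions. *)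

theory Defs
  imports "HOL-Probability.Essential_Supremum"
begin

text \<open>
  The measure \<open>x^(2 lam) dx\<close> on the open half line. Its underlying measurable space consists of
  the Lebesgue measurable subsets of \<open>{0<..}\<close>, so values of functions at nonpositive arguments
  play no role below.
\<close>

definition bessel_measure :: "real \<Rightarrow> real measure" where
  "bessel_measure lam = density (lebesgue_on {0<..}) (\<lambda>x. ennreal (x powr (2 * lam)))"

definition bessel_poisson_kernel :: "real \<Rightarrow> real \<Rightarrow> real \<Rightarrow> real \<Rightarrow> real" where
  "bessel_poisson_kernel lam t x y =
     2 * lam * t / pi *
     (LINT \<theta>:{0..pi}|lborel.
        sin \<theta> powr (2 * lam - 1)
        / (x\<^sup>2 + y\<^sup>2 + t\<^sup>2 - 2 * x * y * cos \<theta>) powr (lam + 1))"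

definition bessel_poisson :: "real \<Rightarrow> real \<Rightarrow> (real \<Rightarrow> complex) \<Rightarrow> real \<Rightarrow> complex" where
  "bessel_poisson lam t f x =
     (LINT y|bessel_measure lam. bessel_poisson_kernel lam t x y *\<^sub>R f y)"

text \<open>Real powers on \<open>[0,\<infinity>]\<close>, meant for exponents \<open>p > 0\<close>.\<close>

definition ennreal_powr :: "ennreal \<Rightarrow> real \<Rightarrow> ennreal" where
  "ennreal_powr u p = (if u = \<infinity> then \<infinity> else ennreal (enn2real u powr p))"

text \<open>
  Variation and oscillation take values in \<open>[0,\<infinity>]\<close>. Sequences are indexed from \<open>0\<close>, and
  decreasing is meant in the weak sense; repeated entries contribute only zero terms (in the
  oscillation, the supremum of the empty set, which is \<open>0\<close> in \<^typ>\<open>ennreal\<close>).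
\<close>

definition variation_op ::
  "real \<Rightarrow> (real \<Rightarrow> (real \<Rightarrow> complex) \<Rightarrow> real \<Rightarrow> complex) \<Rightarrow> (real \<Rightarrow> complex) \<Rightarrow> real \<Rightarrow> ennreal" where
  "variation_op \<rho> P f x =
     (SUP s \<in> {s :: nat \<Rightarrow> real. decseq s \<and> (\<forall>j. 0 < s j) \<and> s \<longlonglongrightarrow> 0}.
        ennreal_powr (\<Sum>j. ennreal (cmod (P (s (Suc j)) f x - P (s j) f x) powr \<rho>)) (1 / \<rho>))"

definition oscillation_op ::
  "(nat \<Rightarrow> real) \<Rightarrow> (real \<Rightarrow> (real \<Rightarrow> complex) \<Rightarrow> real \<Rightarrow> complex) \<Rightarrow> (real \<Rightarrow> complex) \<Rightarrow> real \<Rightarrow> ennreal" where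
  "oscillation_op t P f x =
     ennreal_powr
       (\<Sum>j. SUP (e', e) \<in> {(e', e). t (Suc j) \<le> e' \<and> e' < e \<and> e \<le> t j}.
               ennreal ((cmod (P e' f x - P e f x))\<^sup>2))
       (1 / 2)"

text \<open>
  Measurable functions are identified almost everywhere, so the support condition is imposed
  almost everywhere. The interval may contain the point \<open>0\<close>, which lies outside the measure space;
  hence the intersection with \<open>{0<..}\<close>. If the interval is a null set, the size bound is \<open>\<infinity>\<close>,
  but then the function vanishes almost everywhere.
\<close>

definition H1_atom :: "real \<Rightarrow> (real \<Rightarrow> complex) \<Rightarrow> bool" where
  "H1_atom lam a \<longleftrightarrow>
     a \<in> borel_measurable (bessel_measure lam) \<and>
     (\<exists>I. is_interval I \<and> bounded I \<and> I \<subseteq> {0..} \<and>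
        (AE x in bessel_measure lam. x \<notin> I \<longrightarrow> a x = 0) \<and>
        esssup (bessel_measure lam) (\<lambda>x. ennreal (cmod (a x)))
          \<le> 1 / emeasure (bessel_measure lam) (I \<inter> {0<..})) \<and>
     (LINT x|bessel_measure lam. a x) = 0"

definition H1_decomposition ::
  "real \<Rightarrow> (real \<Rightarrow> complex) \<Rightarrow> (nat \<Rightarrow> complex) \<Rightarrow> (nat \<Rightarrow> real \<Rightarrow> complex) \<Rightarrow> bool" where
  "H1_decomposition lam f \<alpha> a \<longleftrightarrow>
     (\<forall>j. H1_atom lam (a j)) \<and>
     summable (\<lambda>j. cmod (\<alpha> j)) \<and>
     (\<lambda>n. \<integral>\<^sup>+ x. ennreal (cmod (f x - (\<Sum>j<n. \<alpha> j * a j x))) \<partial>bessel_measure lam) \<longlonglongrightarrow> 0"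

definition H1_space :: "real \<Rightarrow> (real \<Rightarrow> complex) set" where
  "H1_space lam = {f. integrable (bessel_measure lam) f \<and> (\<exists>\<alpha> a. H1_decomposition lam f \<alpha> a)}"

definition H1_norm :: "real \<Rightarrow> (real \<Rightarrow> complex) \<Rightarrow> real" where
  "H1_norm lam f = Inf {\<Sum>j. cmod (\<alpha> j) | \<alpha> a. H1_decomposition lam f \<alpha> a}"

text \<open>
  Measurability of \<open>T f\<close> is part of \<open>T f \<in> L^1\<close> and must be stated, since \<^const>\<open>nn_integral\<close> of a
  nonmeasurable function is only a lower integral.
\<close>

definition bounded_H1_L1 :: "real \<Rightarrow> ((real \<Rightarrow> complex) \<Rightarrow> real \<Rightarrow> ennreal) \<Rightarrow> bool" where
  "bounded_H1_L1 lam T \<longleftrightarrow>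
     (\<exists>C>0. \<forall>f \<in> H1_space lam.
        T f \<in> borel_measurable (bessel_measure lam) \<and>
        (\<integral>\<^sup>+ x. T f x \<partial>bessel_measure lam) \<le> ennreal (C * H1_norm lam f))"

end

(*
  The Poisson kernel is a mixture of the heat kernels of the Bessel operator, and these are the
  transition densities of a symmetric Markov semigroup on (0,infinity) with the measure
  x^(2 lambda) dx. By Rota's dilation, the values of the semigroup at decreasing times are
  conditional expectations of a martingale. The variation and the oscillation of any sequence with
  values in [0,M] are dominated pathwise by a multiple of M^(p-2) times the square of the last entry
  plus a martingale transform of the sequence, so taking expectations gives an estimate in terms of
  the L^2 norm, uniformly over finitely many choices of times. Applied to the positive and negative
  parts of an atom, it bounds the operators near the support of the atom.

  Far from the support, the cancellation of the atom leaves mixed differences of the kernel in time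
  and space. Their sum over nonoverlapping time intervals telescopes in arctan and is at most a
  multiple of the Poisson kernel centred at the atom, whose integral is finite.

  Both operators are suprema of l^p norms of finitely many increments, each continuous in x, hence
  are measurable and countably subadditive along an atomic decomposition.
*)
theory Submission
  imports Defs "HOL-Probability.Probability"
begin

section \<open>Pathwise variation and oscillation inequalities\<close>

text \<open>The supremum over all choices of times sits inside the integral, so an estimate for one
  sequence of times is not enough: a single integrand \<open>G\<close> has to dominate every choice
  at once. Hence \<open>G\<close> is fixed before the path and the choice of times, and the
  variation is measured by counting jumps of all dyadic sizes, a count that does not see which
  subsequence was picked. No path space is built. The Markov chain appears only through iterated
  integrals of a functional for which Jensen's inequality survives each integration. The power
  \<open>M powr (p - 2)\<close> comes from summing \<open>l powr (p - 2)\<close> over dyadic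
  \<open>l\<close>, which is finite only for \<open>p > 2\<close>. For the oscillation the blocks
  are fixed in advance, squares telescope across them, and \<open>p = 2\<close> is allowed. On an
  atom \<open>M\<close> is the reciprocal of the measure of its interval, which makes the local
  estimate independent of the interval. The Poisson operator at time \<open>t\<close> is treated as
  an average over \<open>s\<close> of heat operators at times \<open>t^2 / (4 s)\<close>. These
  increase with \<open>t\<close>, so decreasing times stay decreasing for each
  \<open>s\<close>.\<close>

definition predictable :: "(nat \<Rightarrow> (nat \<Rightarrow> real) \<Rightarrow> real) \<Rightarrow> bool" where
  "predictable G \<longleftrightarrow> (\<forall>i z z'. (\<forall>j\<le>i. z j = z' j) \<longrightarrow> G i z = G i z')"

text \<open>A greedy counter of moves of size \<open>l\<close>. The anchor, in the first component,
  is the value at the latest counted move (initially \<open>z 0\<close>). It is known from the path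
  so far, so it can serve as a predictable integrand.\<close>

primrec jump_state :: "real \<Rightarrow> (nat \<Rightarrow> real) \<Rightarrow> nat \<Rightarrow> real \<times> nat" where
  "jump_state l z 0 = (z 0, 0)"
| "jump_state l z (Suc i) =
     (if l \<le> \<bar>z (Suc i) - fst (jump_state l z i)\<bar> then (z (Suc i), Suc (snd (jump_state l z i)))
      else jump_state l z i)"

lemma jump_state_cong: "(\<And>j. j \<le> i \<Longrightarrow> z j = z' j) \<Longrightarrow> jump_state l z i = jump_state l z' i"
  by (induction i) auto

lemma jump_count_mono: "i \<le> k \<Longrightarrow> snd (jump_state l z i) \<le> snd (jump_state l z k)"
  by (rule lift_Suc_mono_le) auto

lemma jump_anchor_range: "(\<And>j. j \<le> i \<Longrightarrow> z j \<in> A) \<Longrightarrow> fst (jump_state l z i) \<in> A"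
  by (induction i) auto

text \<open>With \<open>a\<close> the current anchor, one step adds
  \<open>(z (Suc n) - a)^2 - (z n - a)^2\<close> to the right-hand side. If the move is counted, the
  first square is at least \<open>l^2\<close> and pays for it, while the square on the left restarts
  at zero.\<close>

lemma jump_energy:
  assumes "0 \<le> l"
  shows "l\<^sup>2 * real (snd (jump_state l z n)) + (z n - fst (jump_state l z n))\<^sup>2
    \<le> (z n)\<^sup>2 - (z 0)\<^sup>2 - 2 * (\<Sum>i<n. fst (jump_state l z i) * (z (Suc i) - z i))"
proof (induction n)
  case (Suc n)
  let ?a = "fst (jump_state l z n)"
  show ?case
  proof (cases "l \<le> \<bar>z (Suc n) - ?a\<bar>")
    case True
    then have "l\<^sup>2 \<le> (z (Suc n) - ?a)\<^sup>2"
      using assms by (metis power2_abs power_mono)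
    moreover have "0 \<le> (z n - ?a)\<^sup>2" by simp
    ultimately show ?thesis using Suc True
      by (simp add: algebra_simps power2_eq_square)
  next
    case False
    then show ?thesis using Suc
      by (simp add: algebra_simps power2_eq_square)
  qed
qed simp

lemma jump_anchor_near:
  assumes "0 < l" "i \<le> k" "snd (jump_state l z i) = snd (jump_state l z k)"
  shows "fst (jump_state l z k) = fst (jump_state l z i) \<and> \<bar>z k - fst (jump_state l z i)\<bar> < l"
  using assms(2,3)
proof (induction rule: dec_induct)
  case base
  show ?case
    using assms(1) by (cases i) auto
next
  case (step k)
  have "snd (jump_state l z i) \<le> snd (jump_state l z k)"
    by (rule jump_count_mono) (use step.hyps in simp)
  moreover have "snd (jump_state l z k) \<le> snd (jump_state l z (Suc k))"
    by (rule jump_count_mono) simp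
  ultimately have eq: "snd (jump_state l z i) = snd (jump_state l z k)"
    using step.prems by linarith
  then have "\<not> l \<le> \<bar>z (Suc k) - fst (jump_state l z k)\<bar>"
    using step.prems by (auto split: if_splits)
  then show ?case using conjunct1[OF step.IH[OF eq]] by auto
qed

text \<open>If nothing were counted in between, both values would lie within \<open>l\<close> of one
  anchor; hence the factor 2.\<close>

lemma jump_count_step:
  assumes "0 < l" "i \<le> k" "2 * l \<le> \<bar>z k - z i\<bar>"
  shows "snd (jump_state l z i) < snd (jump_state l z k)"
proof (rule ccontr)
  assume "\<not> ?thesis"
  then have eq: "snd (jump_state l z i) = snd (jump_state l z k)"
    using jump_count_mono[OF assms(2)] by (metis le_neq_implies_less)
  show False
    using jump_anchor_near[OF assms(1) assms(2) eq] jump_anchor_near[OF assms(1) order_refl refl, of z i] assms(3)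
    by linarith
qed

text \<open>The time intervals do not overlap, so the counted moves found in them are distinct. The
  right-hand side knows only the final time \<open>s N\<close>, not the times chosen before
  it.\<close>

lemma card_large_steps_le_jump_count:
  assumes "0 < l" "\<And>j. j < N \<Longrightarrow> s j \<le> s (Suc j)"
  shows "(\<Sum>j<N. if 2 * l \<le> \<bar>z (s (Suc j)) - z (s j)\<bar> then 1 else 0) \<le> snd (jump_state l z (s N))"
  using assms(2)
proof (induction N)
  case (Suc N)
  have "snd (jump_state l z (s N)) \<le> snd (jump_state l z (s (Suc N)))"
    by (rule jump_count_mono) (use Suc.prems in simp)
  moreover have "2 * l \<le> \<bar>z (s (Suc N)) - z (s N)\<bar> \<Longrightarrow> snd (jump_state l z (s N)) < snd (jump_state l z (s (Suc N)))"
    by (rule jump_count_step[OF assms(1)]) (use Suc.prems in simp_all)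
  ultimately show ?case
    using Suc by fastforce
qed simp

lemma powr_of_power: "0 \<le> x \<Longrightarrow> (x ^ k) powr p = (x powr p) ^ k" for x p :: real
  by (induction k) (auto simp: powr_mult)

text \<open>Let \<open>k\<close> be the first level whose threshold \<open>2 * (M / 2 ^ k)\<close>
  is reached by \<open>\<bar>d\<bar>\<close>. The previous threshold was missed, so
  \<open>\<bar>d\<bar> \<le> 4 * (M / 2 ^ k)\<close>, and this single layer already accounts for the
  whole power.\<close>

lemma powr_le_dyadic_layers:
  fixes d M p :: real
  assumes "0 < M" "2 < p" "\<bar>d\<bar> \<le> M"
  shows "\<bar>d\<bar> powr p \<le> (\<Sum>k. 4 powr p * (M / 2 ^ k) powr p * (if 2 * (M / 2 ^ k) \<le> \<bar>d\<bar> then 1 else 0))"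
    and "summable (\<lambda>k. 4 powr p * (M / 2 ^ k) powr p)"
proof -
  have geo: "(M / 2 ^ k) powr p = M powr p * ((1/2) powr p) ^ k" for k
  proof -
    have e: "M / 2 ^ k = M * (1/2) ^ k" by (simp add: power_divide)
    show ?thesis unfolding e
      by (subst powr_mult) (use assms in \<open>simp_all only: powr_of_power\<close>)
  qed
  have lt: "(1/2::real) powr p < 1"
    using assms by (simp add: powr_def ln_div)
  show sm: "summable (\<lambda>k. 4 powr p * (M / 2 ^ k) powr p)"
    unfolding geo by (intro summable_mult summable_geometric) (use lt in simp)
  let ?t = "\<lambda>k. 4 powr p * (M / 2 ^ k) powr p * (if 2 * (M / 2 ^ k) \<le> \<bar>d\<bar> then 1 else 0)"
  have smt: "summable ?t"
    by (rule summable_comparison_test'[OF sm, of 0]) auto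
  show "\<bar>d\<bar> powr p \<le> (\<Sum>k. ?t k)"
  proof (cases "d = 0")
    case True
    then show ?thesis using smt by (auto intro!: suminf_nonneg)
  next
    case False
    have "\<exists>k. 2 * M / \<bar>d\<bar> < 2 ^ k" by (rule real_arch_pow) simp
    then have ex: "\<exists>k. 2 * (M / 2 ^ k) \<le> \<bar>d\<bar>"
      using False by (auto simp: field_simps intro: less_imp_le)
    define k where "k = (LEAST k. 2 * (M / 2 ^ k) \<le> \<bar>d\<bar>)"
    have k: "2 * (M / 2 ^ k) \<le> \<bar>d\<bar>" unfolding k_def by (rule LeastI_ex[OF ex])
    \<comment> \<open>At level 0 the threshold is \<open>2 * M\<close>, out of reach, so a previous
      level exists.\<close>
    have "k \<noteq> 0" using k assms by (cases "k = 0") auto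
    then obtain j where j: "k = Suc j" by (cases k) auto
    have "\<not> 2 * (M / 2 ^ j) \<le> \<bar>d\<bar>" using not_less_Least[of j "\<lambda>k. 2 * (M / 2 ^ k) \<le> \<bar>d\<bar>"] j k_def by simp
    then have "\<bar>d\<bar> \<le> 4 * (M / 2 ^ k)" using j by simp
    then have "\<bar>d\<bar> powr p \<le> (4 * (M / 2 ^ k)) powr p"
      using assms by (intro powr_mono2) auto
    also have "\<dots> = 4 powr p * (M / 2 ^ k) powr p"
      by (rule powr_mult)
    also have "\<dots> = ?t k" using k by simp
    also have "\<dots> = (\<Sum>i\<in>{k}. ?t i)" by simp
    also have "\<dots> \<le> (\<Sum>k. ?t k)"
      by (rule sum_le_suminf[OF smt]) auto
    finally show ?thesis .
  qed
qed

text \<open>\<open>G\<close> is obtained before path and times, hence serves all of them at once.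
  Splitting \<open>l powr p\<close> as \<open>l powr (p - 2) * l^2\<close> leaves \<open>l^2\<close>
  times a jump count, which \<open>jump_energy\<close> bounds. The remaining weights form a
  geometric series with ratio \<open>(1/2) powr (p - 2)\<close>, the source of the denominator and
  of the condition \<open>2 < p\<close>.\<close>

lemma variation_controlled:
  fixes p M :: real
  assumes "2 < p" "0 < M"
  obtains G where "predictable G"
    "\<And>n z s N. (\<And>i. i \<le> n \<Longrightarrow> z i \<in> {0..M}) \<Longrightarrow> (\<And>j. j < N \<Longrightarrow> s j \<le> s (Suc j)) \<Longrightarrow> s N \<le> n \<Longrightarrow>
      (\<Sum>j<N. \<bar>z (s (Suc j)) - z (s j)\<bar> powr p)
        \<le> 4 powr p / (1 - (1/2) powr (p - 2)) * M powr (p - 2) * (z n)\<^sup>2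
          + (\<Sum>i<n. G i z * (z (Suc i) - z i))"
proof -
  define l where "l = (\<lambda>k::nat. M / 2 ^ k)"
  define w where "w = (\<lambda>k. 4 powr p * l k powr p)"
  define c where "c = (\<lambda>k. 4 powr p * l k powr (p - 2))"
  \<comment> \<open>The factor -2 and the anchors are those of \<open>jump_energy\<close>, summed
    over all levels \<open>k\<close>.\<close>
  define G where "G = (\<lambda>i z. - 2 * (\<Sum>k. c k * fst (jump_state (l k) z i)))"
  have lpos: "0 < l k" for k using assms by (simp add: l_def)
  have pred: "predictable G"
    unfolding predictable_def
  proof (intro allI impI)
    fix i and z z' :: "nat \<Rightarrow> real" assume "\<forall>j\<le>i. z j = z' j"
    then have "jump_state (l k) z i = jump_state (l k) z' i" for k
      by (intro jump_state_cong) auto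
    then show "G i z = G i z'" by (simp add: G_def)
  qed
  have geo: "l k powr (p - 2) = M powr (p - 2) * ((1/2) powr (p - 2)) ^ k" for k
  proof -
    have e: "l k = M * (1/2) ^ k" by (simp add: l_def power_divide)
    show ?thesis unfolding e
      by (subst powr_mult) (use assms in \<open>simp_all add: powr_of_power del: power_one_over\<close>)
  qed
  have lt: "norm ((1/2::real) powr (p - 2)) < 1"
    using assms by (simp add: powr_def ln_div)
  have "(\<lambda>k. 4 powr p * (M powr (p - 2) * ((1/2) powr (p - 2)) ^ k)) sums (4 powr p * (M powr (p - 2) * (1 / (1 - (1/2) powr (p - 2)))))"
    by (intro sums_mult geometric_sums lt)
  then have csums: "c sums (4 powr p / (1 - (1/2) powr (p - 2)) * M powr (p - 2))"
    by (simp add: c_def geo field_simps)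
  have wc: "w k = c k * (l k)\<^sup>2" for k
    using lpos[of k] by (simp add: w_def c_def powr_diff field_simps flip: powr_numeral)
  have cnn: "0 \<le> c k" for k by (simp add: c_def)
  have ws: "summable w"
    using powr_le_dyadic_layers(2)[OF assms(2,1), of 0] assms by (simp add: w_def l_def)
  show ?thesis
  proof (rule that[OF pred])
    fix n N :: nat and z :: "nat \<Rightarrow> real" and s :: "nat \<Rightarrow> nat"
    assume z: "\<And>i. i \<le> n \<Longrightarrow> z i \<in> {0..M}" and s: "\<And>j. j < N \<Longrightarrow> s j \<le> s (Suc j)" and sN: "s N \<le> n"
    let ?I = "\<lambda>k j. if 2 * l k \<le> \<bar>z (s (Suc j)) - z (s j)\<bar> then 1 else (0::real)"
    have smono: "j \<le> N \<Longrightarrow> s j \<le> s N" for j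
      by (induction rule: inc_induct) (auto dest: s intro: order_trans)
    have smI: "summable (\<lambda>k. w k * ?I k j)" for j
      by (rule summable_comparison_test'[OF ws, of 0]) (auto simp: w_def)
    \<comment> \<open>Anchors are values of the path, so on paths in \<open>{0..M}\<close> the
      series defining \<open>G\<close> converges.\<close>
    have sma: "summable (\<lambda>k. c k * fst (jump_state (l k) z i))" if "i < n" for i
    proof (rule summable_comparison_test')
      show "summable (\<lambda>k. c k * M)" using csums by (intro summable_mult2) (rule sums_summable)
      fix k
      have "fst (jump_state (l k) z i) \<in> {0..M}" by (rule jump_anchor_range) (use z that in auto)
      then show "norm (c k * fst (jump_state (l k) z i)) \<le> c k * M"
        using cnn[of k] by (simp add: abs_mult mult_left_mono)
    qed
    have smG: "summable (\<lambda>k. \<Sum>i<n. c k * fst (jump_state (l k) z i) * (z (Suc i) - z i))"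
      by (intro summable_sum summable_mult2 sma) auto
    have e: "(\<lambda>k. c k * ((z n)\<^sup>2 - 2 * (\<Sum>i<n. fst (jump_state (l k) z i) * (z (Suc i) - z i))))
      = (\<lambda>k. c k * (z n)\<^sup>2 - 2 * (\<Sum>i<n. c k * fst (jump_state (l k) z i) * (z (Suc i) - z i)))"
      by (simp add: right_diff_distrib sum_distrib_left mult_ac)
    have "(\<Sum>j<N. \<bar>z (s (Suc j)) - z (s j)\<bar> powr p) \<le> (\<Sum>j<N. \<Sum>k. w k * ?I k j)"
    proof (rule sum_mono)
      fix j assume j: "j \<in> {..<N}"
      have "z (s (Suc j)) \<in> {0..M}" "z (s j) \<in> {0..M}"
        using j smono[of j] smono[of "Suc j"] sN by (auto intro!: z simp del: atLeastAtMost_iff)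
      then have "\<bar>z (s (Suc j)) - z (s j)\<bar> \<le> M" by auto
      from powr_le_dyadic_layers(1)[OF assms(2,1) this]
      show "\<bar>z (s (Suc j)) - z (s j)\<bar> powr p \<le> (\<Sum>k. w k * ?I k j)"
        by (simp add: w_def l_def)
    qed
    also have "\<dots> = (\<Sum>k. \<Sum>j<N. w k * ?I k j)"
      by (rule suminf_sum[symmetric]) (rule smI)
    also have "\<dots> \<le> (\<Sum>k. c k * ((z n)\<^sup>2 - 2 * (\<Sum>i<n. fst (jump_state (l k) z i) * (z (Suc i) - z i))))"
    proof (rule suminf_le)
      fix k
      have "real (\<Sum>j<N. if 2 * l k \<le> \<bar>z (s (Suc j)) - z (s j)\<bar> then 1 else 0)
          \<le> real (snd (jump_state (l k) z (s N)))"
        using card_large_steps_le_jump_count[OF lpos[of k], of N s z] s by (simp only: of_nat_le_iff)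
      also have "real (\<Sum>j<N. if 2 * l k \<le> \<bar>z (s (Suc j)) - z (s j)\<bar> then 1 else 0) = (\<Sum>j<N. ?I k j)"
        by (simp only: of_nat_sum if_distrib[of real] of_nat_1 of_nat_0)
      also have "real (snd (jump_state (l k) z (s N))) \<le> real (snd (jump_state (l k) z n))"
        using jump_count_mono[OF sN] by simp
      finally have cnt: "(\<Sum>j<N. ?I k j) \<le> real (snd (jump_state (l k) z n))" .
      have "(l k)\<^sup>2 * real (snd (jump_state (l k) z n)) 
          \<le> (z n)\<^sup>2 - 2 * (\<Sum>i<n. fst (jump_state (l k) z i) * (z (Suc i) - z i))"
        using jump_energy[of "l k" z n] lpos[of k] zero_le_power2[of "z 0"]
          zero_le_power2[of "z n - fst (jump_state (l k) z n)"] by linarith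
      then have "(l k)\<^sup>2 * (\<Sum>j<N. ?I k j) \<le> (z n)\<^sup>2 - 2 * (\<Sum>i<n. fst (jump_state (l k) z i) * (z (Suc i) - z i))"
        using mult_left_mono[OF cnt zero_le_power2[of "l k"]] by linarith
      then have "c k * ((l k)\<^sup>2 * (\<Sum>j<N. ?I k j)) \<le> c k * ((z n)\<^sup>2 - 2 * (\<Sum>i<n. fst (jump_state (l k) z i) * (z (Suc i) - z i)))"
        by (rule mult_left_mono) (rule cnn)
      then show "(\<Sum>j<N. w k * ?I k j) \<le> c k * ((z n)\<^sup>2 - 2 * (\<Sum>i<n. fst (jump_state (l k) z i) * (z (Suc i) - z i)))"
        by (simp only: wc sum_distrib_left mult.assoc)
    next
      show "summable (\<lambda>k. \<Sum>j<N. w k * ?I k j)" by (intro summable_sum smI)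
    next
      show "summable (\<lambda>k. c k * ((z n)\<^sup>2 - 2 * (\<Sum>i<n. fst (jump_state (l k) z i) * (z (Suc i) - z i))))"
        unfolding e by (intro summable_diff summable_mult summable_mult2 sums_summable[OF csums] smG)
    qed
    also have "\<dots> = (\<Sum>k. c k * (z n)\<^sup>2) - (\<Sum>k. 2 * (\<Sum>i<n. c k * fst (jump_state (l k) z i) * (z (Suc i) - z i)))"
      unfolding e
      by (rule suminf_diff[symmetric])
        (intro summable_mult summable_mult2 sums_summable[OF csums] smG)+
    also have "(\<Sum>k. c k * (z n)\<^sup>2) = (\<Sum>k. c k) * (z n)\<^sup>2"
      by (rule suminf_mult2[symmetric]) (rule sums_summable[OF csums])
    also have "(\<Sum>k. 2 * (\<Sum>i<n. c k * fst (jump_state (l k) z i) * (z (Suc i) - z i)))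
        = 2 * (\<Sum>i<n. (\<Sum>k. c k * fst (jump_state (l k) z i)) * (z (Suc i) - z i))"
      using smG sma
      by (subst suminf_mult, simp, subst suminf_sum)
         (auto simp: suminf_mult2 intro!: summable_mult2)
    also have "(\<Sum>k. c k) * (z n)\<^sup>2 - \<dots>
       = 4 powr p / (1 - (1/2) powr (p - 2)) * M powr (p - 2) * (z n)\<^sup>2 + (\<Sum>i<n. G i z * (z (Suc i) - z i))"
      by (simp add: G_def sum_distrib_left sum_negf mult.assoc flip: sums_unique[OF csums])
    finally show "(\<Sum>j<N. \<bar>z (s (Suc j)) - z (s j)\<bar> powr p)
        \<le> 4 powr p / (1 - (1/2) powr (p - 2)) * M powr (p - 2) * (z n)\<^sup>2
          + (\<Sum>i<n. G i z * (z (Suc i) - z i))" .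
  qed
qed

section \<open>Oscillation within fixed blocks of times\<close>

definition run_dev :: "(nat \<Rightarrow> real) \<Rightarrow> nat \<Rightarrow> nat \<Rightarrow> real" where
  "run_dev z a i = Max ((\<lambda>j. \<bar>z j - z a\<bar>) ` {a..i})"

lemma run_dev_self: "run_dev z a a = 0"
  by (simp add: run_dev_def)

lemma run_dev_Suc: "a \<le> i \<Longrightarrow> run_dev z a (Suc i) = max \<bar>z (Suc i) - z a\<bar> (run_dev z a i)"
  by (simp add: run_dev_def atLeastAtMostSuc_conv)

lemma run_dev_ge: "a \<le> j \<Longrightarrow> j \<le> i \<Longrightarrow> \<bar>z j - z a\<bar> \<le> run_dev z a i"
  by (simp add: run_dev_def)

lemma run_dev_cong: "a \<le> i \<Longrightarrow> (\<And>j. j \<le> i \<Longrightarrow> z j = z' j) \<Longrightarrow> run_dev z a i = run_dev z' a i"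
  by (simp add: run_dev_def)

text \<open>A pathwise form of Doob's maximal inequality: \<open>d\<^sup>2 - 4 y\<^sup>2 \<le> 2 d\<^sup>2 - 4 \<bar>y\<bar> d\<close>, and the right-hand
  side is a supermartingale when \<open>y\<close> is a martingale with running maximum \<open>d\<close>.\<close>

lemma pathwise_doob:
  assumes "a \<le> b"
  shows "(run_dev z a b)\<^sup>2 \<le> 4 * (z b - z a)\<^sup>2
     - 4 * (\<Sum>i=a..<b. run_dev z a i * sgn (z i - z a) * (z (Suc i) - z i))"
proof -
  have "2 * (run_dev z a b)\<^sup>2 - 4 * \<bar>z b - z a\<bar> * run_dev z a b
     \<le> - 4 * (\<Sum>i=a..<b. run_dev z a i * sgn (z i - z a) * (z (Suc i) - z i))"
    using assms
  proof (induction rule: dec_induct)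
    case base
    then show ?case by (simp add: run_dev_self)
  next
    case (step n)
    define y y' d where "y = z n - z a" and "y' = z (Suc n) - z a" and "d = run_dev z a n"
    have d: "\<bar>y\<bar> \<le> d" unfolding y_def d_def by (rule run_dev_ge) (use step.hyps in auto)
    \<comment> \<open>\<open>sgn y\<close> is a subgradient of the absolute value at
      \<open>y\<close>.\<close>
    have yy: "sgn y * (y' - y) \<le> \<bar>y'\<bar> - \<bar>y\<bar>"
      by (cases "y = 0"; cases "y > 0") (auto simp: sgn_if)
    have "d * (sgn y * (y' - y)) \<le> d * (\<bar>y'\<bar> - \<bar>y\<bar>)"
      using d by (intro mult_left_mono yy) linarith
    then have k: "- 4 * (\<bar>y'\<bar> * d) \<le> - 4 * (\<bar>y\<bar> * d) - 4 * (d * sgn y * (y' - y))"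
      by (simp add: algebra_simps)
    \<comment> \<open>At a new maximum the right side exceeds the left by exactly
      \<open>2 * (\<bar>y'\<bar> - d)^2\<close>.\<close>
    have "2 * (max \<bar>y'\<bar> d)\<^sup>2 - 4 * (\<bar>y'\<bar> * max \<bar>y'\<bar> d) \<le> 2 * d\<^sup>2 - 4 * (\<bar>y'\<bar> * d)"
    proof (cases "\<bar>y'\<bar> \<le> d")
      case False
      have "0 \<le> 2 * (\<bar>y'\<bar> - d)\<^sup>2" by simp
      then show ?thesis using False by (simp add: max_def power2_eq_square algebra_simps)
    qed (simp add: max_def)
    with k have "2 * (max \<bar>y'\<bar> d)\<^sup>2 - 4 * (\<bar>y'\<bar> * max \<bar>y'\<bar> d) \<le> 2 * d\<^sup>2 - 4 * (\<bar>y\<bar> * d) - 4 * (d * sgn y * (y' - y))"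
      by linarith
    moreover have "y' - y = z (Suc n) - z n" by (simp add: y_def y'_def)
    ultimately have "2 * (run_dev z a (Suc n))\<^sup>2 - 4 * \<bar>z (Suc n) - z a\<bar> * run_dev z a (Suc n)
       \<le> 2 * (run_dev z a n)\<^sup>2 - 4 * \<bar>z n - z a\<bar> * run_dev z a n
         - 4 * (run_dev z a n * sgn (z n - z a) * (z (Suc n) - z n))"
      unfolding run_dev_Suc[OF step.hyps(1)] y_def[symmetric] y'_def[symmetric] d_def[symmetric]
      by (simp add: mult.assoc)
    then show ?case using step.IH step.hyps by simp
  qed
  moreover have "0 \<le> (run_dev z a b - 2 * \<bar>z b - z a\<bar>)\<^sup>2" by simp
  ultimately show ?thesis by (simp add: power2_eq_square algebra_simps)
qed

text \<open>Both values lie within the running deviation of \<open>z a\<close>, which gives a factor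
  2, squared to 4; Doob's constant 4 makes it 16. Writing \<open>(z b - z a)^2\<close> as a
  difference of squares minus a martingale term lets neighbouring blocks telescope.\<close>

lemma block_oscillation_controlled:
  assumes "a \<le> k" "k \<le> b" "a \<le> l" "l \<le> b"
  shows "(z k - z l)\<^sup>2 \<le> 16 * (z b)\<^sup>2 - 16 * (z a)\<^sup>2
     + (\<Sum>i=a..<b. (- 32 * z a - 16 * run_dev z a i * sgn (z i - z a)) * (z (Suc i) - z i))"
proof -
  have ab: "a \<le> b" using assms by simp
  have "\<bar>z k - z l\<bar> \<le> 2 * run_dev z a b"
    using run_dev_ge[of a k b z] run_dev_ge[of a l b z] assms by linarith
  then have "(z k - z l)\<^sup>2 \<le> (2 * run_dev z a b)\<^sup>2"
    by (metis abs_ge_zero power2_abs power_mono)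
  also have "\<dots> \<le> 16 * (z b - z a)\<^sup>2 - 16 * (\<Sum>i=a..<b. run_dev z a i * sgn (z i - z a) * (z (Suc i) - z i))"
    using pathwise_doob[OF ab, of z] by (simp add: power2_eq_square)
  also have "16 * (z b - z a)\<^sup>2 = 16 * (z b)\<^sup>2 - 16 * (z a)\<^sup>2 - 32 * z a * (z b - z a)"
    by (simp add: power2_eq_square algebra_simps)
  also have "32 * z a * (z b - z a) = (\<Sum>i=a..<b. 32 * z a * (z (Suc i) - z i))"
    using sum_Suc_diff'[OF ab, of z] by (simp flip: sum_distrib_left)
  finally show ?thesis
    by (simp add: left_diff_distrib sum_subtractf sum_negf sum_distrib_left mult.assoc)
qed

text \<open>\<open>G\<close> runs through the integrands of the consecutive blocks, so it depends on
  the block boundaries but not on the two times picked in each block. The case \<open>N' < N\<close>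
  covers members of a family with fewer intervals.\<close>

lemma oscillation_controlled:
  fixes b :: "nat \<Rightarrow> nat"
  assumes "\<And>j. j < N \<Longrightarrow> b j \<le> b (Suc j)" "b 0 = 0" "b N = n"
  obtains G where "predictable G"
    "\<And>z N' k l. N' \<le> N \<Longrightarrow> (\<And>j. j < N' \<Longrightarrow> {k j, l j} \<subseteq> {b j..b (Suc j)}) \<Longrightarrow>
      (\<Sum>j<N'. (z (k j) - z (l j))\<^sup>2) \<le> 16 * (z n)\<^sup>2 + (\<Sum>i<n. G i z * (z (Suc i) - z i))"
proof -
  define g where "g = (\<lambda>a i (z::nat \<Rightarrow> real). - 32 * z a - 16 * run_dev z a i * sgn (z i - z a))"
  define G where "G = (\<lambda>i z. \<Sum>j<N. if b j \<le> i \<and> i < b (Suc j) then g (b j) i z else 0)"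
  have pred: "predictable G"
    unfolding predictable_def
  proof (intro allI impI)
    fix i and z z' :: "nat \<Rightarrow> real" assume e: "\<forall>j\<le>i. z j = z' j"
    have "g a i z = g a i z'" if "a \<le> i" for a
      using that e run_dev_cong[of a i z z'] by (simp add: g_def)
    then show "G i z = G i z'" by (auto simp: G_def intro!: sum.cong)
  qed
  have bmono: "j \<le> N \<Longrightarrow> b j \<le> n" for j
    by (induction rule: inc_induct) (auto simp: assms(3) dest: assms(1) intro: order_trans)
  show ?thesis
  proof (rule that[OF pred])
    fix z :: "nat \<Rightarrow> real" and N' and k l :: "nat \<Rightarrow> nat"
    assume N': "N' \<le> N" and kl: "\<And>j. j < N' \<Longrightarrow> {k j, l j} \<subseteq> {b j..b (Suc j)}"
    \<comment> \<open>Blocks from \<open>N'\<close> on get two equal times and contribute zero, so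
      that the sum always runs over all blocks and telescopes to \<open>z n\<close>.\<close>
    let ?k = "\<lambda>j. if j < N' then k j else b j" and ?l = "\<lambda>j. if j < N' then l j else b j"
    have "(\<Sum>j<N'. (z (k j) - z (l j))\<^sup>2) = (\<Sum>j<N'. (z (?k j) - z (?l j))\<^sup>2)"
      by simp
    also have "\<dots> \<le> (\<Sum>j<N. (z (?k j) - z (?l j))\<^sup>2)"
      by (rule sum_mono2) (use N' in auto)
    also have "\<dots> \<le> (\<Sum>j<N. 16 * (z (b (Suc j)))\<^sup>2 - 16 * (z (b j))\<^sup>2
        + (\<Sum>i=b j..<b (Suc j). g (b j) i z * (z (Suc i) - z i)))"
      unfolding g_def
      by (intro sum_mono block_oscillation_controlled) (use kl assms(1) in auto)
    also have "\<dots> = 16 * (z n)\<^sup>2 - 16 * (z 0)\<^sup>2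
        + (\<Sum>j<N. \<Sum>i=b j..<b (Suc j). g (b j) i z * (z (Suc i) - z i))"
      using sum_lessThan_telescope[of "\<lambda>j. 16 * (z (b j))\<^sup>2" N]
      by (simp add: sum.distrib assms(2,3))
    also have "(\<Sum>j<N. \<Sum>i=b j..<b (Suc j). g (b j) i z * (z (Suc i) - z i))
      = (\<Sum>j<N. \<Sum>i<n. if b j \<le> i \<and> i < b (Suc j) then g (b j) i z * (z (Suc i) - z i) else 0)"
      by (intro sum.cong refl sum.mono_neutral_cong_left) (use bmono in \<open>auto intro: less_le_trans\<close>)
    also have "\<dots> = (\<Sum>i<n. G i z * (z (Suc i) - z i))"
      by (subst sum.swap) (auto simp: G_def sum_distrib_right intro!: sum.cong)
    finally show "(\<Sum>j<N'. (z (k j) - z (l j))\<^sup>2) \<le> 16 * (z n)\<^sup>2 + (\<Sum>i<n. G i z * (z (Suc i) - z i))"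
      using zero_le_power2[of "z 0"] by linarith
  qed
qed

section \<open>Symmetric Markov semigroups\<close>

text \<open>Away from zero this is convexity of the power on the positive axis, applied to absolute
  values. If one of the points is zero, the claim reduces to \<open>s powr p \<le> s\<close> for
  \<open>0 < s < 1\<close>.\<close>

lemma convex_abs_powr:
  fixes p :: real
  assumes "1 \<le> p"
  shows "convex_on UNIV (\<lambda>x::real. \<bar>x\<bar> powr p)"
proof (rule convex_onI)
  fix t x y :: real assume t: "0 < t" "t < 1"
  have "\<bar>(1 - t) *\<^sub>R x + t *\<^sub>R y\<bar> \<le> (1 - t) * \<bar>x\<bar> + t * \<bar>y\<bar>"
    using t by (simp add: abs_triangle_ineq[THEN order_trans] abs_mult)
  then have "\<bar>(1 - t) *\<^sub>R x + t *\<^sub>R y\<bar> powr p \<le> ((1 - t) * \<bar>x\<bar> + t * \<bar>y\<bar>) powr p"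
    using assms by (intro powr_mono2) auto
  also have "\<dots> \<le> (1 - t) * \<bar>x\<bar> powr p + t * \<bar>y\<bar> powr p"
  proof -
    have small: "s powr p \<le> s" if "0 < s" "s < 1" for s :: real
      using powr_mono'[of 1 p s] that assms by simp
    consider "x = 0" | "y = 0" | "x \<noteq> 0" "y \<noteq> 0" by auto
    then show ?thesis
    proof cases
      case 1
      then show ?thesis using t small[of t] by (simp add: powr_mult mult_right_mono)
    next
      case 2
      then show ?thesis using t small[of "1 - t"] by (simp add: powr_mult mult_right_mono)
    next
      case 3
      then show ?thesis
        using convex_onD[OF powr_convex[OF assms], of t "\<bar>x\<bar>" "\<bar>y\<bar>"] t by simp
    qed
  qed
  finally show "\<bar>(1 - t) *\<^sub>R x + t *\<^sub>R y\<bar> powr p \<le> (1 - t) * \<bar>x\<bar> powr p + t * \<bar>y\<bar> powr p" .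
qed simp

lemma (in prob_space) jensen_abs_powr:
  fixes X :: "'a \<Rightarrow> real"
  assumes p: "1 \<le> p" and X[measurable]: "X \<in> borel_measurable M" and b: "\<And>x. x \<in> space M \<Longrightarrow> \<bar>X x\<bar> \<le> B"
  shows "ennreal (\<bar>expectation X\<bar> powr p) \<le> (\<integral>\<^sup>+x. ennreal (\<bar>X x\<bar> powr p) \<partial>M)"
proof -
  have iX: "integrable M X"
    by (rule integrable_const_bound[of _ B]) (use b in auto)
  have iq: "integrable M (\<lambda>x. \<bar>X x\<bar> powr p)"
    by (rule integrable_const_bound[of _ "B powr p"])
       (use b p in \<open>auto intro!: powr_mono2 AE_I2\<close>)
  have "\<bar>expectation X\<bar> powr p \<le> expectation (\<lambda>x. \<bar>X x\<bar> powr p)"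
    by (rule jensens_inequality[where I = UNIV and q = "\<lambda>x. \<bar>x\<bar> powr p"])
       (use iX iq convex_abs_powr[OF p] in auto)
  then show ?thesis
    by (subst nn_integral_eq_integral[OF iq]) (auto simp: ennreal_leI)
qed

section \<open>Transition kernels and their semigroup\<close>

locale symmetric_markov_semigroup = sigma_finite_measure m
  for m :: "'a measure" +
  fixes w :: "real \<Rightarrow> 'a \<Rightarrow> 'a \<Rightarrow> real"
  assumes kernel_measurable: "0 < u \<Longrightarrow> (\<lambda>(x, y). w u x y) \<in> borel_measurable (m \<Otimes>\<^sub>M m)"
    and kernel_nonneg: "0 < u \<Longrightarrow> x \<in> space m \<Longrightarrow> y \<in> space m \<Longrightarrow> 0 \<le> w u x y"
    and kernel_sym: "0 < u \<Longrightarrow> x \<in> space m \<Longrightarrow> y \<in> space m \<Longrightarrow> w u x y = w u y x"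
    and kernel_mass: "0 < u \<Longrightarrow> x \<in> space m \<Longrightarrow> (\<integral>\<^sup>+y. ennreal (w u x y) \<partial>m) = 1"
    and kernel_semigroup: "0 < s \<Longrightarrow> 0 < t \<Longrightarrow> x \<in> space m \<Longrightarrow> z \<in> space m \<Longrightarrow>
      (\<integral>\<^sup>+y. ennreal (w s x y) * ennreal (w t y z) \<partial>m) = ennreal (w (s + t) x z)"
begin

definition W :: "real \<Rightarrow> ('a \<Rightarrow> real) \<Rightarrow> 'a \<Rightarrow> real" where
  "W u f x = (LINT y|m. w u x y * f y)"

lemma kernel_measurable':
  assumes "0 < u" "f \<in> measurable N m" "g \<in> measurable N m"
  shows "(\<lambda>x. w u (f x) (g x)) \<in> borel_measurable N"
  using measurable_compose[OF measurable_Pair[OF assms(2,3)] kernel_measurable[OF assms(1)]] by simp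

lemma kernel_measurable_right [measurable]:
  "0 < u \<Longrightarrow> x \<in> space m \<Longrightarrow> w u x \<in> borel_measurable m"
  by (rule kernel_measurable') simp_all

text \<open>The transition law from \<open>x\<close>. As a probability measure, it gives access to
  Jensen's inequality and to the nonnegativity of variances.\<close>

definition K :: "real \<Rightarrow> 'a \<Rightarrow> 'a measure" where
  "K u x = density m (\<lambda>y. ennreal (w u x y))"

lemma sets_K [measurable_cong, simp]: "sets (K u x) = sets m"
  and space_K [simp]: "space (K u x) = space m"
  by (simp_all add: K_def)

lemma prob_K: "0 < u \<Longrightarrow> x \<in> space m \<Longrightarrow> prob_space (K u x)"
  by (intro prob_spaceI) (simp add: K_def emeasure_density kernel_mass cong: nn_integral_cong)

lemma nn_integral_K:
  assumes "0 < u" "x \<in> space m" "f \<in> borel_measurable m"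
  shows "(\<integral>\<^sup>+y. f y \<partial>K u x) = (\<integral>\<^sup>+y. ennreal (w u x y) * f y \<partial>m)"
  unfolding K_def using assms by (intro nn_integral_density) auto

lemma W_eq_integral_K:
  assumes "0 < u" "x \<in> space m" "f \<in> borel_measurable m"
  shows "W u f x = (LINT y|K u x. f y)"
  unfolding W_def K_def using assms kernel_nonneg
  by (subst integral_density) (auto intro!: AE_I2)

lemma kernel_integrable:
  fixes f :: "'a \<Rightarrow> real"
  assumes "0 < u" "x \<in> space m" "f \<in> borel_measurable m" "\<And>y. y \<in> space m \<Longrightarrow> \<bar>f y\<bar> \<le> B"
  shows "integrable m (\<lambda>y. w u x y * f y)"
proof -
  interpret K: prob_space "K u x" by (rule prob_K) fact+
  have "integrable (K u x) f"
    by (rule K.integrable_const_bound[of _ B]) (use assms in \<open>auto intro!: AE_I2\<close>)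
  then show ?thesis
    unfolding K_def using assms kernel_nonneg
    by (subst (asm) integrable_density) (auto intro!: AE_I2)
qed

lemma nn_W:
  assumes "0 < u" "x \<in> space m" "f \<in> borel_measurable m" "\<And>y. y \<in> space m \<Longrightarrow> 0 \<le> f y \<and> f y \<le> B"
  shows "ennreal (W u f x) = (\<integral>\<^sup>+y. ennreal (w u x y) * ennreal (f y) \<partial>m)"
proof -
  have "ennreal (W u f x) = (\<integral>\<^sup>+y. ennreal (w u x y * f y) \<partial>m)"
    unfolding W_def using assms kernel_nonneg
    by (intro nn_integral_eq_integral[symmetric] kernel_integrable[where B = B] AE_I2) auto
  also have "\<dots> = (\<integral>\<^sup>+y. ennreal (w u x y) * ennreal (f y) \<partial>m)"
    using assms kernel_nonneg by (intro nn_integral_cong) (simp add: ennreal_mult)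
  finally show ?thesis .
qed

lemma W_range:
  assumes "0 < u" "x \<in> space m" "f \<in> borel_measurable m" "\<And>y. y \<in> space m \<Longrightarrow> 0 \<le> f y \<and> f y \<le> B"
  shows "0 \<le> W u f x \<and> W u f x \<le> B"
proof -
  interpret K: prob_space "K u x" by (rule prob_K) fact+
  have "integrable (K u x) f"
    by (rule K.integrable_const_bound[of _ B]) (use assms in \<open>auto intro!: AE_I2\<close>)
  then have "0 \<le> (LINT y|K u x. f y)" "(LINT y|K u x. f y) \<le> B"
    by (auto intro!: integral_nonneg_AE K.integral_le_const AE_I2 simp: assms(4))
  then show ?thesis using assms by (simp add: W_eq_integral_K)
qed

lemma W_measurable [measurable]:
  assumes [measurable]: "0 < u" "f \<in> borel_measurable m"
  shows "W u f \<in> borel_measurable m"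
proof -
  have [measurable]: "(\<lambda>(x, y). w u x y * f y) \<in> borel_measurable (m \<Otimes>\<^sub>M m)"
    using kernel_measurable[OF assms(1)] by (auto simp: split_beta')
  show ?thesis unfolding W_def by measurable
qed

lemma W_semigroup:
  assumes st: "0 < s" "0 < t" and x: "x \<in> space m"
    and f[measurable]: "f \<in> borel_measurable m" and b: "\<And>y. y \<in> space m \<Longrightarrow> 0 \<le> f y \<and> f y \<le> B"
  shows "W s (W t f) x = W (s + t) f x"
proof -
  have r: "0 \<le> W t f y \<and> W t f y \<le> B" if "y \<in> space m" for y
    using W_range[OF st(2) that f b] .
  note [measurable] = kernel_measurable'[OF st(1)] kernel_measurable'[OF st(2)]
  have "ennreal (W s (W t f) x) = (\<integral>\<^sup>+y. ennreal (w s x y) * (\<integral>\<^sup>+z. ennreal (w t y z) * ennreal (f z) \<partial>m) \<partial>m)"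
    using st x by (subst nn_W[OF st(1) x _ r]) (auto intro!: nn_integral_cong simp: nn_W[OF st(2) _ f b])
  also have "\<dots> = (\<integral>\<^sup>+y. (\<integral>\<^sup>+z. ennreal (w s x y) * (ennreal (w t y z) * ennreal (f z)) \<partial>m) \<partial>m)"
    using st x by (intro nn_integral_cong nn_integral_cmult[symmetric]) measurable
  also have "\<dots> = (\<integral>\<^sup>+z. (\<integral>\<^sup>+y. ennreal (w s x y) * (ennreal (w t y z) * ennreal (f z)) \<partial>m) \<partial>m)"
  proof -
    interpret pair_sigma_finite m m ..
    show ?thesis using st x by (intro Fubini') measurable
  qed
  also have "\<dots> = (\<integral>\<^sup>+z. (\<integral>\<^sup>+y. ennreal (w s x y) * ennreal (w t y z) \<partial>m) * ennreal (f z) \<partial>m)"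
    using st x by (intro nn_integral_cong) (subst nn_integral_multc[symmetric], auto simp: mult.assoc)
  also have "\<dots> = (\<integral>\<^sup>+z. ennreal (w (s + t) x z) * ennreal (f z) \<partial>m)"
    using st x by (intro nn_integral_cong) (simp add: kernel_semigroup)
  also have "\<dots> = ennreal (W (s + t) f x)"
    using st x by (intro nn_W[symmetric, where B = B] f b) auto
  finally show ?thesis
    using W_range[OF st(1) x _ r] W_range[of "s + t" x f B] st x b by simp
qed

text \<open>By symmetry the kernel has mass one in its first argument too, so \<open>m\<close> is an
  invariant measure.\<close>

lemma W_nn_integral:
  assumes u: "0 < u" and f[measurable]: "f \<in> borel_measurable m" and b: "\<And>y. y \<in> space m \<Longrightarrow> 0 \<le> f y \<and> f y \<le> B"
  shows "(\<integral>\<^sup>+x. ennreal (W u f x) \<partial>m) = (\<integral>\<^sup>+x. ennreal (f x) \<partial>m)"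
proof -
  interpret pair_sigma_finite m m ..
  note [measurable] = kernel_measurable'[OF u]
  have "(\<integral>\<^sup>+x. ennreal (W u f x) \<partial>m) = (\<integral>\<^sup>+x. (\<integral>\<^sup>+y. ennreal (w u x y) * ennreal (f y) \<partial>m) \<partial>m)"
    by (intro nn_integral_cong nn_W[OF u _ f b]) auto
  also have "\<dots> = (\<integral>\<^sup>+y. (\<integral>\<^sup>+x. ennreal (w u x y) * ennreal (f y) \<partial>m) \<partial>m)"
    by (intro Fubini') measurable
  also have "\<dots> = (\<integral>\<^sup>+y. (\<integral>\<^sup>+x. ennreal (w u y x) \<partial>m) * ennreal (f y) \<partial>m)"
    using u by (intro nn_integral_cong)
      (subst nn_integral_multc[symmetric], auto intro!: nn_integral_cong simp: kernel_sym)
  also have "\<dots> = (\<integral>\<^sup>+y. ennreal (f y) \<partial>m)"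
    using u by (intro nn_integral_cong) (simp add: kernel_mass)
  finally show ?thesis .
qed

lemma W_square_le:
  assumes u: "0 < u" and x: "x \<in> space m" and f[measurable]: "f \<in> borel_measurable m"
    and b: "\<And>y. y \<in> space m \<Longrightarrow> 0 \<le> f y \<and> f y \<le> B"
  shows "(W u f x)\<^sup>2 \<le> W u (\<lambda>y. (f y)\<^sup>2) x"
proof -
  interpret K: prob_space "K u x" by (rule prob_K) fact+
  have i1: "integrable (K u x) f" and i2: "integrable (K u x) (\<lambda>y. (f y)\<^sup>2)"
    by (rule K.integrable_const_bound[of _ B] K.integrable_const_bound[of _ "B\<^sup>2"];
        use b in \<open>auto intro!: AE_I2 power_mono\<close>)+
  show ?thesis
    using K.variance_positive[of f] K.variance_eq[OF i1 i2]
    by (simp add: W_eq_integral_K[OF u x])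
qed


text \<open>Functionals of a state and a path that satisfy Jensen's inequality in the path while the
  state is held fixed. The inequality is built in as the defining property because it passes
  directly through an integral over states; this closure is what carries the induction in
  \<open>rota_step\<close>.\<close>

definition jensen_functional :: "('a \<Rightarrow> (nat \<Rightarrow> real) \<Rightarrow> ennreal) \<Rightarrow> bool" where
  "jensen_functional \<Psi> \<longleftrightarrow>
     (\<lambda>(x, z). \<Psi> x z) \<in> borel_measurable (m \<Otimes>\<^sub>M (\<Pi>\<^sub>M i\<in>UNIV. borel)) \<and>
     (\<forall>x\<in>space m. \<forall>N g B. prob_space N \<and> sets N = sets m \<and>
        (\<forall>i. g i \<in> borel_measurable N \<and> (\<forall>y\<in>space N. \<bar>g i y\<bar> \<le> B)) \<longrightarrow>
        \<Psi> x (\<lambda>i. LINT y|N. g i y) \<le> (\<integral>\<^sup>+y. \<Psi> x (\<lambda>i. g i y) \<partial>N))"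

lemma jensen_functional_measurable:
  assumes "jensen_functional \<Psi>" "f \<in> measurable N m" "\<And>i. g i \<in> borel_measurable N"
  shows "(\<lambda>x. \<Psi> (f x) (\<lambda>i. g i x)) \<in> borel_measurable N"
proof -
  have "(\<lambda>x. (f x, \<lambda>i. g i x)) \<in> measurable N (m \<Otimes>\<^sub>M (\<Pi>\<^sub>M i\<in>UNIV. borel))"
    by (intro measurable_Pair assms(2) measurable_PiM_single') (use assms(3) in auto)
  from measurable_compose[OF this conjunct1[OF assms(1)[unfolded jensen_functional_def]]]
  show ?thesis by simp
qed

text \<open>Overwriting a coordinate by a function of the integrated state and averaging with a
  nonnegative kernel preserves Jensen's inequality, by Tonelli. The new functional sees the
  coordinate \<open>k\<close> only through \<open>h\<close>.\<close>

lemma jensen_functional_step: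
  assumes \<Psi>: "jensen_functional \<Psi>" and v: "0 < v"
    and h[measurable]: "h \<in> borel_measurable m" and hb: "\<And>x. x \<in> space m \<Longrightarrow> 0 \<le> h x \<and> h x \<le> B"
  shows "jensen_functional (\<lambda>x' z. \<integral>\<^sup>+x. ennreal (w v x' x) * \<Psi> x (z(k := h x)) \<partial>m)"
  unfolding jensen_functional_def
proof (intro conjI ballI allI impI)
  note [measurable] = kernel_measurable'[OF v] jensen_functional_measurable[OF \<Psi>]
  have *: "(\<lambda>p. (snd (fst p) :: nat \<Rightarrow> real) i) \<in> borel_measurable ((m \<Otimes>\<^sub>M (\<Pi>\<^sub>M i\<in>UNIV. borel)) \<Otimes>\<^sub>M m)" for i
    by (rule measurable_compose[OF measurable_compose[OF measurable_fst measurable_snd]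
          measurable_component_singleton]) simp
  have "(\<lambda>p. \<Psi> (snd p) (\<lambda>i. if i = k then h (snd p) else snd (fst p) i))
      \<in> borel_measurable ((m \<Otimes>\<^sub>M (\<Pi>\<^sub>M i\<in>UNIV. borel)) \<Otimes>\<^sub>M m)"
    by (rule jensen_functional_measurable[OF \<Psi>]) (auto intro: *)
  then have [measurable]: "(\<lambda>p. \<Psi> (snd p) ((snd (fst p))(k := h (snd p))))
      \<in> borel_measurable ((m \<Otimes>\<^sub>M (\<Pi>\<^sub>M i\<in>UNIV. borel)) \<Otimes>\<^sub>M m)"
    by (simp add: fun_upd_def)
  show "(\<lambda>(x', z). \<integral>\<^sup>+x. ennreal (w v x' x) * \<Psi> x (z(k := h x)) \<partial>m) \<in> borel_measurable (m \<Otimes>\<^sub>M (\<Pi>\<^sub>M i\<in>UNIV. borel))"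
    unfolding split_beta' by (rule borel_measurable_nn_integral) (simp add: split_beta')
  fix x N and g :: "nat \<Rightarrow> 'a \<Rightarrow> real" and b
  assume x: "x \<in> space m" and N: "prob_space N \<and> sets N = sets m \<and>
    (\<forall>i. g i \<in> borel_measurable N \<and> (\<forall>y\<in>space N. \<bar>g i y\<bar> \<le> b))"
  interpret N: prob_space N using N by simp
  interpret P: pair_sigma_finite N m ..
  have [measurable]: "g i \<in> borel_measurable N" for i using N by simp
  let ?g = "\<lambda>x' i y. if i = k then h x' else g i y"
  have B0: "0 \<le> B" if "x' \<in> space m" for x' using hb[OF that] by simp
  have b0: "0 \<le> b" using N N.not_empty by (metis abs_ge_zero order_trans equals0I)
  have J: "\<Psi> x' (\<lambda>i. LINT y|N. ?g x' i y) \<le> (\<integral>\<^sup>+y. \<Psi> x' (\<lambda>i. ?g x' i y) \<partial>N)" if x': "x' \<in> space m" for x'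
  proof -
    have "\<bar>?g x' i y\<bar> \<le> B + b" if "y \<in> space N" for i y
    proof -
      have "\<bar>g i y\<bar> \<le> b" using N that by blast
      then show ?thesis using hb[OF x'] b0 by auto
    qed
    moreover have "?g x' i \<in> borel_measurable N" for i by measurable
    ultimately show ?thesis
      using \<Psi>[unfolded jensen_functional_def, THEN conjunct2, rule_format, OF x', of N "?g x'" "B + b"] N
      by blast
  qed
  \<comment> \<open>The overwritten coordinate is constant in \<open>y\<close> and \<open>N\<close>
    has mass one, so averaging commutes with the update.\<close>
  have e: "(\<lambda>i. LINT y|N. ?g x' i y) = (\<lambda>i. LINT y|N. g i y)(k := h x')" for x'
    by (auto simp: fun_eq_iff N.prob_space)
  have e': "(\<lambda>i. ?g x' i y) = (\<lambda>i. g i y)(k := h x')" for x' y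
    by (auto simp: fun_eq_iff)
  have [measurable]: "(\<lambda>p. \<Psi> (snd p) ((\<lambda>i. g i (fst p))(k := h (snd p)))) \<in> borel_measurable (N \<Otimes>\<^sub>M m)"
    unfolding fun_upd_def by (rule jensen_functional_measurable[OF \<Psi>]) measurable
  have "(\<integral>\<^sup>+x'. ennreal (w v x x') * \<Psi> x' ((\<lambda>i. LINT y|N. g i y)(k := h x')) \<partial>m)
     \<le> (\<integral>\<^sup>+x'. ennreal (w v x x') * (\<integral>\<^sup>+y. \<Psi> x' ((\<lambda>i. g i y)(k := h x')) \<partial>N) \<partial>m)"
    using J unfolding e e' by (intro nn_integral_mono mult_left_mono) auto
  also have "\<dots> = (\<integral>\<^sup>+x'. (\<integral>\<^sup>+y. ennreal (w v x x') * \<Psi> x' ((\<lambda>i. g i y)(k := h x')) \<partial>N) \<partial>m)"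
  proof (intro nn_integral_cong nn_integral_cmult[symmetric])
    fix x' assume "x' \<in> space m"
    then show "(\<lambda>y. \<Psi> x' ((\<lambda>i. g i y)(k := h x'))) \<in> borel_measurable N"
      unfolding fun_upd_def by (intro jensen_functional_measurable[OF \<Psi>]) auto
  qed
  also have "\<dots> = (\<integral>\<^sup>+y. (\<integral>\<^sup>+x'. ennreal (w v x x') * \<Psi> x' ((\<lambda>i. g i y)(k := h x')) \<partial>m) \<partial>N)"
    using x by (intro P.Fubini') measurable
  finally show "(\<integral>\<^sup>+x'. ennreal (w v x x') * \<Psi> x' ((\<lambda>i. LINT y|N. g i y)(k := h x')) \<partial>m)
     \<le> (\<integral>\<^sup>+y. (\<integral>\<^sup>+x'. ennreal (w v x x') * \<Psi> x' ((\<lambda>i. g i y)(k := h x')) \<partial>m) \<partial>N)" .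
qed

text \<open>
  Rota's dilation, one time step at a time: \<open>W (u i) f = W (u n / 2) (W (u i - u n / 2) f)\<close> and the
  functions \<open>W (u i / 2) f\<close> evaluated along the reversible Markov chain form a martingale in \<open>i\<close>.
  The chain is integrated out from its last state.
\<close>

lemma rota_step:
  assumes f[measurable]: "f \<in> borel_measurable m" and b: "\<And>y. y \<in> space m \<Longrightarrow> 0 \<le> f y \<and> f y \<le> M"
    and G: "predictable G" and "0 \<le> C"
    and "\<And>i. i < n \<Longrightarrow> u (Suc i) < u i" "\<And>i. i \<le> n \<Longrightarrow> 0 < u i"
    and "jensen_functional \<Psi>"
    and "\<And>x z. x \<in> space m \<Longrightarrow> z n = W (u n / 2) f x \<Longrightarrow> (\<And>i. i \<le> n \<Longrightarrow> z i \<in> {0..M}) \<Longrightarrow>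
       0 \<le> C * W (u n / 2) (\<lambda>y. (f y)\<^sup>2) x + (\<Sum>i<n. G i z * (z (Suc i) - z i)) \<and>
       \<Psi> x z \<le> ennreal (C * W (u n / 2) (\<lambda>y. (f y)\<^sup>2) x + (\<Sum>i<n. G i z * (z (Suc i) - z i)))"
  shows "(\<integral>\<^sup>+x. \<Psi> x (\<lambda>i. if i \<le> n then W (u i - u n / 2) f x else 0) \<partial>m)
     \<le> ennreal C * (\<integral>\<^sup>+x. ennreal ((f x)\<^sup>2) \<partial>m)"
  using assms(5-)
proof (induction n arbitrary: \<Psi>)
  case 0
  have u0: "0 < u 0 / 2" using "0.prems"(2) by simp
  have r: "0 \<le> (f y)\<^sup>2 \<and> (f y)\<^sup>2 \<le> M\<^sup>2" if "y \<in> space m" for y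
    using b[OF that] by (auto intro: power_mono)
  have "(\<integral>\<^sup>+x. \<Psi> x (\<lambda>i. if i \<le> 0 then W (u i - u 0 / 2) f x else 0) \<partial>m)
     \<le> (\<integral>\<^sup>+x. ennreal C * ennreal (W (u 0 / 2) (\<lambda>y. (f y)\<^sup>2) x) \<partial>m)"
  proof (rule nn_integral_mono)
    fix x assume x: "x \<in> space m"
    show "\<Psi> x (\<lambda>i. if i \<le> 0 then W (u i - u 0 / 2) f x else 0) \<le> ennreal C * ennreal (W (u 0 / 2) (\<lambda>y. (f y)\<^sup>2) x)"
      using "0.prems"(4)[OF x, of "\<lambda>i. if i \<le> 0 then W (u i - u 0 / 2) f x else 0"] W_range[OF u0 x f b] assms(4)
        W_range[OF u0 x _ r]
      by (simp add: ennreal_mult)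
  qed
  also have "\<dots> = ennreal C * (\<integral>\<^sup>+x. ennreal ((f x)\<^sup>2) \<partial>m)"
    using u0 by (subst nn_integral_cmult) (auto simp: W_nn_integral[OF u0 _ r])
  finally show ?case .
next
  case (Suc n)
  \<comment> \<open>Half of the time gap: since \<open>v + u (Suc n) / 2 = u n / 2\<close>, one
    kernel step of length \<open>v\<close> relates the functions attached to the indices
    \<open>n\<close> and \<open>Suc n\<close>.\<close>
  define v where "v = (u n - u (Suc n)) / 2"
  define h where "h = W (u (Suc n) / 2) f"
  define S where "S = W (u (Suc n) / 2) (\<lambda>y. (f y)\<^sup>2)"
  have v: "0 < v" using Suc.prems(1)[of n] by (simp add: v_def)
  have un: "0 < u (Suc n) / 2" "0 < u n / 2" using Suc.prems(2)[of "Suc n"] Suc.prems(2)[of n] by simp_all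
  have r: "0 \<le> (f y)\<^sup>2 \<and> (f y)\<^sup>2 \<le> M\<^sup>2" if "y \<in> space m" for y
    using b[OF that] by (auto intro: power_mono)
  have h[measurable]: "h \<in> borel_measurable m" unfolding h_def using un by measurable
  have hb: "0 \<le> h x \<and> h x \<le> M" if "x \<in> space m" for x
    unfolding h_def by (rule W_range[OF un(1) that f b])
  have S[measurable]: "S \<in> borel_measurable m" unfolding S_def using un by measurable
  have Sb: "0 \<le> S x \<and> S x \<le> M\<^sup>2" if "x \<in> space m" for x
    unfolding S_def by (rule W_range[OF un(1) that _ r]) auto
  have vu: "v + u (Suc n) / 2 = u n / 2" by (simp add: v_def field_simps)
  have Wh: "W v h x = W (u n / 2) f x" if "x \<in> space m" for x
    unfolding h_def using W_semigroup[OF v un(1) that f b] vu by simp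
  have WS: "W v S x = W (u n / 2) (\<lambda>y. (f y)\<^sup>2) x" if "x \<in> space m" for x
    unfolding S_def using W_semigroup[OF v un(1) that _ r] vu by simp
  \<comment> \<open>The conditional expectation of the functional given the previous state
    \<open>x'\<close>: the last state \<open>x\<close> is integrated out and supplies the last path
    entry.\<close>
  define \<Psi>' where "\<Psi>' = (\<lambda>x' z. \<integral>\<^sup>+x. ennreal (w v x' x) * \<Psi> x (z(Suc n := h x)) \<partial>m)"
  have J': "jensen_functional \<Psi>'"
    unfolding \<Psi>'_def by (rule jensen_functional_step[OF Suc.prems(3) v h hb])
  have u_ge: "u n \<le> u i" if "i \<le> n" for i
    using that
  proof (induction rule: inc_induct)
    case (step k)
    then show ?case using Suc.prems(1)[of k] by simp
  qed simp
  let ?z = "\<lambda>x i. if i \<le> n then W (u i - u n / 2) f x else 0"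
  have zm[measurable]: "(\<lambda>x. ?z x i) \<in> borel_measurable m" for i
    using u_ge[of i] un by (cases "i \<le> n") auto
  have "(\<integral>\<^sup>+x. \<Psi> x (\<lambda>i. if i \<le> Suc n then W (u i - u (Suc n) / 2) f x else 0) \<partial>m)
     \<le> (\<integral>\<^sup>+x. (\<integral>\<^sup>+x'. ennreal (w v x x') * \<Psi> x ((?z x')(Suc n := h x)) \<partial>m) \<partial>m)"
  proof (rule nn_integral_mono)
    fix x assume x: "x \<in> space m"
    interpret Kx: prob_space "K v x" by (rule prob_K[OF v x])
    let ?g = "\<lambda>i x'. if i = Suc n then h x else ?z x' i"
    have g: "?g i \<in> borel_measurable m" "y \<in> space m \<Longrightarrow> \<bar>?g i y\<bar> \<le> M" for i y
    proof -
      show "?g i \<in> borel_measurable m" by measurable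
      assume y: "y \<in> space m"
      have "0 < u i - u n / 2" if "i \<le> n" using u_ge[OF that] un by simp
      then show "\<bar>?g i y\<bar> \<le> M"
        using W_range[OF _ y f b, of "u i - u n / 2"] hb[OF x] b[OF x] by auto
    qed
    \<comment> \<open>Every entry with \<open>i \<le> n\<close> is an average over one step of the
      chain, and the last entry is constant in that step. Jensen's inequality can therefore move the
      averaging outside.\<close>
    have "(\<lambda>i. if i \<le> Suc n then W (u i - u (Suc n) / 2) f x else 0) = (\<lambda>i. LINT x'|K v x. ?g i x')"
    proof
      fix i
      consider "i \<le> n" | "i = Suc n" | "Suc n < i" by linarith
      then show "(if i \<le> Suc n then W (u i - u (Suc n) / 2) f x else 0) = (LINT x'|K v x. ?g i x')"
      proof cases
        case 1
        have p: "0 < u i - u n / 2" using u_ge[OF 1] un by simp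
        have "v + (u i - u n / 2) = u i - u (Suc n) / 2" by (simp add: v_def field_simps)
        then have "W (u i - u (Suc n) / 2) f x = W v (W (u i - u n / 2) f) x"
          using W_semigroup[OF v p x f b] by metis
        then show ?thesis using 1 p x v by (simp add: W_eq_integral_K)
      next
        case 2
        then show ?thesis using Kx.prob_space by (simp add: h_def)
      qed simp
    qed
    moreover have "\<Psi> x (\<lambda>i. LINT x'|K v x. ?g i x') \<le> (\<integral>\<^sup>+x'. \<Psi> x (\<lambda>i. ?g i x') \<partial>K v x)"
    proof -
      have "\<forall>i. ?g i \<in> borel_measurable (K v x) \<and> (\<forall>y\<in>space (K v x). \<bar>?g i y\<bar> \<le> M)"
        using g by (simp cong: measurable_cong_sets)
      then show ?thesis
        using Suc.prems(3)[unfolded jensen_functional_def, THEN conjunct2, rule_format, OF x, of "K v x" ?g M]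
          Kx.prob_space_axioms by simp
    qed
    moreover have "(\<integral>\<^sup>+x'. \<Psi> x (\<lambda>i. ?g i x') \<partial>K v x) = (\<integral>\<^sup>+x'. ennreal (w v x x') * \<Psi> x (\<lambda>i. ?g i x') \<partial>m)"
      using x by (intro nn_integral_K v jensen_functional_measurable[OF Suc.prems(3)] g(1)) auto
    moreover have "(\<lambda>i. ?g i x') = (?z x')(Suc n := h x)" for x' by auto
    ultimately show "\<Psi> x (\<lambda>i. if i \<le> Suc n then W (u i - u (Suc n) / 2) f x else 0)
       \<le> (\<integral>\<^sup>+x'. ennreal (w v x x') * \<Psi> x ((?z x')(Suc n := h x)) \<partial>m)"
      by simp
  qed
  also have "\<dots> = (\<integral>\<^sup>+x'. (\<integral>\<^sup>+x. ennreal (w v x x') * \<Psi> x ((?z x')(Suc n := h x)) \<partial>m) \<partial>m)"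
  proof -
    interpret pair_sigma_finite m m ..
    note [measurable] = kernel_measurable'[OF v]
    have "(\<lambda>p. ?z (snd p) i) \<in> borel_measurable (m \<Otimes>\<^sub>M m)" for i
      by (rule measurable_compose[OF measurable_snd zm])
    then have [measurable]: "(\<lambda>p. \<Psi> (fst p) ((?z (snd p))(Suc n := h (fst p)))) \<in> borel_measurable (m \<Otimes>\<^sub>M m)"
      unfolding fun_upd_def by (intro jensen_functional_measurable[OF Suc.prems(3)]) auto
    show ?thesis by (intro Fubini'[symmetric]) (simp add: split_beta')
  qed
  \<comment> \<open>Reversibility: by symmetry of the kernel the outer variable \<open>x'\<close>
    may be taken as the starting state of the step.\<close>
  also have "\<dots> = (\<integral>\<^sup>+x'. \<Psi>' x' (?z x') \<partial>m)"
    unfolding \<Psi>'_def using v by (intro nn_integral_cong) (simp add: kernel_sym)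
  also have "\<dots> \<le> ennreal C * (\<integral>\<^sup>+x. ennreal ((f x)\<^sup>2) \<partial>m)"
  proof (rule Suc.IH[OF _ _ J'])
    fix x' and z :: "nat \<Rightarrow> real"
    assume x': "x' \<in> space m" and zn: "z n = W (u n / 2) f x'" and zb: "\<And>i. i \<le> n \<Longrightarrow> z i \<in> {0..M}"
    define A where "A = (\<Sum>i<n. G i z * (z (Suc i) - z i))"
    define R where "R = (\<lambda>x. C * S x + (A + G n z * (h x - z n)))"
    \<comment> \<open>Nonnegativity travels with the bound because \<open>ennreal\<close> truncates
      negative numbers; with it, the average of \<open>ennreal (R x)\<close> is the value of
      \<open>W v R\<close> and can be computed linearly.\<close>
    have R: "0 \<le> R x \<and> \<Psi> x (z(Suc n := h x)) \<le> ennreal (R x)" if x: "x \<in> space m" for x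
    proof -
      let ?z' = "z(Suc n := h x)"
      \<comment> \<open>Predictability: the integrands up to index \<open>n\<close> do not see the
        new entry.\<close>
      have "G i ?z' = G i z" if "i \<le> n" for i
        using G that unfolding predictable_def by (metis fun_upd_apply not_less_eq_eq le_trans)
      then have "(\<Sum>i<Suc n. G i ?z' * (?z' (Suc i) - ?z' i)) = A + G n z * (h x - z n)"
        by (simp add: A_def)
      note sumeq = this
      have "?z' (Suc n) = W (u (Suc n) / 2) f x" by (simp add: h_def)
      moreover have "?z' i \<in> {0..M}" if "i \<le> Suc n" for i
        using zb[of i] hb[OF x] that by (auto simp: le_Suc_eq)
      ultimately show ?thesis
        using Suc.prems(4)[OF x, of ?z'] unfolding sumeq S_def[symmetric] R_def by blast
    qed
    have RM: "R x \<le> C * M\<^sup>2 + \<bar>A\<bar> + \<bar>G n z\<bar> * (M + \<bar>z n\<bar>)" if x: "x \<in> space m" for x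
    proof -
      have "C * S x \<le> C * M\<^sup>2" using Sb[OF x] assms(4) by (intro mult_left_mono) auto
      moreover have "G n z * (h x - z n) \<le> \<bar>G n z\<bar> * \<bar>h x - z n\<bar>"
        by (metis abs_ge_self abs_mult)
      moreover have "\<bar>G n z\<bar> * \<bar>h x - z n\<bar> \<le> \<bar>G n z\<bar> * (M + \<bar>z n\<bar>)"
        using hb[OF x] by (intro mult_left_mono) auto
      ultimately show ?thesis by (simp add: R_def)
    qed
    have Rm[measurable]: "R \<in> borel_measurable m" unfolding R_def by measurable
    have RW: "W v R x' = C * W v S x' + (A + G n z * (W v h x' - z n))"
    proof -
      have i: "integrable m (\<lambda>x. w v x' x * 1)" "integrable m (\<lambda>x. w v x' x * S x)" "integrable m (\<lambda>x. w v x' x * h x)"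
        by (rule kernel_integrable[OF v x', where B = 1] kernel_integrable[OF v x', where B = "M\<^sup>2"]
              kernel_integrable[OF v x', where B = M]; use Sb hb in force)+
      have one: "(LINT x|m. w v x' x) = 1"
        using nn_W[OF v x', of "\<lambda>_. 1" 1] W_range[OF v x', of "\<lambda>_. 1" 1] kernel_mass[OF v x']
        by (simp add: W_def)
      have "W v R x' = (LINT x|m. C * (w v x' x * S x) + ((A - G n z * z n) * (w v x' x * 1) + G n z * (w v x' x * h x)))"
        unfolding W_def R_def by (rule Bochner_Integration.integral_cong) (auto simp: algebra_simps)
      also have "\<dots> = C * W v S x' + ((A - G n z * z n) + G n z * W v h x')"
        using i one by (simp add: W_def)
      finally show ?thesis by (simp add: algebra_simps)
    qed
    \<comment> \<open>The martingale property. Averaging \<open>h\<close> over the step returns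
      \<open>z n\<close>, so the last increment disappears from the mean.\<close>
    have val: "W v R x' = C * W (u n / 2) (\<lambda>y. (f y)\<^sup>2) x' + A"
      unfolding RW WS[OF x'] Wh[OF x'] zn by simp
    have "\<Psi>' x' z \<le> (\<integral>\<^sup>+x. ennreal (w v x' x) * ennreal (R x) \<partial>m)"
      unfolding \<Psi>'_def using R by (intro nn_integral_mono mult_left_mono) auto
    also have "\<dots> = ennreal (W v R x')"
      using R RM by (intro nn_W[OF v x' Rm, symmetric]) auto
    finally have "\<Psi>' x' z \<le> ennreal (W v R x')" .
    moreover have "0 \<le> W v R x'" using W_range[OF v x' Rm] R RM by blast
    ultimately show "0 \<le> C * W (u n / 2) (\<lambda>y. (f y)\<^sup>2) x' + (\<Sum>i<n. G i z * (z (Suc i) - z i)) \<and>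
       \<Psi>' x' z \<le> ennreal (C * W (u n / 2) (\<lambda>y. (f y)\<^sup>2) x' + (\<Sum>i<n. G i z * (z (Suc i) - z i)))"
      unfolding val A_def by simp
  qed (use Suc.prems in auto)
  finally show ?case .
qed


text \<open>\<open>W (u i) f\<close> is one more half step \<open>u n / 2\<close> applied to
  \<open>W (u i - u n / 2) f\<close>. Jensen's inequality and the invariance of \<open>m\<close>
  remove that half step, and \<open>rota_step\<close> treats the rest. Since \<open>G\<close> and
  \<open>C\<close> are common to all members of \<open>A\<close>, the whole supremum is handled as
  one functional.\<close>

lemma rota_maximal:
  assumes f[measurable]: "f \<in> borel_measurable m" and b: "\<And>y. y \<in> space m \<Longrightarrow> 0 \<le> f y \<and> f y \<le> M"
    and G: "predictable G" and C: "0 \<le> C" and p: "1 \<le> p" and A: "finite A" "A \<noteq> {}"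
    and u: "\<And>i. i < n \<Longrightarrow> u (Suc i) < u i" "\<And>i. i \<le> n \<Longrightarrow> 0 < u i"
    and kl: "\<And>a j. a \<in> A \<Longrightarrow> j < N a \<Longrightarrow> k a j \<le> n \<and> l a j \<le> n"
    and ctrl: "\<And>z a. a \<in> A \<Longrightarrow> (\<And>i. i \<le> n \<Longrightarrow> z i \<in> {0..M}) \<Longrightarrow>
       (\<Sum>j<N a. \<bar>z (k a j) - z (l a j)\<bar> powr p) \<le> C * (z n)\<^sup>2 + (\<Sum>i<n. G i z * (z (Suc i) - z i))"
  shows "(\<integral>\<^sup>+x. (SUP a\<in>A. \<Sum>j<N a. ennreal (\<bar>W (u (k a j)) f x - W (u (l a j)) f x\<bar> powr p)) \<partial>m)
     \<le> ennreal C * (\<integral>\<^sup>+x. ennreal ((f x)\<^sup>2) \<partial>m)"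
proof -
  define \<Phi> where "\<Phi> = (\<lambda>z :: nat \<Rightarrow> real. SUP a\<in>A. \<Sum>j<N a. ennreal (\<bar>z (k a j) - z (l a j)\<bar> powr p))"
  have J: "jensen_functional (\<lambda>_::'a. \<Phi>)"
    unfolding jensen_functional_def
  proof (intro conjI ballI allI impI)
    have [measurable]: "(\<lambda>q. (snd q :: nat \<Rightarrow> real) i) \<in> borel_measurable (m \<Otimes>\<^sub>M (\<Pi>\<^sub>M i\<in>UNIV. borel))" for i
      by (rule measurable_compose[OF measurable_snd measurable_component_singleton]) simp
    show "(\<lambda>(x, z). \<Phi> z) \<in> borel_measurable (m \<Otimes>\<^sub>M (\<Pi>\<^sub>M i\<in>UNIV. borel))"
      unfolding \<Phi>_def split_beta' using A by (intro borel_measurable_SUP countable_finite) measurable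
    fix x :: 'a and Q :: "'a measure" and g :: "nat \<Rightarrow> 'a \<Rightarrow> real" and B
    assume Q: "prob_space Q \<and> sets Q = sets m \<and>
      (\<forall>i. g i \<in> borel_measurable Q \<and> (\<forall>y\<in>space Q. \<bar>g i y\<bar> \<le> B))"
    interpret Q: prob_space Q using Q by simp
    have [measurable]: "g i \<in> borel_measurable Q" for i using Q by blast
    have gB: "\<bar>g i y\<bar> \<le> B" if "y \<in> space Q" for i y using Q that by blast
    have gi: "integrable Q (g i)" for i
      by (rule Q.integrable_const_bound[of _ B]) (use gB in auto)
    show "\<Phi> (\<lambda>i. LINT y|Q. g i y) \<le> (\<integral>\<^sup>+y. \<Phi> (\<lambda>i. g i y) \<partial>Q)"
      unfolding \<Phi>_def
    proof (rule SUP_least)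
      fix a assume a: "a \<in> A"
      have "(\<Sum>j<N a. ennreal (\<bar>(LINT y|Q. g (k a j) y) - (LINT y|Q. g (l a j) y)\<bar> powr p))
        = (\<Sum>j<N a. ennreal (\<bar>LINT y|Q. g (k a j) y - g (l a j) y\<bar> powr p))"
        using gi by simp
      also have "\<dots> \<le> (\<Sum>j<N a. \<integral>\<^sup>+y. ennreal (\<bar>g (k a j) y - g (l a j) y\<bar> powr p) \<partial>Q)"
      proof (intro sum_mono Q.jensen_abs_powr[OF p, where B = "B + B"])
        fix j y assume "y \<in> space Q"
        then show "\<bar>g (k a j) y - g (l a j) y\<bar> \<le> B + B"
          using gB[of y "k a j"] gB[of y "l a j"] by linarith
      qed measurable
      also have "\<dots> = (\<integral>\<^sup>+y. (\<Sum>j<N a. ennreal (\<bar>g (k a j) y - g (l a j) y\<bar> powr p)) \<partial>Q)"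
        by (rule nn_integral_sum[symmetric]) measurable
      also have "\<dots> \<le> (\<integral>\<^sup>+y. (SUP a\<in>A. \<Sum>j<N a. ennreal (\<bar>g (k a j) y - g (l a j) y\<bar> powr p)) \<partial>Q)"
        by (intro nn_integral_mono SUP_upper a)
      finally show "(\<Sum>j<N a. ennreal (\<bar>(LINT y|Q. g (k a j) y) - (LINT y|Q. g (l a j) y)\<bar> powr p))
        \<le> (\<integral>\<^sup>+y. (SUP a\<in>A. \<Sum>j<N a. ennreal (\<bar>g (k a j) y - g (l a j) y\<bar> powr p)) \<partial>Q)" .
    qed
  qed
  let ?z = "\<lambda>x i. if i \<le> n then W (u i) f x else 0"
  have un: "0 < u n / 2" using u(2)[of n] by simp
  have u_ge: "u n \<le> u i" if "i \<le> n" for i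
    using that
  proof (induction rule: inc_induct)
    case (step k)
    then show ?case using u(1)[of k] by simp
  qed simp
  let ?y = "\<lambda>x i. if i \<le> n then W (u i - u n / 2) f x else 0"
  have ym[measurable]: "(\<lambda>x. ?y x i) \<in> borel_measurable m" for i
    using u_ge[of i] un by (cases "i \<le> n") auto
  have \<Phi>m: "(\<lambda>x'. \<Phi> (?y x')) \<in> borel_measurable m"
    by (rule jensen_functional_measurable[OF J, of "\<lambda>x. x" m "\<lambda>i x'. ?y x' i"]) (rule measurable_ident_sets[OF refl], rule ym)
  have "(\<integral>\<^sup>+x. (SUP a\<in>A. \<Sum>j<N a. ennreal (\<bar>W (u (k a j)) f x - W (u (l a j)) f x\<bar> powr p)) \<partial>m)
     = (\<integral>\<^sup>+x. \<Phi> (?z x) \<partial>m)"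
    unfolding \<Phi>_def using kl by (intro nn_integral_cong SUP_cong sum.cong refl) auto
  also have "\<dots> \<le> (\<integral>\<^sup>+x. (\<integral>\<^sup>+x'. ennreal (w (u n / 2) x x') * \<Phi> (?y x') \<partial>m) \<partial>m)"
  proof (rule nn_integral_mono)
    fix x assume x: "x \<in> space m"
    interpret Kx: prob_space "K (u n / 2) x" by (rule prob_K[OF un x])
    have "?z x = (\<lambda>i. LINT x'|K (u n / 2) x. ?y x' i)"
    proof
      fix i
      show "?z x i = (LINT x'|K (u n / 2) x. ?y x' i)"
      proof (cases "i \<le> n")
        case True
        have q: "0 < u i - u n / 2" using u_ge[OF True] un by simp
        have "W (u i) f x = W (u n / 2) (W (u i - u n / 2) f) x"
          using W_semigroup[OF un q x f b] by simp
        then show ?thesis using True q x un by (simp add: W_eq_integral_K)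
      qed simp
    qed
    moreover have "\<bar>?y x' i\<bar> \<le> M" if "x' \<in> space m" for x' i
    proof -
      have "0 < u i - u n / 2" if "i \<le> n" using u_ge[OF that] un by simp
      then show ?thesis using W_range[OF _ that f b, of "u i - u n / 2"] b[OF that] by auto
    qed
    then have "\<forall>i. (\<lambda>x'. ?y x' i) \<in> borel_measurable (K (u n / 2) x) \<and> (\<forall>y\<in>space (K (u n / 2) x). \<bar>?y y i\<bar> \<le> M)"
      by (simp cong: measurable_cong_sets)
    then have "\<Phi> (\<lambda>i. LINT x'|K (u n / 2) x. ?y x' i) \<le> (\<integral>\<^sup>+x'. \<Phi> (?y x') \<partial>K (u n / 2) x)"
      using J[unfolded jensen_functional_def, THEN conjunct2, rule_format, OF x, of "K (u n / 2) x" "\<lambda>i x'. ?y x' i" M]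
        Kx.prob_space_axioms by simp
    moreover have "(\<integral>\<^sup>+x'. \<Phi> (?y x') \<partial>K (u n / 2) x) = (\<integral>\<^sup>+x'. ennreal (w (u n / 2) x x') * \<Phi> (?y x') \<partial>m)"
      using x by (intro nn_integral_K[OF un _ \<Phi>m])
    ultimately show "\<Phi> (?z x) \<le> (\<integral>\<^sup>+x'. ennreal (w (u n / 2) x x') * \<Phi> (?y x') \<partial>m)"
      by simp
  qed
  also have "\<dots> = (\<integral>\<^sup>+x'. (\<integral>\<^sup>+x. ennreal (w (u n / 2) x x') * \<Phi> (?y x') \<partial>m) \<partial>m)"
  proof -
    interpret pair_sigma_finite m m ..
    note [measurable] = kernel_measurable'[OF un]
    have "(\<lambda>q. ?y (snd q) i) \<in> borel_measurable (m \<Otimes>\<^sub>M m)" for i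
      by (rule measurable_compose[OF measurable_snd ym])
    then have [measurable]: "(\<lambda>q. \<Phi> (?y (snd q))) \<in> borel_measurable (m \<Otimes>\<^sub>M m)"
      by (intro jensen_functional_measurable[OF J, of snd]) auto
    show ?thesis by (intro Fubini'[symmetric]) (simp add: split_beta')
  qed
  also have "\<dots> = (\<integral>\<^sup>+x'. (\<integral>\<^sup>+x. ennreal (w (u n / 2) x' x) \<partial>m) * \<Phi> (?y x') \<partial>m)"
    using un by (intro nn_integral_cong)
      (subst nn_integral_multc[symmetric], auto intro!: nn_integral_cong simp: kernel_sym)
  also have "\<dots> = (\<integral>\<^sup>+x'. \<Phi> (?y x') \<partial>m)"
    using un by (intro nn_integral_cong) (simp add: kernel_mass)
  also have "\<dots> \<le> ennreal C * (\<integral>\<^sup>+x. ennreal ((f x)\<^sup>2) \<partial>m)"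
  proof (rule rota_step[where u = u and n = n and \<Psi> = "\<lambda>_. \<Phi>", OF f b G C u J])
    fix x z assume x: "x \<in> space m" and zn: "z n = W (u n / 2) f x" and z: "\<And>i. i \<le> n \<Longrightarrow> z i \<in> {0..M}"
    let ?R = "\<lambda>s. C * s + (\<Sum>i<n. G i z * (z (Suc i) - z i))"
    \<comment> \<open>Replacing the last square by the average of the square of \<open>f\<close>
      makes the bound linear in that square, so that the semigroup law can propagate it in
      \<open>rota_step\<close>.\<close>
    have le: "?R ((z n)\<^sup>2) \<le> ?R (W (u n / 2) (\<lambda>y. (f y)\<^sup>2) x)"
      using W_square_le[OF un x f b] C by (simp add: zn mult_left_mono)
    obtain a where "a \<in> A" using A by auto
    have "0 \<le> (\<Sum>j<N a. \<bar>z (k a j) - z (l a j)\<bar> powr p)" by (intro sum_nonneg) auto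
    then have nn: "0 \<le> ?R ((z n)\<^sup>2)" using ctrl[OF \<open>a \<in> A\<close>, of z] z by fastforce
    have "\<Phi> z \<le> ennreal (?R ((z n)\<^sup>2))"
      unfolding \<Phi>_def
    proof (rule SUP_least)
      fix a assume "a \<in> A"
      then show "(\<Sum>j<N a. ennreal (\<bar>z (k a j) - z (l a j)\<bar> powr p)) \<le> ennreal (?R ((z n)\<^sup>2))"
        using ctrl[OF \<open>a \<in> A\<close>, of z] z by (subst sum_ennreal) (auto intro!: ennreal_leI)
    qed
    then show "0 \<le> ?R (W (u n / 2) (\<lambda>y. (f y)\<^sup>2) x) \<and> \<Phi> z \<le> ennreal (?R (W (u n / 2) (\<lambda>y. (f y)\<^sup>2) x))"
      using le nn by (meson ennreal_leI order_trans)
  qed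
  finally show ?thesis .
qed

end

section \<open>The Bessel heat semigroup\<close>

lemma space_bessel_measure [simp]: "space (bessel_measure lam) = {0<..}"
  by (simp add: bessel_measure_def)

lemma measurable_bessel_id: "(\<lambda>x. x) \<in> borel_measurable (bessel_measure lam)"
proof -
  have "(\<lambda>x::real. x) \<in> borel_measurable (lebesgue_on {0<..})"
    by (intro measurable_restrict_space1) (simp add: measurable_completion)
  then show ?thesis by (simp add: bessel_measure_def cong: measurable_cong_sets)
qed

lemma borel_measurable_bessel:
  "f \<in> borel_measurable borel \<Longrightarrow> f \<in> borel_measurable (bessel_measure lam)"
  using measurable_compose[OF measurable_bessel_id] .

text \<open>For Borel integrands the completion of Lebesgue measure is invisible, so the
  computations can take place over \<open>lborel\<close>.\<close>

lemma nn_integral_bessel: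
  assumes [measurable]: "f \<in> borel_measurable borel"
  shows "(\<integral>\<^sup>+x. f x \<partial>bessel_measure lam) = (\<integral>\<^sup>+x\<in>{0<..}. ennreal (x powr (2 * lam)) * f x \<partial>lborel)"
proof -
  have m: "g \<in> borel_measurable (lebesgue_on {0<..})" if "g \<in> borel_measurable borel" for g :: "real \<Rightarrow> ennreal"
    using that by (intro measurable_restrict_space1 measurable_completion) simp
  have "(\<integral>\<^sup>+x. f x \<partial>bessel_measure lam) = (\<integral>\<^sup>+x. ennreal (x powr (2 * lam)) * f x \<partial>lebesgue_on {0<..})"
    unfolding bessel_measure_def by (intro nn_integral_density m) measurable
  also have "\<dots> = (\<integral>\<^sup>+x\<in>{0<..}. ennreal (x powr (2 * lam)) * f x \<partial>lebesgue)"
    by (subst nn_integral_restrict_space) auto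
  also have "\<dots> = (\<integral>\<^sup>+x\<in>{0<..}. ennreal (x powr (2 * lam)) * f x \<partial>lborel)"
    by (rule nn_integral_completion)
  finally show ?thesis .
qed

lemma sigma_finite_bessel_measure: "sigma_finite_measure (bessel_measure lam)"
proof -
  have "sigma_finite_measure (lebesgue :: real measure)"
  proof
    obtain A :: "real set set" where "countable A" "A \<subseteq> sets lborel" "\<Union>A = space lborel" "\<forall>a\<in>A. emeasure lborel a \<noteq> \<infinity>"
      using lborel.sigma_finite_countable by blast
    then show "\<exists>A. countable A \<and> A \<subseteq> sets lebesgue \<and> \<Union>A = space (lebesgue :: real measure) \<and> (\<forall>a\<in>A. emeasure lebesgue a \<noteq> \<infinity>)"
      by (intro exI[of _ A]) auto
  qed
  then interpret L: sigma_finite_measure "lebesgue_on {0::real<..}"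
    by (rule sigma_finite_measure_restrict_space) auto
  have "(\<lambda>x. ennreal (x powr (2 * lam))) \<in> borel_measurable (lebesgue_on {0<..})"
    by (intro measurable_restrict_space1 measurable_completion) simp
  from L.sigma_finite_iff_density_finite[OF this] show ?thesis
    by (simp add: bessel_measure_def)
qed

section \<open>Gaussian moments against the weight\<close>

lemma gaussian_moment_has_integral:
  fixes b z :: real
  assumes "0 < b" "0 < z"
  shows "((\<lambda>y. y powr (2 * z - 1) * exp (- b * y\<^sup>2)) has_integral Gamma z / (2 * b powr z)) {0<..}"
proof -
  let ?f = "\<lambda>t::real. t powr (z - 1) / exp t"
  have S: "{0::real<..} \<in> sets lebesgue" by simp
  have img: "(\<lambda>y. b * y\<^sup>2) ` {0<..} = {0<..}"
  proof
    show "{0<..} \<subseteq> (\<lambda>y. b * y\<^sup>2) ` {0<..}"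
    proof
      fix t :: real assume "t \<in> {0<..}"
      then have "t = b * (sqrt (t / b))\<^sup>2" "sqrt (t / b) \<in> {0<..}" using assms by simp_all
      then show "t \<in> (\<lambda>y. b * y\<^sup>2) ` {0<..}" by blast
    qed
  qed (use assms in auto)
  have "(?f has_integral Gamma z) {0..}" by (rule Gamma_integral_real[OF assms(2)])
  then have G: "(?f has_integral Gamma z) {0<..}"
    by (subst has_integral_spike_set_eq[of "{0<..}" "{0..}"]) (auto intro: negligible_subset[of "{0}"])
  then have "?f absolutely_integrable_on {0<..}"
    by (intro nonnegative_absolutely_integrable_1) (auto simp: has_integral_integrable)
  then have "?f absolutely_integrable_on ((\<lambda>y. b * y\<^sup>2) ` {0<..}) \<and>
      integral ((\<lambda>y. b * y\<^sup>2) ` {0<..}) ?f = Gamma z"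
    using G img by (simp add: integral_unique)
  moreover have inj: "inj_on (\<lambda>y. b * y\<^sup>2) {0<..}"
    using assms by (auto simp: inj_on_def)
  moreover have der: "((\<lambda>y. b * y\<^sup>2) has_field_derivative 2 * b * x) (at x within {0<..})" for x
    by (auto intro!: derivative_eq_intros)
  ultimately have "(\<lambda>y. \<bar>2 * b * y\<bar> * ?f (b * y\<^sup>2)) absolutely_integrable_on {0<..} \<and> integral {0<..} (\<lambda>y. \<bar>2 * b * y\<bar> * ?f (b * y\<^sup>2)) = Gamma z"
    using has_absolute_integral_change_of_variables_1'[OF S der inj, of ?f "Gamma z"] by blast
  then have "((\<lambda>y. \<bar>2 * b * y\<bar> * ?f (b * y\<^sup>2)) has_integral Gamma z) {0<..}"
    unfolding absolutely_integrable_on_def has_integral_iff by blast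
  then have "((\<lambda>y. 1 / (2 * b powr z) * (\<bar>2 * b * y\<bar> * ?f (b * y\<^sup>2))) has_integral 1 / (2 * b powr z) * Gamma z) {0<..}"
    by (rule has_integral_mult_right)
  moreover have "1 / (2 * b powr z) * (\<bar>2 * b * y\<bar> * ?f (b * y\<^sup>2)) = y powr (2 * z - 1) * exp (- b * y\<^sup>2)"
    if "y \<in> {0<..}" for y
  proof -
    have y: "0 < y" using that by simp
    define P Q where "P = b powr (z - 1)" and "Q = y powr (2 * (z - 1))"
    have e1: "(b * y\<^sup>2) powr (z - 1) = P * Q"
      using y assms by (simp add: P_def Q_def powr_mult powr_powr flip: powr_numeral)
    have "1 + 2 * (z - 1) = 2 * z - 1" by simp
    then have e2: "b powr z = b * P" "y powr (2 * z - 1) = y * Q"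
      using y assms powr_mult_base[of b "z - 1"] powr_mult_base[of y "2 * (z - 1)"] by (simp_all add: P_def Q_def)
    have "0 < P" using assms by (simp add: P_def)
    have E: "exp (- b * y\<^sup>2) = 1 / exp (b * y\<^sup>2)" by (simp add: exp_minus inverse_eq_divide)
    show ?thesis unfolding e1 e2 E using y assms \<open>0 < P\<close> by (simp add: abs_mult)
  qed
  ultimately have "((\<lambda>y. y powr (2 * z - 1) * exp (- b * y\<^sup>2)) has_integral 1 / (2 * b powr z) * Gamma z) {0<..}"
    by (rule has_integral_eq[rotated])
  then show ?thesis by (simp only: mult_1 times_divide_eq_left)
qed

lemma gamma_integral_scaled:
  fixes b z :: real
  assumes "0 < b" "0 < z"
  shows "((\<lambda>s. s powr (z - 1) * exp (- b * s)) has_integral Gamma z / b powr z) {0<..}"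
proof -
  let ?f = "\<lambda>t::real. t powr (z - 1) / exp t"
  have S: "{0::real<..} \<in> sets lebesgue" by simp
  have img: "(\<lambda>y. b * y) ` {0<..} = {0<..}"
  proof
    show "{0<..} \<subseteq> (\<lambda>y. b * y) ` {0<..}"
    proof
      fix t :: real assume "t \<in> {0<..}"
      then have "t = b * (t / b)" "t / b \<in> {0<..}" using assms by simp_all
      then show "t \<in> (\<lambda>y. b * y) ` {0<..}" by blast
    qed
  qed (use assms in auto)
  have "(?f has_integral Gamma z) {0..}" by (rule Gamma_integral_real[OF assms(2)])
  then have G: "(?f has_integral Gamma z) {0<..}"
    by (subst has_integral_spike_set_eq[of "{0<..}" "{0..}"]) (auto intro: negligible_subset[of "{0}"])
  then have "?f absolutely_integrable_on {0<..}"
    by (intro nonnegative_absolutely_integrable_1) (auto simp: has_integral_integrable)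
  then have "?f absolutely_integrable_on ((\<lambda>y. b * y) ` {0<..}) \<and>
      integral ((\<lambda>y. b * y) ` {0<..}) ?f = Gamma z"
    using G img by (simp add: integral_unique)
  moreover have inj: "inj_on (\<lambda>y. b * y) {0<..}"
    using assms by (auto simp: inj_on_def)
  moreover have der: "((\<lambda>y. b * y) has_field_derivative b) (at x within {0<..})" for x
    by (auto intro!: derivative_eq_intros)
  ultimately have "(\<lambda>y. \<bar>b\<bar> * ?f (b * y)) absolutely_integrable_on {0<..} \<and> integral {0<..} (\<lambda>y. \<bar>b\<bar> * ?f (b * y)) = Gamma z"
    using has_absolute_integral_change_of_variables_1'[OF S der inj, of ?f "Gamma z"] by blast
  then have "((\<lambda>y. \<bar>b\<bar> * ?f (b * y)) has_integral Gamma z) {0<..}"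
    unfolding absolutely_integrable_on_def has_integral_iff by blast
  then have "((\<lambda>y. 1 / b powr z * (\<bar>b\<bar> * ?f (b * y))) has_integral 1 / b powr z * Gamma z) {0<..}"
    by (rule has_integral_mult_right)
  moreover have "1 / b powr z * (\<bar>b\<bar> * ?f (b * y)) = y powr (z - 1) * exp (- b * y)"
    if "y \<in> {0<..}" for y
  proof -
    have y: "0 < y" using that by simp
    define P Q where "P = b powr (z - 1)" and "Q = y powr (z - 1)"
    have e: "b powr z = b * P" "(b * y) powr (z - 1) = P * Q"
      using assms by (simp_all add: P_def Q_def powr_mult_base powr_mult)
    have "0 < P" using assms by (simp add: P_def)
    have E: "exp (- b * y) = 1 / exp (b * y)" by (simp add: exp_minus inverse_eq_divide)
    show ?thesis unfolding e Q_def[symmetric] E using y assms \<open>0 < P\<close> by simp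
  qed
  ultimately have "((\<lambda>s. s powr (z - 1) * exp (- b * s)) has_integral 1 / b powr z * Gamma z) {0<..}"
    by (rule has_integral_eq[rotated])
  then show ?thesis by (simp only: mult_1 times_divide_eq_left)
qed

lemma nn_integral_bessel_gaussian_moment:
  assumes "0 < lam" "0 < b"
  shows "(\<integral>\<^sup>+y. ennreal (exp (- b * y\<^sup>2) * y ^ (2 * k)) \<partial>bessel_measure lam)
    = ennreal (Gamma (lam + 1/2 + k) / (2 * b powr (lam + 1/2 + k)))"
proof -
  let ?z = "lam + 1/2 + real k"
  have "(\<integral>\<^sup>+y. ennreal (exp (- b * y\<^sup>2) * y ^ (2 * k)) \<partial>bessel_measure lam)
    = (\<integral>\<^sup>+y\<in>{0<..}. ennreal (y powr (2 * lam)) * ennreal (exp (- b * y\<^sup>2) * y ^ (2 * k)) \<partial>lborel)"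
    by (rule nn_integral_bessel) measurable
  also have "\<dots> = (\<integral>\<^sup>+y\<in>{0<..}. ennreal (y powr (2 * ?z - 1) * exp (- b * y\<^sup>2)) \<partial>lborel)"
  proof (rule nn_integral_cong)
    fix y :: real
    have "y powr (2 * lam) * (exp (- b * y\<^sup>2) * y ^ (2 * k)) = y powr (2 * ?z - 1) * exp (- b * y\<^sup>2)" if "0 < y"
    proof -
      have "2 * ?z - 1 = 2 * lam + real (2 * k)" by simp
      then have "y powr (2 * ?z - 1) = y powr (2 * lam) * y ^ (2 * k)"
        using that by (simp only: powr_add powr_realpow)
      then show ?thesis by simp
    qed
    then show "ennreal (y powr (2 * lam)) * ennreal (exp (- b * y\<^sup>2) * y ^ (2 * k)) * indicator {0<..} y
      = ennreal (y powr (2 * ?z - 1) * exp (- b * y\<^sup>2)) * indicator {0<..} y"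
      by (auto simp: indicator_def simp flip: ennreal_mult')
  qed
  also have "\<dots> = ennreal (Gamma ?z / (2 * b powr ?z))"
    by (rule nn_integral_has_integral_lebesgue') (use gaussian_moment_has_integral[of b ?z] assms in auto)
  finally show ?thesis .
qed

text \<open>In terms of the modified Bessel function, this is \<open>z powr ((1 - \<beta>) / 2) * I (\<beta> - 1) (2 * sqrt z)\<close>.\<close>

definition bessel_series :: "real \<Rightarrow> real \<Rightarrow> real" where
  "bessel_series \<beta> z = (\<Sum>k. z ^ k / (fact k * Gamma (\<beta> + real k)))"

lemma Gamma_add_nat_ge:
  fixes \<beta> :: real
  assumes "0 < \<beta>"
  shows "Gamma \<beta> * min 1 \<beta> \<le> Gamma (\<beta> + real k)"
proof -
  have p: "min 1 \<beta> \<le> pochhammer \<beta> k"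
  proof (induction k)
    case (Suc k)
    show ?case
    proof (cases k)
      case (Suc j)
      then have "min 1 \<beta> * 1 \<le> pochhammer \<beta> k * (\<beta> + real k)"
        using Suc.IH assms by (intro mult_mono) auto
      then show ?thesis by (simp add: pochhammer_Suc)
    qed simp
  qed simp
  have "\<beta> \<notin> \<int>\<^sub>\<le>\<^sub>0" using assms by (auto elim!: nonpos_Ints_cases)
  then have "Gamma (\<beta> + real k) = Gamma \<beta> * pochhammer \<beta> k"
    using pochhammer_Gamma[of \<beta> k] Gamma_real_pos[OF assms] by (simp add: field_simps)
  then show ?thesis using p Gamma_real_pos[OF assms] by simp
qed

lemma bessel_series_summable:
  assumes "0 < \<beta>"
  shows "summable (\<lambda>k. z ^ k / (fact k * Gamma (\<beta> + real k)))"
    and "summable (\<lambda>k. norm (z ^ k / (fact k * Gamma (\<beta> + real k))))"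
proof -
  let ?c = "Gamma \<beta> * min 1 \<beta>"
  have c: "0 < ?c" using assms Gamma_real_pos[OF assms] by simp
  have *: "norm (norm (z ^ k / (fact k * Gamma (\<beta> + real k)))) \<le> (\<bar>z\<bar> ^ k / fact k) * (1 / ?c)" for k
  proof -
    have "0 < Gamma (\<beta> + real k)" using assms by simp
    moreover have "1 / Gamma (\<beta> + real k) \<le> 1 / ?c"
      using Gamma_add_nat_ge[OF assms, of k] c by (intro divide_left_mono) auto
    ultimately have "\<bar>z\<bar> ^ k / fact k * (1 / Gamma (\<beta> + real k)) \<le> (\<bar>z\<bar> ^ k / fact k) * (1 / ?c)"
      by (intro mult_left_mono) auto
    then show ?thesis using \<open>0 < Gamma (\<beta> + real k)\<close> by (simp add: abs_mult power_abs)
  qed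
  have "summable (\<lambda>k. (\<bar>z\<bar> ^ k / fact k) * (1 / ?c))"
    using summable_exp[of "\<bar>z\<bar>"] by (intro summable_mult2) (simp add: divide_inverse mult.commute)
  then show "summable (\<lambda>k. norm (z ^ k / (fact k * Gamma (\<beta> + real k))))"
    by (rule summable_comparison_test'[of _ 0]) (rule *)
  then show "summable (\<lambda>k. z ^ k / (fact k * Gamma (\<beta> + real k)))"
    by (rule summable_norm_cancel)
qed

lemma bessel_series_measurable [measurable]: "bessel_series \<beta> \<in> borel_measurable borel"
  unfolding bessel_series_def by measurable

lemma bessel_series_nonneg: "0 < \<beta> \<Longrightarrow> 0 \<le> z \<Longrightarrow> 0 \<le> bessel_series \<beta> z"
  unfolding bessel_series_def
  by (intro suminf_nonneg bessel_series_summable divide_nonneg_nonneg mult_nonneg_nonneg less_imp_le[OF Gamma_real_pos]) auto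

text \<open>The kernel of the heat semigroup at time \<open>u / 4\<close>.\<close>

definition bessel_heat :: "real \<Rightarrow> real \<Rightarrow> real \<Rightarrow> real \<Rightarrow> real" where
  "bessel_heat lam u x y =
     2 * u powr (- (lam + 1/2)) * exp (- (x\<^sup>2 + y\<^sup>2) / u) * bessel_series (lam + 1/2) ((x * y / u)\<^sup>2)"

lemma bessel_heat_nonneg: "0 < lam \<Longrightarrow> 0 \<le> bessel_heat lam u x y"
  unfolding bessel_heat_def by (intro mult_nonneg_nonneg bessel_series_nonneg) auto

lemma bessel_heat_sym: "bessel_heat lam u x y = bessel_heat lam u y x"
  by (simp add: bessel_heat_def add.commute mult.commute)

lemma bessel_heat_measurable:
  assumes [measurable]: "f \<in> borel_measurable M" "g \<in> borel_measurable M" "h \<in> borel_measurable M"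
  shows "(\<lambda>p. bessel_heat lam (f p) (g p) (h p)) \<in> borel_measurable M"
  unfolding bessel_heat_def by measurable

text \<open>The Chu--Vandermonde identity in disguise.\<close>

lemma Gamma_vandermonde:
  fixes \<beta> :: real
  assumes "0 < \<beta>"
  shows "Gamma (\<beta> + k + l) / (fact k * fact l * Gamma (\<beta> + k) * Gamma (\<beta> + l))
    = (\<Sum>m\<le>k. if m \<le> l then 1 / (fact (k - m) * fact (l - m) * fact m * Gamma (\<beta> + m)) else 0)"
proof -
  have np: "\<beta> + real i \<notin> \<int>\<^sub>\<le>\<^sub>0" for i using assms by (auto elim!: nonpos_Ints_cases)
  have G: "0 < Gamma (\<beta> + real i)" for i using assms by simp
  have 1: "(real l + (\<beta> + real k - 1)) gchoose k = Gamma (\<beta> + k + l) / (Gamma (\<beta> + l) * fact k)"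
    using pochhammer_Gamma[OF np[of l], of k]
    by (simp add: gbinomial_pochhammer' add_ac)
  have 2: "(\<beta> + real k - 1) gchoose (k - m) = Gamma (\<beta> + k) / (Gamma (\<beta> + m) * fact (k - m))" if "m \<le> k" for m
    using pochhammer_Gamma[OF np[of m], of "k - m"] that
    by (simp add: gbinomial_pochhammer' of_nat_diff add_ac)
  have 3: "real l gchoose m = (if m \<le> l then fact l / (fact m * fact (l - m)) else 0)" for m
    by (auto simp: binomial_gbinomial[symmetric] binomial_fact)
  have "Gamma (\<beta> + k + l) / (fact k * fact l * Gamma (\<beta> + k) * Gamma (\<beta> + l))
     = ((real l + (\<beta> + real k - 1)) gchoose k) / (fact l * Gamma (\<beta> + k))"
    unfolding 1 by simp
  also have "\<dots> = (\<Sum>m = 0..k. (real l gchoose m) * ((\<beta> + real k - 1) gchoose (k - m)) / (fact l * Gamma (\<beta> + k)))"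
    by (simp add: gbinomial_Vandermonde[symmetric] sum_divide_distrib)
  also have "\<dots> = (\<Sum>m\<le>k. if m \<le> l then 1 / (fact (k - m) * fact (l - m) * fact m * Gamma (\<beta> + m)) else 0)"
  proof (rule sum.cong)
    fix m assume "m \<in> {..k}"
    then show "(real l gchoose m) * ((\<beta> + real k - 1) gchoose (k - m)) / (fact l * Gamma (\<beta> + k))
       = (if m \<le> l then 1 / (fact (k - m) * fact (l - m) * fact m * Gamma (\<beta> + m)) else 0)"
      using G[of k] by (simp add: 2 3)
  qed auto
  finally show ?thesis .
qed

text \<open>The power series form of Weber's integral for a product of two modified Bessel functions
  against a Gaussian. After the Vandermonde identity, the sum over \<open>l\<close> produces
  \<open>Z ^ m * exp Z\<close>, and what remains in \<open>k\<close> is the Cauchy product of the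
  series of \<open>bessel_series \<beta> (X * Z)\<close> and of \<open>exp X\<close>.\<close>

lemma bessel_double_series:
  fixes \<beta> X Z :: real
  assumes \<beta>: "0 < \<beta>" and X: "0 \<le> X" and Z: "0 \<le> Z"
  defines "c \<equiv> \<lambda>k l. X ^ k * Z ^ l * Gamma (\<beta> + real k + real l) / (fact k * fact l * Gamma (\<beta> + real k) * Gamma (\<beta> + real l))"
  shows "(\<Sum>k. \<Sum>l. ennreal (c k l)) = ennreal (exp (X + Z) * bessel_series \<beta> (X * Z))"
proof -
  have G: "0 < Gamma (\<beta> + real i)" for i using \<beta> by simp
  have exps: "(\<lambda>j. x ^ j / fact j) sums exp x" for x :: real
    using exp_converges[of x] by (simp add: divide_inverse mult.commute)
  have shift: "(\<lambda>l. if m \<le> l then Z ^ l / fact (l - m) else 0) sums (Z ^ m * exp Z)" for m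
  proof -
    have "(\<lambda>l. if m \<le> l + m then Z ^ (l + m) / fact (l + m - m) else 0) sums (Z ^ m * exp Z)"
      using sums_mult[OF exps[of Z], of "Z ^ m"] by (simp add: power_add mult_ac)
    then show ?thesis
      by (subst (asm) sums_iff_shift) simp
  qed
  have inner: "(\<lambda>l. c k l) sums (X ^ k * (\<Sum>m\<le>k. Z ^ m * exp Z / (fact (k - m) * fact m * Gamma (\<beta> + real m))))" for k
  proof -
    have "(\<lambda>l. X ^ k * (\<Sum>m\<le>k. (if m \<le> l then Z ^ l / fact (l - m) else 0) * (1 / (fact (k - m) * fact m * Gamma (\<beta> + real m)))))
       sums (X ^ k * (\<Sum>m\<le>k. Z ^ m * exp Z * (1 / (fact (k - m) * fact m * Gamma (\<beta> + real m)))))"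
      by (intro sums_mult sums_sum sums_mult2 shift)
    moreover have "X ^ k * (\<Sum>m\<le>k. (if m \<le> l then Z ^ l / fact (l - m) else 0) * (1 / (fact (k - m) * fact m * Gamma (\<beta> + real m)))) = c k l" for l
    proof -
      have "c k l = X ^ k * (Z ^ l * (Gamma (\<beta> + k + l) / (fact k * fact l * Gamma (\<beta> + k) * Gamma (\<beta> + l))))"
        by (simp add: c_def)
      then show ?thesis
        unfolding Gamma_vandermonde[OF \<beta>]
        by (auto simp: sum_distrib_left intro!: sum.cong)
    qed
    ultimately show ?thesis by simp
  qed
  have cnn: "0 \<le> c k l" for k l
    unfolding c_def using \<beta> X Z G[of k] G[of l]
    by (intro divide_nonneg_nonneg mult_nonneg_nonneg) (auto intro!: less_imp_le[OF Gamma_real_pos])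
  have "(\<lambda>k. \<Sum>m\<le>k. (X * Z) ^ m / (fact m * Gamma (\<beta> + real m)) * (X ^ (k - m) / fact (k - m)))
     sums ((\<Sum>k. (X * Z) ^ k / (fact k * Gamma (\<beta> + real k))) * (\<Sum>k. X ^ k / fact k))"
    using exps[of "\<bar>X\<bar>"]
    by (intro Cauchy_product_sums bessel_series_summable \<beta>) (auto dest: sums_summable simp: power_abs)
  then have outer: "(\<lambda>k. exp Z * (\<Sum>m\<le>k. (X * Z) ^ m / (fact m * Gamma (\<beta> + real m)) * (X ^ (k - m) / fact (k - m))))
     sums (exp Z * (bessel_series \<beta> (X * Z) * exp X))"
    unfolding bessel_series_def using sums_unique[OF exps[of X]] by (intro sums_mult) simp
  have e: "exp Z * (\<Sum>m\<le>k. (X * Z) ^ m / (fact m * Gamma (\<beta> + real m)) * (X ^ (k - m) / fact (k - m)))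
     = X ^ k * (\<Sum>m\<le>k. Z ^ m * exp Z / (fact (k - m) * fact m * Gamma (\<beta> + real m)))" for k
    unfolding sum_distrib_left
  proof (rule sum.cong)
    fix m assume "m \<in> {..k}"
    then have "X ^ k = X ^ m * X ^ (k - m)" by (simp flip: power_add)
    then show "exp Z * ((X * Z) ^ m / (fact m * Gamma (\<beta> + real m)) * (X ^ (k - m) / fact (k - m)))
       = X ^ k * (Z ^ m * exp Z / (fact (k - m) * fact m * Gamma (\<beta> + real m)))"
      by (simp add: power_mult_distrib mult_ac)
  qed simp
  have "(\<Sum>k. \<Sum>l. ennreal (c k l)) = (\<Sum>k. ennreal (X ^ k * (\<Sum>m\<le>k. Z ^ m * exp Z / (fact (k - m) * fact m * Gamma (\<beta> + real m)))))"
    by (intro suminf_cong suminf_ennreal_eq cnn inner)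
  also have "\<dots> = ennreal (exp Z * (bessel_series \<beta> (X * Z) * exp X))"
    using outer unfolding e using X Z G
    by (intro suminf_ennreal_eq) (auto intro!: mult_nonneg_nonneg sum_nonneg divide_nonneg_nonneg less_imp_le[OF G])
  finally show ?thesis by (simp add: exp_add mult_ac)
qed

text \<open>Termwise integration. The spare factor \<open>y ^ (2 * j)\<close> allows the product of
  two power series to be integrated by expanding one factor at a time.\<close>

lemma nn_integral_bessel_gaussian_series:
  assumes lam: "0 < lam" and b: "0 < b" and a: "\<And>k. 0 \<le> a k" and sm: "\<And>y::real. summable (\<lambda>k. a k * y ^ (2 * k))"
  shows "(\<integral>\<^sup>+y. ennreal (exp (- b * y\<^sup>2) * y ^ (2 * j) * (\<Sum>k. a k * y ^ (2 * k))) \<partial>bessel_measure lam)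
    = (\<Sum>k. ennreal (a k * (Gamma (lam + 1/2 + (j + k)) / (2 * b powr (lam + 1/2 + (j + k))))))"
proof -
  have bm: "(\<lambda>y. ennreal (exp (- b * y\<^sup>2) * y ^ (2 * i))) \<in> borel_measurable (bessel_measure lam)" for i
    by (rule borel_measurable_bessel) measurable
  have "(\<integral>\<^sup>+y. ennreal (exp (- b * y\<^sup>2) * y ^ (2 * j) * (\<Sum>k. a k * y ^ (2 * k))) \<partial>bessel_measure lam)
    = (\<integral>\<^sup>+y. (\<Sum>k. ennreal (a k) * ennreal (exp (- b * y\<^sup>2) * y ^ (2 * (j + k)))) \<partial>bessel_measure lam)"
  proof (rule nn_integral_cong)
    fix y :: real
    have "(\<lambda>k. exp (- b * y\<^sup>2) * y ^ (2 * j) * (a k * y ^ (2 * k))) sums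
        (exp (- b * y\<^sup>2) * y ^ (2 * j) * (\<Sum>k. a k * y ^ (2 * k)))"
      by (intro sums_mult summable_sums sm)
    moreover have e: "exp (- b * y\<^sup>2) * y ^ (2 * j) * (a k * y ^ (2 * k)) = a k * (exp (- b * y\<^sup>2) * y ^ (2 * (j + k)))" for k
      by (simp add: power_add mult_ac distrib_left)
    ultimately have "(\<lambda>k. a k * (exp (- b * y\<^sup>2) * y ^ (2 * (j + k)))) sums
        (exp (- b * y\<^sup>2) * y ^ (2 * j) * (\<Sum>k. a k * y ^ (2 * k)))" unfolding e by blast
    then have "(\<Sum>k. ennreal (a k * (exp (- b * y\<^sup>2) * y ^ (2 * (j + k))))) =
        ennreal (exp (- b * y\<^sup>2) * y ^ (2 * j) * (\<Sum>k. a k * y ^ (2 * k)))"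
      by (intro suminf_ennreal_eq mult_nonneg_nonneg a exp_ge_zero zero_le_even_power')
    then show "ennreal (exp (- b * y\<^sup>2) * y ^ (2 * j) * (\<Sum>k. a k * y ^ (2 * k)))
      = (\<Sum>k. ennreal (a k) * ennreal (exp (- b * y\<^sup>2) * y ^ (2 * (j + k))))"
      by (simp add: ennreal_mult' a)
  qed
  also have "\<dots> = (\<Sum>k. \<integral>\<^sup>+y. ennreal (a k) * ennreal (exp (- b * y\<^sup>2) * y ^ (2 * (j + k))) \<partial>bessel_measure lam)"
    by (intro nn_integral_suminf borel_measurable_times_ennreal bm measurable_const) simp
  also have "\<dots> = (\<Sum>k. ennreal (a k) * ennreal (Gamma (lam + 1/2 + (j + k)) / (2 * b powr (lam + 1/2 + (j + k)))))"
    using nn_integral_bessel_gaussian_moment[OF lam b]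
    by (subst nn_integral_cmult[OF bm]) (simp only:)
  also have "\<dots> = (\<Sum>k. ennreal (a k * (Gamma (lam + 1/2 + (j + k)) / (2 * b powr (lam + 1/2 + (j + k))))))"
    by (simp only: ennreal_mult'[OF a])
  finally show ?thesis .
qed

lemma bessel_series_as_power_series:
  assumes "0 < \<beta>"
  shows "bessel_series \<beta> ((c * y)\<^sup>2) = (\<Sum>k. c ^ (2 * k) / (fact k * Gamma (\<beta> + real k)) * y ^ (2 * k))"
    and "summable (\<lambda>k. c ^ (2 * k) / (fact k * Gamma (\<beta> + real k)) * y ^ (2 * k))"
proof -
  have e: "((c * y)\<^sup>2) ^ k / (fact k * Gamma (\<beta> + real k)) = c ^ (2 * k) / (fact k * Gamma (\<beta> + real k)) * y ^ (2 * k)" for k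
    by (simp add: power_mult_distrib flip: power_mult)
  show "bessel_series \<beta> ((c * y)\<^sup>2) = (\<Sum>k. c ^ (2 * k) / (fact k * Gamma (\<beta> + real k)) * y ^ (2 * k))"
    unfolding bessel_series_def e ..
  show "summable (\<lambda>k. c ^ (2 * k) / (fact k * Gamma (\<beta> + real k)) * y ^ (2 * k))"
    using bessel_series_summable(1)[OF assms, of "(c * y)\<^sup>2"] unfolding e .
qed

text \<open>The Gamma value of each Gaussian moment cancels the one in the series coefficient,
  leaving the exponential series of \<open>x\<^sup>2 / u\<close>, which undoes the Gaussian factor
  in \<open>x\<close>.\<close>

lemma bessel_heat_mass:
  assumes lam: "0 < lam" and u: "0 < u"
  shows "(\<integral>\<^sup>+y. ennreal (bessel_heat lam u x y) \<partial>bessel_measure lam) = 1"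
proof -
  let ?\<beta> = "lam + 1/2"
  have \<beta>: "0 < ?\<beta>" using lam by simp
  have G: "0 < Gamma (?\<beta> + real k)" for k using lam by simp
  define a where "a k = (x / u) ^ (2 * k) / (fact k * Gamma (?\<beta> + real k))" for k
  define c where "c = 2 * u powr (- ?\<beta>) * exp (- x\<^sup>2 / u)"
  have a: "0 \<le> a k" for k using G[of k] by (simp add: a_def power_mult)
  have c: "0 \<le> c" by (simp add: c_def)
  have "bessel_heat lam u x y = c * (exp (- (1 / u) * y\<^sup>2) * y ^ (2 * 0) * (\<Sum>k. a k * y ^ (2 * k)))" for y
  proof -
    have "exp (- (x\<^sup>2 + y\<^sup>2) / u) = exp (- x\<^sup>2 / u) * exp (- (1 / u) * y\<^sup>2)"
      by (simp add: add_divide_distrib diff_divide_distrib flip: exp_add)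
    moreover have "bessel_series ?\<beta> ((x * y / u)\<^sup>2) = (\<Sum>k. a k * y ^ (2 * k))"
      using bessel_series_as_power_series(1)[OF \<beta>, of "x / u" y] by (simp add: a_def)
    ultimately show ?thesis by (simp add: bessel_heat_def c_def)
  qed
  then have "(\<integral>\<^sup>+y. ennreal (bessel_heat lam u x y) \<partial>bessel_measure lam)
    = (\<integral>\<^sup>+y. ennreal c * ennreal (exp (- (1 / u) * y\<^sup>2) * y ^ (2 * 0) * (\<Sum>k. a k * y ^ (2 * k))) \<partial>bessel_measure lam)"
    by (simp only: ennreal_mult'[OF c])
  also have "\<dots> = ennreal c * (\<integral>\<^sup>+y. ennreal (exp (- (1 / u) * y\<^sup>2) * y ^ (2 * 0) * (\<Sum>k. a k * y ^ (2 * k))) \<partial>bessel_measure lam)"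
    by (intro nn_integral_cmult borel_measurable_bessel) measurable
  also have "\<dots> = ennreal c * (\<Sum>k. ennreal (a k * (Gamma (?\<beta> + (0 + k)) / (2 * (1 / u) powr (?\<beta> + (0 + k))))))"
    by (subst nn_integral_bessel_gaussian_series[OF lam _ a])
      (use u bessel_series_as_power_series(2)[OF \<beta>] in \<open>auto simp: a_def\<close>)
  also have "(\<lambda>k::nat. a k * (Gamma (?\<beta> + (0 + k)) / (2 * (1 / u) powr (?\<beta> + (0 + k)))))
     = (\<lambda>k. u powr ?\<beta> / 2 * ((x\<^sup>2 / u) ^ k / fact k))"
  proof
    fix k :: nat
    have e1: "(1 / u) powr (?\<beta> + (0 + k)) = 1 / (u powr ?\<beta> * u ^ k)"
      using u by (simp add: powr_add powr_realpow powr_divide power_divide)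
    have e2: "(x\<^sup>2 / u) ^ k = (x / u) ^ (2 * k) * u ^ k"
      using u by (simp add: power_mult power2_eq_square flip: power_mult_distrib)
    show "a k * (Gamma (?\<beta> + (0 + k)) / (2 * (1 / u) powr (?\<beta> + (0 + k)))) = u powr ?\<beta> / 2 * ((x\<^sup>2 / u) ^ k / fact k)"
      unfolding a_def e1 e2 using G[of k] u by (simp add: mult_ac)
  qed
  also have "(\<Sum>k. ennreal (u powr ?\<beta> / 2 * ((x\<^sup>2 / u) ^ k / fact k))) = ennreal (u powr ?\<beta> / 2 * exp (x\<^sup>2 / u))"
  proof (rule suminf_ennreal_eq)
    show "(\<lambda>k. u powr ?\<beta> / 2 * ((x\<^sup>2 / u) ^ k / fact k)) sums (u powr ?\<beta> / 2 * exp (x\<^sup>2 / u))"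
      using exp_converges[of "x\<^sup>2 / u"] by (intro sums_mult) (simp add: divide_inverse mult.commute)
  qed (use u in simp)
  also have "ennreal c * \<dots> = 1"
  proof -
    have "c * (u powr ?\<beta> / 2 * exp (x\<^sup>2 / u)) = (u powr (- ?\<beta>) * u powr ?\<beta>) * (exp (- x\<^sup>2 / u) * exp (x\<^sup>2 / u))"
      by (simp add: c_def mult_ac)
    also have "\<dots> = 1" using u by (simp flip: powr_add exp_add)
    finally show ?thesis using c by (simp flip: ennreal_mult')
  qed
  finally show ?thesis .
qed

text \<open>Chapman-Kolmogorov by direct computation. Expanding both Bessel series and integrating
  against the Gaussian with parameter \<open>b\<close> yields the double series of
  \<open>bessel_double_series\<close> in \<open>X\<close> and \<open>Z\<close>. Its factor
  \<open>exp (X + Z)\<close> turns the exponents \<open>- x\<^sup>2 / s\<close> and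
  \<open>- z\<^sup>2 / t\<close> into those for \<open>s + t\<close>.\<close>

lemma bessel_heat_semigroup:
  assumes lam: "0 < lam" and s: "0 < s" and t: "0 < t"
  shows "(\<integral>\<^sup>+y. ennreal (bessel_heat lam s x y) * ennreal (bessel_heat lam t y z) \<partial>bessel_measure lam)
    = ennreal (bessel_heat lam (s + t) x z)"
proof -
  let ?\<beta> = "lam + 1/2"
  have \<beta>: "0 < ?\<beta>" using lam by simp
  have G: "0 < Gamma (?\<beta> + real k)" for k using lam by simp
  define A where "A k = (x / s) ^ (2 * k) / (fact k * Gamma (?\<beta> + real k))" for k
  define B where "B k = (z / t) ^ (2 * k) / (fact k * Gamma (?\<beta> + real k))" for k
  define b where "b = 1 / s + 1 / t"
  define c where "c = (2 * s powr (- ?\<beta>) * exp (- x\<^sup>2 / s)) * (2 * t powr (- ?\<beta>) * exp (- z\<^sup>2 / t))"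
  define X where "X = (x / s)\<^sup>2 / b"
  define Z where "Z = (z / t)\<^sup>2 / b"
  have b: "0 < b" using s t by (auto simp: b_def intro: add_pos_pos)
  have A: "0 \<le> A k" and B: "0 \<le> B k" for k using G[of k] by (simp_all add: A_def B_def power_mult)
  have As: "summable (\<lambda>k. A k * y ^ (2 * k))" and Bs: "summable (\<lambda>k. B k * y ^ (2 * k))" for y
    using bessel_series_as_power_series(2)[OF \<beta>] by (auto simp: A_def B_def)
  have c: "0 \<le> c" by (simp add: c_def)
  have bnn: "0 \<le> 1 / (2 * b powr ?\<beta>)" by simp
  define g where "g k y = exp (- b * y\<^sup>2) * y ^ (2 * k) * (\<Sum>l. B l * y ^ (2 * l))" for k and y :: real
  have g0: "0 \<le> g k y" for k y
    unfolding g_def by (intro mult_nonneg_nonneg suminf_nonneg Bs B) (auto simp: power_mult)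
  have gm: "(\<lambda>y. ennreal (g k y)) \<in> borel_measurable (bessel_measure lam)" for k
    unfolding g_def by (rule borel_measurable_bessel) measurable
  have "ennreal (bessel_heat lam s x y) * ennreal (bessel_heat lam t y z) = ennreal c * (\<Sum>k. ennreal (A k) * ennreal (g k y))" for y
  proof -
    have e: "exp (- (x\<^sup>2 + y\<^sup>2) / s) * exp (- (y\<^sup>2 + z\<^sup>2) / t) = exp (- x\<^sup>2 / s) * exp (- z\<^sup>2 / t) * exp (- b * y\<^sup>2)"
    proof -
      have "- (x\<^sup>2 + y\<^sup>2) / s + - (y\<^sup>2 + z\<^sup>2) / t = - x\<^sup>2 / s + - z\<^sup>2 / t + - b * y\<^sup>2"
        using s t by (simp add: b_def field_simps)
      then show ?thesis by (simp only: exp_add[symmetric])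
    qed
    have "bessel_series ?\<beta> ((x * y / s)\<^sup>2) = (\<Sum>k. A k * y ^ (2 * k))"
      using bessel_series_as_power_series(1)[OF \<beta>, of "x / s" y] by (simp add: A_def)
    moreover have "bessel_series ?\<beta> ((y * z / t)\<^sup>2) = (\<Sum>k. B k * y ^ (2 * k))"
      using bessel_series_as_power_series(1)[OF \<beta>, of "z / t" y] by (simp add: B_def mult.commute)
    ultimately have "bessel_heat lam s x y * bessel_heat lam t y z
      = (2 * s powr (- ?\<beta>)) * (2 * t powr (- ?\<beta>)) * (exp (- (x\<^sup>2 + y\<^sup>2) / s) * exp (- (y\<^sup>2 + z\<^sup>2) / t))
         * ((\<Sum>k. A k * y ^ (2 * k)) * (\<Sum>l. B l * y ^ (2 * l)))"
      unfolding bessel_heat_def by (simp only: mult_ac)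
    also have "\<dots> = c * ((\<Sum>k. A k * y ^ (2 * k)) * g 0 y)"
      unfolding e c_def g_def by simp
    finally have p: "bessel_heat lam s x y * bessel_heat lam t y z = c * ((\<Sum>k. A k * y ^ (2 * k)) * g 0 y)" .
    have "(\<lambda>k. A k * y ^ (2 * k) * g 0 y) sums ((\<Sum>k. A k * y ^ (2 * k)) * g 0 y)"
      by (intro sums_mult2 summable_sums As)
    moreover have e': "A k * y ^ (2 * k) * g 0 y = A k * g k y" for k by (simp add: g_def)
    ultimately have "(\<lambda>k. A k * g k y) sums ((\<Sum>k. A k * y ^ (2 * k)) * g 0 y)" unfolding e' by blast
    then have q: "(\<Sum>k. ennreal (A k * g k y)) = ennreal ((\<Sum>k. A k * y ^ (2 * k)) * g 0 y)"
      by (rule suminf_ennreal_eq[rotated]) (intro mult_nonneg_nonneg A g0)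
    have "ennreal (bessel_heat lam s x y) * ennreal (bessel_heat lam t y z) = ennreal (bessel_heat lam s x y * bessel_heat lam t y z)"
      by (intro ennreal_mult[symmetric] bessel_heat_nonneg lam)
    also have "\<dots> = ennreal c * (\<Sum>k. ennreal (A k * g k y))"
      unfolding p q by (rule ennreal_mult'[OF c])
    finally show ?thesis by (simp only: ennreal_mult'[OF A])
  qed
  then have "(\<integral>\<^sup>+y. ennreal (bessel_heat lam s x y) * ennreal (bessel_heat lam t y z) \<partial>bessel_measure lam)
     = (\<integral>\<^sup>+y. ennreal c * (\<Sum>k. ennreal (A k) * ennreal (g k y)) \<partial>bessel_measure lam)"
    by simp
  also have "\<dots> = ennreal c * (\<Sum>k. ennreal (A k) * (\<integral>\<^sup>+y. ennreal (g k y) \<partial>bessel_measure lam))"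
  proof -
    note [measurable] = gm
    show ?thesis by (simp add: nn_integral_cmult nn_integral_suminf)
  qed
  also have "\<dots> = ennreal c * (\<Sum>k. \<Sum>l. ennreal (A k * (B l * (Gamma (?\<beta> + (k + l)) / (2 * b powr (?\<beta> + (k + l)))))))"
    unfolding g_def
    by (subst nn_integral_bessel_gaussian_series[OF lam b B Bs]) (simp only: ennreal_mult'[OF A] ennreal_suminf_cmult)
  also have "(\<lambda>k l. A k * (B l * (Gamma (?\<beta> + (k + l)) / (2 * b powr (?\<beta> + (k + l))))))
    = (\<lambda>k l. 1 / (2 * b powr ?\<beta>) * (X ^ k * Z ^ l * Gamma (?\<beta> + real k + real l) / (fact k * fact l * Gamma (?\<beta> + real k) * Gamma (?\<beta> + real l))))"
  proof (intro ext)
    fix k l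
    have "b powr (?\<beta> + (k + l)) = b powr ?\<beta> * b ^ k * b ^ l"
      using b by (simp add: powr_add powr_realpow power_add)
    moreover have "X ^ k = (x / s) ^ (2 * k) / b ^ k" "Z ^ l = (z / t) ^ (2 * l) / b ^ l"
      by (simp_all add: X_def Z_def power_divide power_mult power_mult_distrib)
    ultimately show "A k * (B l * (Gamma (?\<beta> + (k + l)) / (2 * b powr (?\<beta> + (k + l)))))
      = 1 / (2 * b powr ?\<beta>) * (X ^ k * Z ^ l * Gamma (?\<beta> + real k + real l) / (fact k * fact l * Gamma (?\<beta> + real k) * Gamma (?\<beta> + real l)))"
      by (simp add: A_def B_def add.assoc mult_ac)
  qed
  also have "(\<Sum>k. \<Sum>l. ennreal (1 / (2 * b powr ?\<beta>) * (X ^ k * Z ^ l * Gamma (?\<beta> + real k + real l) / (fact k * fact l * Gamma (?\<beta> + real k) * Gamma (?\<beta> + real l)))))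
     = ennreal (1 / (2 * b powr ?\<beta>)) * (\<Sum>k. \<Sum>l. ennreal (X ^ k * Z ^ l * Gamma (?\<beta> + real k + real l) / (fact k * fact l * Gamma (?\<beta> + real k) * Gamma (?\<beta> + real l))))"
    by (simp only: ennreal_mult'[OF bnn] ennreal_suminf_cmult)
  also have "\<dots> = ennreal (1 / (2 * b powr ?\<beta>)) * ennreal (exp (X + Z) * bessel_series ?\<beta> (X * Z))"
    by (subst bessel_double_series[OF \<beta>]) (use b in \<open>auto simp: X_def Z_def\<close>)
  also have "ennreal c * \<dots> = ennreal (bessel_heat lam (s + t) x z)"
  proof -
    have bst: "b = (s + t) / (s * t)" using s t by (simp add: b_def field_simps)
    have 1: "s powr (- ?\<beta>) * t powr (- ?\<beta>) / b powr ?\<beta> = (s + t) powr (- ?\<beta>)"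
      using s t unfolding bst by (simp add: powr_divide powr_mult powr_minus divide_simps)
    have X: "X = x\<^sup>2 * t / (s * (s + t))" and Z: "Z = z\<^sup>2 * s / (t * (s + t))"
      using s t unfolding X_def Z_def bst by (simp_all add: power2_eq_square field_simps)
    have XZ: "X * Z = (x * z / (s + t))\<^sup>2"
      using s t unfolding X Z by (simp add: power_divide power_mult_distrib) (simp add: power2_eq_square)
    have "- x\<^sup>2 / s + X = - x\<^sup>2 / (s + t)"
      using s t add_pos_pos[OF s t] unfolding X by (simp add: divide_simps) (simp add: algebra_simps)
    moreover have "- z\<^sup>2 / t + Z = - z\<^sup>2 / (s + t)"
      using s t add_pos_pos[OF s t] unfolding Z by (simp add: divide_simps) (simp add: algebra_simps)
    ultimately have "- x\<^sup>2 / s + - z\<^sup>2 / t + (X + Z) = - x\<^sup>2 / (s + t) + - z\<^sup>2 / (s + t)"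
      by linarith
    then have "- x\<^sup>2 / s + - z\<^sup>2 / t + (X + Z) = - (x\<^sup>2 + z\<^sup>2) / (s + t)"
      by (simp add: add_divide_distrib diff_divide_distrib)
    then have 2: "exp (- x\<^sup>2 / s) * exp (- z\<^sup>2 / t) * exp (X + Z) = exp (- (x\<^sup>2 + z\<^sup>2) / (s + t))"
      by (simp only: exp_add[symmetric])
    have "c * (1 / (2 * b powr ?\<beta>) * (exp (X + Z) * bessel_series ?\<beta> (X * Z)))
      = 2 * (s powr (- ?\<beta>) * t powr (- ?\<beta>) / b powr ?\<beta>) * (exp (- x\<^sup>2 / s) * exp (- z\<^sup>2 / t) * exp (X + Z)) * bessel_series ?\<beta> (X * Z)"
      unfolding c_def by simp
    also have "\<dots> = bessel_heat lam (s + t) x z"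
      unfolding 1 2 XZ bessel_heat_def ..
    finally show ?thesis by (simp only: ennreal_mult'[OF c, symmetric] ennreal_mult'[OF bnn, symmetric])
  qed
  finally show ?thesis .
qed

lemma bessel_heat_semigroup_locale:
  assumes "0 < lam"
  shows "symmetric_markov_semigroup (bessel_measure lam) (bessel_heat lam)"
proof -
  interpret sigma_finite_measure "bessel_measure lam" by (rule sigma_finite_bessel_measure)
  have "(\<lambda>(x, y). bessel_heat lam u x y) \<in> borel_measurable (bessel_measure lam \<Otimes>\<^sub>M bessel_measure lam)" for u
    unfolding split_beta'
    by (intro bessel_heat_measurable measurable_const measurable_compose[OF measurable_fst measurable_bessel_id]
        measurable_compose[OF measurable_snd measurable_bessel_id]) simp
  then show ?thesis
  proof (intro symmetric_markov_semigroup.intro symmetric_markov_semigroup_axioms.intro)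
    show "sigma_finite_measure (bessel_measure lam)" ..
  qed (auto intro: bessel_heat_nonneg[OF assms] bessel_heat_sym bessel_heat_mass[OF assms] bessel_heat_semigroup[OF assms])
qed

section \<open>Subordination of the Poisson kernel\<close>

definition sine_moment :: "real \<Rightarrow> nat \<Rightarrow> real" where
  "sine_moment lam n = (LINT \<theta>:{0..pi}|lborel. sin \<theta> powr (2 * lam - 1) * cos \<theta> ^ n)"

lemma sine_weight_derivative:
  assumes "0 < lam" "0 < \<theta>" "\<theta> < pi"
  shows "((\<lambda>\<theta>. sin \<theta> powr (2 * lam) * cos \<theta> ^ n) has_real_derivative
    2 * lam * (sin \<theta> powr (2 * lam - 1) * cos \<theta> ^ Suc n) - real n * (sin \<theta> powr (2 * lam - 1) * (cos \<theta> ^ (n - 1) - cos \<theta> ^ (n - 1) * (cos \<theta>)\<^sup>2))) (at \<theta>)"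
proof -
  have s: "0 < sin \<theta>" using assms by (intro sin_gt_zero) auto
  have e: "sin \<theta> powr (2 * lam) = sin \<theta> * sin \<theta> powr (2 * lam - 1)"
    using s powr_mult_base[of "sin \<theta>" "2 * lam - 1"] by simp
  have c: "(cos \<theta>)\<^sup>2 = 1 - (sin \<theta>)\<^sup>2" by (simp add: cos_squared_eq)
  have "((\<lambda>\<theta>. sin \<theta> powr (2 * lam) * cos \<theta> ^ n) has_real_derivative
     (2 * lam * sin \<theta> powr (2 * lam - 1) * cos \<theta>) * cos \<theta> ^ n + sin \<theta> powr (2 * lam) * (real n * cos \<theta> ^ (n - 1) * - sin \<theta>)) (at \<theta>)"
    using s by (auto intro!: derivative_eq_intros)
  then show ?thesis
    unfolding e c by (rule DERIV_cong) (simp add: algebra_simps power2_eq_square)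
qed

lemma sine_weight_continuous:
  assumes "0 < lam"
  shows "continuous_on {0..pi} (\<lambda>\<theta>. sin \<theta> powr (2 * lam) * cos \<theta> ^ n)"
  using assms by (intro continuous_intros continuous_on_powr') (auto intro: sin_ge_zero)

text \<open>The primitive \<open>sin \<theta> powr (2 * lam) * cos \<theta> ^ n\<close> vanishes at
  both endpoints because \<open>0 < lam\<close>. Each \<open>n\<close> gives one relation between
  moments; for \<open>n = 0\<close> the truncated exponent \<open>n - 1\<close> is multiplied by
  zero.\<close>

lemma sine_weight_ftc:
  assumes "0 < lam"
  shows "((\<lambda>\<theta>. 2 * lam * (sin \<theta> powr (2 * lam - 1) * cos \<theta> ^ Suc n) - real n * (sin \<theta> powr (2 * lam - 1) * (cos \<theta> ^ (n - 1) - cos \<theta> ^ (n - 1) * (cos \<theta>)\<^sup>2)))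
     has_integral 0) {0..pi}"
proof -
  have "((\<lambda>\<theta>. 2 * lam * (sin \<theta> powr (2 * lam - 1) * cos \<theta> ^ Suc n) - real n * (sin \<theta> powr (2 * lam - 1) * (cos \<theta> ^ (n - 1) - cos \<theta> ^ (n - 1) * (cos \<theta>)\<^sup>2)))
     has_integral (sin pi powr (2 * lam) * cos pi ^ n - sin 0 powr (2 * lam) * cos 0 ^ n)) {0..pi}"
    by (rule fundamental_theorem_of_calculus_interior[OF _ sine_weight_continuous[OF assms]])
      (use sine_weight_derivative[OF assms] in \<open>auto simp: has_real_derivative_iff_has_vector_derivative[symmetric]\<close>)
  then show ?thesis by simp
qed

lemma sine_weight_measurable [measurable]: "(\<lambda>\<theta>::real. sin \<theta> powr r) \<in> borel_measurable borel"
proof -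
  have "(sin :: real \<Rightarrow> real) \<in> borel_measurable borel"
    by (intro borel_measurable_continuous_onI continuous_intros)
  moreover have "(\<lambda>x::real. x powr r) \<in> borel_measurable borel" by measurable
  ultimately show ?thesis by (rule measurable_compose)
qed

text \<open>For \<open>lam < 1/2\<close> the weight is unbounded near the endpoints. It is a
  combination of the derivative in \<open>sine_weight_ftc\<close> for \<open>n = 1\<close> and of
  the continuous function \<open>sin \<theta> powr (2 * lam + 1)\<close>, both integrable.\<close>

lemma sine_weight_integrable:
  assumes "0 < lam"
  shows "set_integrable lborel {0..pi} (\<lambda>\<theta>. sin \<theta> powr (2 * lam - 1))"
proof -
  have "continuous_on {0..pi} (\<lambda>\<theta>. sin \<theta> powr (2 * lam + 1))"
    using assms by (intro continuous_intros continuous_on_powr') (auto intro: sin_ge_zero)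
  then have i: "(\<lambda>\<theta>. sin \<theta> powr (2 * lam + 1)) integrable_on {0..pi}"
    by (rule integrable_continuous_interval)
  have j: "(\<lambda>\<theta>. 2 * lam * (sin \<theta> powr (2 * lam - 1) * cos \<theta> ^ Suc 1) - real 1 * (sin \<theta> powr (2 * lam - 1) * (cos \<theta> ^ (1 - 1) - cos \<theta> ^ (1 - 1) * (cos \<theta>)\<^sup>2))) integrable_on {0..pi}"
    using sine_weight_ftc[OF assms, of 1] by (rule has_integral_integrable)
  have "(\<lambda>\<theta>. 1 / (2 * lam) * ((2 * lam * (sin \<theta> powr (2 * lam - 1) * cos \<theta> ^ Suc 1) - real 1 * (sin \<theta> powr (2 * lam - 1) * (cos \<theta> ^ (1 - 1) - cos \<theta> ^ (1 - 1) * (cos \<theta>)\<^sup>2)))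
      + (2 * lam + 1) * sin \<theta> powr (2 * lam + 1))) integrable_on {0..pi}"
    by (intro integrable_on_mult_right integrable_add i j)
  moreover have "1 / (2 * lam) * ((2 * lam * (sin \<theta> powr (2 * lam - 1) * cos \<theta> ^ Suc 1) - real 1 * (sin \<theta> powr (2 * lam - 1) * (cos \<theta> ^ (1 - 1) - cos \<theta> ^ (1 - 1) * (cos \<theta>)\<^sup>2)))
      + (2 * lam + 1) * sin \<theta> powr (2 * lam + 1)) = sin \<theta> powr (2 * lam - 1)" if "\<theta> \<in> {0..pi}" for \<theta>
  proof -
    define w where "w = sin \<theta> powr (2 * lam - 1)"
    have "0 \<le> sin \<theta>" using that by (intro sin_ge_zero) auto
    then have "sin \<theta> powr (2 * lam + 1) = (sin \<theta>)\<^sup>2 * w"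
    proof (cases "sin \<theta> = 0")
      case False
      have "sin \<theta> powr (2 * lam + 1) = sin \<theta> powr ((2 * lam - 1) + 2)"
        by (rule arg_cong[where f = "\<lambda>r. sin \<theta> powr r"]) simp
      also have "\<dots> = w * sin \<theta> powr 2" unfolding w_def by (rule powr_add)
      also have "sin \<theta> powr 2 = (sin \<theta>)\<^sup>2" using \<open>0 \<le> sin \<theta>\<close> False by (simp add: powr_numeral)
      finally show ?thesis by simp
    qed simp
    then have e: "sin \<theta> powr (2 * lam + 1) = (1 - (cos \<theta>)\<^sup>2) * w" by (simp add: sin_squared_eq)
    show ?thesis
      unfolding e w_def[symmetric] using assms by (simp add: field_simps power2_eq_square)
  qed
  ultimately have "(\<lambda>\<theta>. sin \<theta> powr (2 * lam - 1)) integrable_on {0..pi}"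
    by (rule integrable_eq)
  then have "(\<lambda>\<theta>. sin \<theta> powr (2 * lam - 1)) absolutely_integrable_on {0..pi}"
    by (intro nonnegative_absolutely_integrable_1) auto
  then show ?thesis
    unfolding set_integrable_def by (subst (asm) integrable_completion) auto
qed

lemma sine_weight_mult_integrable:
  assumes lam: "0 < lam" and [measurable]: "g \<in> borel_measurable borel" and g: "\<And>\<theta>. \<theta> \<in> {0..pi} \<Longrightarrow> \<bar>g \<theta>\<bar> \<le> B"
  shows "set_integrable lborel {0..pi} (\<lambda>\<theta>. sin \<theta> powr (2 * lam - 1) * g \<theta>)"
  unfolding set_integrable_def
proof (rule Bochner_Integration.integrable_bound)
  show "integrable lborel (\<lambda>\<theta>. indicator {0..pi} \<theta> *\<^sub>R (sin \<theta> powr (2 * lam - 1)) * B)"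
    using sine_weight_integrable[OF lam] unfolding set_integrable_def by simp
  have "\<bar>sin \<theta> powr (2 * lam - 1) * g \<theta>\<bar> \<le> \<bar>sin \<theta> powr (2 * lam - 1) * B\<bar>" if "\<theta> \<in> {0..pi}" for \<theta>
    using g[OF that] by (auto simp: abs_mult intro!: mult_left_mono)
  then show "AE \<theta> in lborel. norm (indicator {0..pi} \<theta> *\<^sub>R (sin \<theta> powr (2 * lam - 1) * g \<theta>))
      \<le> norm (indicator {0..pi} \<theta> *\<^sub>R sin \<theta> powr (2 * lam - 1) * B)"
    by (intro AE_I2) (auto simp: indicator_def)
qed measurable

lemma sine_moment_integrable:
  "0 < lam \<Longrightarrow> set_integrable lborel {0..pi} (\<lambda>\<theta>. sin \<theta> powr (2 * lam - 1) * cos \<theta> ^ n)"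
  by (rule sine_weight_mult_integrable[where B = 1]) (auto simp: power_abs power_le_one)

lemma sine_moment_has_integral:
  assumes "0 < lam"
  shows "((\<lambda>\<theta>. sin \<theta> powr (2 * lam - 1) * cos \<theta> ^ n) has_integral sine_moment lam n) {0..pi}"
  using set_borel_integral_eq_integral[OF sine_moment_integrable[OF assms, of n]]
  unfolding sine_moment_def has_integral_iff by simp

lemma sine_moment_1:
  assumes "0 < lam"
  shows "sine_moment lam 1 = 0"
proof -
  have "((\<lambda>\<theta>. 2 * lam * (sin \<theta> powr (2 * lam - 1) * cos \<theta> ^ 1)) has_integral 2 * lam * sine_moment lam 1) {0..pi}"
    by (intro has_integral_mult_right sine_moment_has_integral assms)
  moreover have "((\<lambda>\<theta>. 2 * lam * (sin \<theta> powr (2 * lam - 1) * cos \<theta> ^ 1)) has_integral 0) {0..pi}"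
    using sine_weight_ftc[OF assms, of 0] by simp
  ultimately have "2 * lam * sine_moment lam 1 = 0" by (rule has_integral_unique)
  then show ?thesis using assms by simp
qed

lemma sine_moment_Suc_Suc:
  assumes "0 < lam"
  shows "(2 * lam + real n + 1) * sine_moment lam (Suc (Suc n)) = (real n + 1) * sine_moment lam n"
proof -
  let ?w = "\<lambda>n \<theta>. sin \<theta> powr (2 * lam - 1) * cos \<theta> ^ n"
  have "((\<lambda>\<theta>. 2 * lam * ?w (Suc (Suc n)) \<theta> - real (Suc n) * (?w n \<theta> - ?w (Suc (Suc n)) \<theta>)) has_integral
      2 * lam * sine_moment lam (Suc (Suc n)) - real (Suc n) * (sine_moment lam n - sine_moment lam (Suc (Suc n)))) {0..pi}"
    by (intro has_integral_mult_right has_integral_diff sine_moment_has_integral assms)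
  moreover have "((\<lambda>\<theta>. 2 * lam * ?w (Suc (Suc n)) \<theta> - real (Suc n) * (?w n \<theta> - ?w (Suc (Suc n)) \<theta>)) has_integral 0) {0..pi}"
    using sine_weight_ftc[OF assms, of "Suc n"] by (simp add: right_diff_distrib power2_eq_square mult_ac)
  ultimately have "2 * lam * sine_moment lam (Suc (Suc n)) - real (Suc n) * (sine_moment lam n - sine_moment lam (Suc (Suc n))) = 0"
    by (rule has_integral_unique)
  then show ?thesis by (simp add: algebra_simps)
qed

lemma sine_moment_odd: "0 < lam \<Longrightarrow> sine_moment lam (Suc (2 * k)) = 0"
proof (induction k)
  case (Suc k)
  have "(2 * lam + real (Suc (2 * k)) + 1) * sine_moment lam (Suc (Suc (Suc (2 * k)))) = 0"
    using sine_moment_Suc_Suc[OF Suc.prems, of "Suc (2 * k)"] Suc by simp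
  then show ?case using Suc.prems by simp
qed (use sine_moment_1 in simp)

text \<open>The odd numbers in the recurrence multiply to
  \<open>fact (2 * k) / (2 ^ k * fact k)\<close>, and the denominators to \<open>2 ^ k\<close> times
  a quotient of Gamma values.\<close>

lemma sine_moment_even:
  assumes "0 < lam"
  shows "sine_moment lam (2 * k) = sine_moment lam 0 * Gamma (lam + 1/2) * fact (2 * k) / (4 ^ k * fact k * Gamma (lam + 1/2 + real k))"
proof (induction k)
  case 0
  have "0 < Gamma (lam + 1/2)" using assms by simp
  then show ?case by simp
next
  case (Suc k)
  let ?b = "lam + 1/2 + real k"
  have b0: "0 < ?b" using assms by simp
  then have np: "?b \<notin> \<int>\<^sub>\<le>\<^sub>0" by (metis nonpos_Ints_nonpos not_le)
  have G: "0 < Gamma ?b" "Gamma (lam + 1/2 + real (Suc k)) = ?b * Gamma ?b"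
    using b0 Gamma_plus1[OF np] by (simp_all add: add_ac)
  have "2 * ?b * sine_moment lam (2 * Suc k) = (2 * real k + 1) * sine_moment lam (2 * k)"
    using sine_moment_Suc_Suc[OF assms, of "2 * k"] by (simp add: algebra_simps)
  then have m: "sine_moment lam (2 * Suc k) = (2 * real k + 1) / (2 * ?b) * sine_moment lam (2 * k)"
    using assms by (simp add: field_simps)
  have f: "fact (2 * Suc k) = (2 * real k + 2) * (2 * real k + 1) * fact (2 * k)"
    by (simp add: algebra_simps)
  show ?case
    unfolding m Suc.IH G(2) f using G(1) b0 by (simp add: divide_simps) (simp add: algebra_simps)
qed

lemma sine_moment_0_pos:
  assumes "0 < lam"
  shows "0 < sine_moment lam 0"
proof -
  let ?f = "\<lambda>\<theta>. indicator {0..pi} \<theta> *\<^sub>R (sin \<theta> powr (2 * lam - 1))"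
  have i: "integrable lborel ?f"
    using sine_weight_integrable[OF assms] by (simp add: set_integrable_def)
  have "sine_moment lam 0 = integral\<^sup>L lborel ?f"
    by (simp add: sine_moment_def set_lebesgue_integral_def)
  moreover have "0 \<le> integral\<^sup>L lborel ?f" by (intro integral_nonneg_AE AE_I2) simp
  moreover have "integral\<^sup>L lborel ?f \<noteq> 0"
  proof
    assume "integral\<^sup>L lborel ?f = 0"
    then have "AE \<theta> in lborel. ?f \<theta> = 0"
      by (subst (asm) integral_nonneg_eq_0_iff_AE[OF i]) auto
    then have "AE \<theta> in lborel. \<theta> \<notin> {0<..<pi}"
    proof eventually_elim
      case (elim \<theta>)
      have "0 < sin \<theta>" if "\<theta> \<in> {0<..<pi}" using that by (intro sin_gt_zero) auto
      then show ?case using elim by (auto simp: indicator_def)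
    qed
    then have "emeasure lborel {0<..<pi} = 0"
      by (subst (asm) AE_iff_measurable[of "{0<..<pi}"]) auto
    then show False by simp
  qed
  ultimately show ?thesis by linarith
qed

text \<open>Poisson's integral representation of the modified Bessel function. In the exponential
  series the odd moments vanish, and \<open>sine_moment_even\<close> turns the even ones into the
  coefficients of \<open>bessel_series\<close>.\<close>

lemma sine_weight_exp_integral:
  assumes lam: "0 < lam"
  shows "(LINT \<theta>:{0..pi}|lborel. sin \<theta> powr (2 * lam - 1) * exp (a * cos \<theta>))
    = sine_moment lam 0 * Gamma (lam + 1/2) * bessel_series (lam + 1/2) ((a / 2)\<^sup>2)"
proof -
  let ?w = "\<lambda>\<theta>. sin \<theta> powr (2 * lam - 1)"
  define f where "f n \<theta> = indicator {0..pi} \<theta> *\<^sub>R (?w \<theta> * cos \<theta> ^ n) * (a ^ n / fact n)" for n \<theta>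
  have fi: "integrable lborel (f n)" for n
    using sine_moment_integrable[OF lam, of n] unfolding f_def set_integrable_def by simp
  have fint: "integral\<^sup>L lborel (f n) = sine_moment lam n * (a ^ n / fact n)" for n
    unfolding f_def sine_moment_def set_lebesgue_integral_def by simp
  have exps: "(\<lambda>n. x ^ n / fact n) sums exp x" for x :: real
    using exp_converges[of x] by (simp add: divide_inverse mult.commute)
  have fn: "norm (f n \<theta>) \<le> indicator {0..pi} \<theta> *\<^sub>R ?w \<theta> * (\<bar>a\<bar> ^ n / fact n)" for n \<theta>
  proof -
    have "\<bar>cos \<theta>\<bar> ^ n \<le> 1" by (simp add: power_le_one)
    then have "?w \<theta> * \<bar>cos \<theta>\<bar> ^ n * (\<bar>a\<bar> ^ n / fact n) \<le> ?w \<theta> * 1 * (\<bar>a\<bar> ^ n / fact n)"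
      by (intro mult_right_mono mult_left_mono) auto
    then show ?thesis by (auto simp: f_def indicator_def abs_mult power_abs)
  qed
  have wi: "integrable lborel (\<lambda>\<theta>. indicator {0..pi} \<theta> *\<^sub>R ?w \<theta>)"
    using sine_weight_integrable[OF lam] by (simp add: set_integrable_def)
  have "(\<lambda>n. integral\<^sup>L lborel (f n)) sums (LINT \<theta>|lborel. (\<Sum>n. f n \<theta>))"
  proof (rule sums_integral[OF fi])
    show "AE \<theta> in lborel. summable (\<lambda>n. norm (f n \<theta>))"
      by (intro AE_I2 summable_comparison_test'[OF summable_mult[OF sums_summable[OF exps[of "\<bar>a\<bar>"]]], of 0])
        (use fn in simp)
    show "summable (\<lambda>n. LINT \<theta>|lborel. norm (f n \<theta>))"
    proof (rule summable_comparison_test'[OF summable_mult[OF sums_summable[OF exps[of "\<bar>a\<bar>"]]], of 0])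
      fix n :: nat
      have "(LINT \<theta>|lborel. norm (f n \<theta>)) \<le> (LINT \<theta>|lborel. indicator {0..pi} \<theta> *\<^sub>R ?w \<theta> * (\<bar>a\<bar> ^ n / fact n))"
        using wi by (intro integral_mono fi integrable_norm fn integrable_mult_left) auto
      then show "norm (LINT \<theta>|lborel. norm (f n \<theta>)) \<le> (LINT \<theta>|lborel. indicator {0..pi} \<theta> *\<^sub>R ?w \<theta>) * (\<bar>a\<bar> ^ n / fact n)"
        by simp
    qed
  qed
  moreover have "(\<Sum>n. f n \<theta>) = indicator {0..pi} \<theta> *\<^sub>R (?w \<theta> * exp (a * cos \<theta>))" for \<theta>
  proof -
    have "(\<lambda>n. indicator {0..pi} \<theta> *\<^sub>R ?w \<theta> * ((a * cos \<theta>) ^ n / fact n)) sums (indicator {0..pi} \<theta> *\<^sub>R ?w \<theta> * exp (a * cos \<theta>))"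
      by (intro sums_mult exps)
    moreover have "indicator {0..pi} \<theta> *\<^sub>R ?w \<theta> * ((a * cos \<theta>) ^ n / fact n) = f n \<theta>" for n
      by (simp add: f_def power_mult_distrib)
    ultimately show ?thesis by (simp add: sums_iff)
  qed
  ultimately have "(\<lambda>n. sine_moment lam n * (a ^ n / fact n)) sums (LINT \<theta>:{0..pi}|lborel. ?w \<theta> * exp (a * cos \<theta>))"
    by (simp add: fint set_lebesgue_integral_def)
  then have "(\<lambda>k. sine_moment lam (2 * k) * (a ^ (2 * k) / fact (2 * k))) sums (LINT \<theta>:{0..pi}|lborel. ?w \<theta> * exp (a * cos \<theta>))"
  proof (subst sums_mono_reindex[of "\<lambda>k. 2 * k"])
    fix n :: nat assume "n \<notin> range (\<lambda>k. 2 * k)"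
    then have "odd n" by (auto elim!: evenE)
    then obtain k where "n = Suc (2 * k)" by (auto elim!: oddE)
    then show "sine_moment lam n * (a ^ n / fact n) = 0" using sine_moment_odd[OF lam] by simp
  qed (auto simp: strict_mono_def)
  moreover have "sine_moment lam (2 * k) * (a ^ (2 * k) / fact (2 * k))
      = sine_moment lam 0 * Gamma (lam + 1/2) * (((a / 2)\<^sup>2) ^ k / (fact k * Gamma (lam + 1/2 + real k)))" for k
  proof -
    have "((a / 2)\<^sup>2) ^ k = a ^ (2 * k) / 4 ^ k"
      by (simp add: power_divide power_mult)
    then show ?thesis by (simp add: sine_moment_even[OF lam])
  qed
  ultimately have "(\<lambda>k. sine_moment lam 0 * Gamma (lam + 1/2) * (((a / 2)\<^sup>2) ^ k / (fact k * Gamma (lam + 1/2 + real k))))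
      sums (LINT \<theta>:{0..pi}|lborel. ?w \<theta> * exp (a * cos \<theta>))" by simp
  moreover have "(\<lambda>k. sine_moment lam 0 * Gamma (lam + 1/2) * (((a / 2)\<^sup>2) ^ k / (fact k * Gamma (lam + 1/2 + real k))))
      sums (sine_moment lam 0 * Gamma (lam + 1/2) * bessel_series (lam + 1/2) ((a / 2)\<^sup>2))"
    unfolding bessel_series_def using lam by (intro sums_mult summable_sums bessel_series_summable) simp
  ultimately show ?thesis by (rule sums_unique2)
qed

text \<open>If \<open>s\<close> has this law, then averaging the heat semigroup at time \<open>t\<^sup>2 / (4 * s)\<close> gives the Poisson
  semigroup at time \<open>t\<close>.\<close>

definition subordinator :: "real measure" where
  "subordinator = density lborel (\<lambda>s. ennreal (indicator {0<..} s * (s powr (- 1/2) * exp (- s)) / Gamma (1/2)))"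

lemma sets_subordinator [measurable_cong, simp]: "sets subordinator = sets borel"
  and space_subordinator [simp]: "space subordinator = UNIV"
  by (simp_all add: subordinator_def)

lemma nn_integral_subordinator:
  assumes [measurable]: "f \<in> borel_measurable borel"
  shows "(\<integral>\<^sup>+s. f s \<partial>subordinator) = (\<integral>\<^sup>+s\<in>{0<..}. ennreal (s powr (- 1/2) * exp (- s) / Gamma (1/2)) * f s \<partial>lborel)"
  unfolding subordinator_def
  by (subst nn_integral_density) (auto intro!: nn_integral_cong simp: indicator_def)

lemma prob_space_subordinator: "prob_space subordinator"
proof (rule prob_spaceI)
  have "emeasure subordinator (space subordinator) = (\<integral>\<^sup>+s. 1 \<partial>subordinator)" by simp
  also have "\<dots> = (\<integral>\<^sup>+s\<in>{0<..}. ennreal (s powr (- 1/2) * exp (- s) / Gamma (1/2)) \<partial>lborel)"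
    by (subst nn_integral_subordinator) simp_all
  also have "\<dots> = 1"
  proof -
    have "((\<lambda>s::real. s powr (1/2 - 1) * exp (- 1 * s) / Gamma (1/2)) has_integral Gamma (1/2) / 1 powr (1/2) / Gamma (1/2)) {0<..}"
      by (intro has_integral_divide gamma_integral_scaled) simp_all
    moreover have "0 < Gamma (1/2 :: real)" by simp
    ultimately show ?thesis
      using nn_integral_has_integral_lebesgue'[of "{0<..}" "\<lambda>s. s powr (- 1/2) * exp (- s) / Gamma (1/2)" 1] by simp
  qed
  finally show "emeasure subordinator (space subordinator) = 1" .
qed

lemma AE_subordinator_pos: "AE s in subordinator. 0 < s"
  unfolding subordinator_def by (subst AE_density) (auto simp: indicator_def)

text \<open>The total mass of the Poisson kernel. It equals \<open>1\<close>, but its value never matters.\<close>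

definition poisson_const :: "real \<Rightarrow> real" where
  "poisson_const lam = lam / pi * sine_moment lam 0 * Gamma (lam + 1/2) * Gamma (1/2) / Gamma (lam + 1)"

lemma poisson_const_pos: "0 < lam \<Longrightarrow> 0 < poisson_const lam"
  unfolding poisson_const_def by (intro divide_pos_pos mult_pos_pos sine_moment_0_pos) auto

section \<open>The Poisson kernel as an average of heat kernels\<close>

lemma poisson_denominator_ge:
  fixes x y t \<theta> :: real
  assumes "0 \<le> x" "0 \<le> y"
  shows "t\<^sup>2 + (x - y)\<^sup>2 \<le> x\<^sup>2 + y\<^sup>2 + t\<^sup>2 - 2 * x * y * cos \<theta>"
proof -
  have "x * y * cos \<theta> \<le> x * y * 1" using assms by (intro mult_left_mono) auto
  then show ?thesis by (simp add: power2_eq_square algebra_simps)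
qed

lemma poisson_integrand_integrable:
  assumes lam: "0 < lam" and t: "0 < t" and xy: "0 \<le> x" "0 \<le> y"
  shows "set_integrable lborel {0..pi} (\<lambda>\<theta>. sin \<theta> powr (2 * lam - 1) / (x\<^sup>2 + y\<^sup>2 + t\<^sup>2 - 2 * x * y * cos \<theta>) powr (lam + 1))"
proof -
  let ?A = "\<lambda>\<theta>. x\<^sup>2 + y\<^sup>2 + t\<^sup>2 - 2 * x * y * cos \<theta>"
  have "\<bar>1 / ?A \<theta> powr (lam + 1)\<bar> \<le> 1 / (t\<^sup>2) powr (lam + 1)" for \<theta>
  proof -
    have "t\<^sup>2 \<le> ?A \<theta>" using poisson_denominator_ge[OF xy, of t \<theta>] zero_le_power2[of "x - y"] by linarith
    then have "(t\<^sup>2) powr (lam + 1) \<le> ?A \<theta> powr (lam + 1)" using lam by (intro powr_mono2) auto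
    then show ?thesis using t by (auto intro!: divide_left_mono mult_pos_pos)
  qed
  then have "set_integrable lborel {0..pi} (\<lambda>\<theta>. sin \<theta> powr (2 * lam - 1) * (1 / ?A \<theta> powr (lam + 1)))"
    by (intro sine_weight_mult_integrable[OF lam, where B = "1 / (t\<^sup>2) powr (lam + 1)"]) auto
  then show ?thesis by simp
qed

text \<open>Euler's integral writes \<open>1 / A \<theta> powr (lam + 1)\<close> as an integral of
  exponentials over \<open>s\<close>. After exchanging the integrals, the one over \<theta> is
  Poisson's representation and returns the heat kernel at \<open>t\<^sup>2 / s\<close>.\<close>

lemma poisson_kernel_subordination:
  assumes lam: "0 < lam" and t: "0 < t" and xy: "0 < x" "0 < y"
  shows "ennreal (bessel_poisson_kernel lam t x y)
    = ennreal (poisson_const lam) * (\<integral>\<^sup>+s. ennreal (bessel_heat lam (t\<^sup>2 / s) x y) \<partial>subordinator)"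
proof -
  let ?w = "\<lambda>\<theta>. sin \<theta> powr (2 * lam - 1)"
  let ?\<beta> = "lam + 1/2"
  define A where "A \<theta> = x\<^sup>2 + y\<^sup>2 + t\<^sup>2 - 2 * x * y * cos \<theta>" for \<theta>
  define c1 where "c1 = 1 / ((t\<^sup>2) powr (lam + 1) * Gamma (lam + 1))"
  define D where "D = sine_moment lam 0 * Gamma ?\<beta>"
  define F where "F s \<theta> = ?w \<theta> * (s powr lam * exp (- (A \<theta> / t\<^sup>2) * s))" for s \<theta>
  have [measurable]: "A \<in> borel_measurable borel" unfolding A_def by measurable
  have A: "0 < A \<theta>" for \<theta>
  proof -
    have "0 < t\<^sup>2" using t by simp
    then show ?thesis
      using poisson_denominator_ge[OF less_imp_le[OF xy(1)] less_imp_le[OF xy(2)], of t \<theta>] zero_le_power2[of "x - y"]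
      unfolding A_def by linarith
  qed
  have G: "0 < Gamma (lam + 1)" "0 < Gamma ?\<beta>" using lam by simp_all
  have c1: "0 \<le> c1" using G by (simp add: c1_def)
  have D: "0 \<le> D" using G sine_moment_0_pos[OF lam] by (simp add: D_def)
  have Gi: "ennreal (?w \<theta> / A \<theta> powr (lam + 1)) = ennreal c1 * (\<integral>\<^sup>+s\<in>{0<..}. ennreal (F s \<theta>) \<partial>lborel)" for \<theta>
  proof -
    have "((\<lambda>s. s powr (lam + 1 - 1) * exp (- (A \<theta> / t\<^sup>2) * s)) has_integral Gamma (lam + 1) / (A \<theta> / t\<^sup>2) powr (lam + 1)) {0<..}"
      by (rule gamma_integral_scaled) (use A[of \<theta>] t lam in auto)
    then have "((\<lambda>s. F s \<theta>) has_integral (?w \<theta> * (Gamma (lam + 1) / (A \<theta> / t\<^sup>2) powr (lam + 1)))) {0<..}"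
      unfolding F_def by (intro has_integral_mult_right) simp
    then have "(\<integral>\<^sup>+s\<in>{0<..}. ennreal (F s \<theta>) \<partial>lborel) = ennreal (?w \<theta> * (Gamma (lam + 1) / (A \<theta> / t\<^sup>2) powr (lam + 1)))"
      by (rule nn_integral_has_integral_lebesgue'[rotated]) (simp add: F_def)
    moreover have "c1 * (?w \<theta> * (Gamma (lam + 1) / (A \<theta> / t\<^sup>2) powr (lam + 1))) = ?w \<theta> / A \<theta> powr (lam + 1)"
      using A[of \<theta>] t G by (simp add: c1_def powr_divide)
    ultimately show ?thesis by (simp only: ennreal_mult'[OF c1, symmetric])
  qed
  have Th: "(\<integral>\<^sup>+\<theta>\<in>{0..pi}. ennreal (F s \<theta>) \<partial>lborel)
     = ennreal (D * (t\<^sup>2) powr ?\<beta> / 2) * (ennreal (s powr (- 1/2) * exp (- s)) * ennreal (bessel_heat lam (t\<^sup>2 / s) x y))" if s: "0 < s" for s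
  proof -
    define a where "a = 2 * x * y * s / t\<^sup>2"
    define E where "E = s powr lam * exp (- s) * exp (- (x\<^sup>2 + y\<^sup>2) / (t\<^sup>2 / s))"
    have E: "0 \<le> E" by (simp add: E_def)
    have "F s \<theta> = E * (?w \<theta> * exp (a * cos \<theta>))" for \<theta>
    proof -
      have "- (A \<theta> / t\<^sup>2) * s = - s + - (x\<^sup>2 + y\<^sup>2) / (t\<^sup>2 / s) + a * cos \<theta>"
        using s t by (simp add: A_def a_def field_simps)
      then have "exp (- (A \<theta> / t\<^sup>2) * s) = exp (- s) * exp (- (x\<^sup>2 + y\<^sup>2) / (t\<^sup>2 / s)) * exp (a * cos \<theta>)"
        by (simp only: exp_add)
      then show ?thesis unfolding F_def E_def by simp
    qed
    then have "(\<integral>\<^sup>+\<theta>\<in>{0..pi}. ennreal (F s \<theta>) \<partial>lborel) = (\<integral>\<^sup>+\<theta>. ennreal E * ennreal (indicator {0..pi} \<theta> *\<^sub>R (?w \<theta> * exp (a * cos \<theta>))) \<partial>lborel)"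
      by (intro nn_integral_cong) (simp only: ennreal_mult'[OF E], simp add: indicator_def)
    also have "\<dots> = ennreal E * (\<integral>\<^sup>+\<theta>. ennreal (indicator {0..pi} \<theta> *\<^sub>R (?w \<theta> * exp (a * cos \<theta>))) \<partial>lborel)"
      by (intro nn_integral_cmult) measurable
    also have "(\<integral>\<^sup>+\<theta>. ennreal (indicator {0..pi} \<theta> *\<^sub>R (?w \<theta> * exp (a * cos \<theta>))) \<partial>lborel)
       = ennreal (LINT \<theta>:{0..pi}|lborel. ?w \<theta> * exp (a * cos \<theta>))"
      unfolding set_lebesgue_integral_def
    proof (rule nn_integral_eq_integral)
      have "\<bar>exp (a * cos \<theta>)\<bar> \<le> exp \<bar>a\<bar>" for \<theta>
      proof -
        have "a * cos \<theta> \<le> \<bar>a\<bar> * \<bar>cos \<theta>\<bar>" by (simp flip: abs_mult)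
        also have "\<dots> \<le> \<bar>a\<bar> * 1" by (intro mult_left_mono abs_cos_le_one) simp
        finally have "a * cos \<theta> \<le> \<bar>a\<bar>" by simp
        then show ?thesis by simp
      qed
      then show "integrable lborel (\<lambda>\<theta>. indicator {0..pi} \<theta> *\<^sub>R (?w \<theta> * exp (a * cos \<theta>)))"
        using sine_weight_mult_integrable[OF lam, of "\<lambda>\<theta>. exp (a * cos \<theta>)" "exp \<bar>a\<bar>"]
        by (simp add: set_integrable_def)
    qed (auto simp: indicator_def)
    also have "\<dots> = ennreal (D * bessel_series ?\<beta> ((a / 2)\<^sup>2))"
      unfolding sine_weight_exp_integral[OF lam] D_def ..
    also have "ennreal E * \<dots> = ennreal (D * (t\<^sup>2) powr ?\<beta> / 2 * (s powr (- 1/2) * exp (- s) * bessel_heat lam (t\<^sup>2 / s) x y))"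
    proof -
      have a2: "a / 2 = x * y / (t\<^sup>2 / s)" using s t by (simp add: a_def)
      have "s powr lam = s powr (- 1/2) * s powr ?\<beta>" using s by (simp flip: powr_add)
      moreover have "(t\<^sup>2) powr ?\<beta> * (t\<^sup>2 / s) powr (- ?\<beta>) = s powr ?\<beta>"
        using s t by (simp add: powr_divide powr_minus divide_simps)
      ultimately have p: "s powr lam = s powr (- 1/2) * ((t\<^sup>2) powr ?\<beta> * (t\<^sup>2 / s) powr (- ?\<beta>))" by (simp only:)
      have "E * (D * bessel_series ?\<beta> ((a / 2)\<^sup>2)) = D * (t\<^sup>2) powr ?\<beta> / 2 * (s powr (- 1/2) * exp (- s) * bessel_heat lam (t\<^sup>2 / s) x y)"
        unfolding E_def a2 p bessel_heat_def by simp
      then show ?thesis by (simp only: ennreal_mult'[OF E, symmetric])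
    qed
    also have "\<dots> = ennreal (D * (t\<^sup>2) powr ?\<beta> / 2) * (ennreal (s powr (- 1/2) * exp (- s)) * ennreal (bessel_heat lam (t\<^sup>2 / s) x y))"
      using D by (subst ennreal_mult') (simp_all add: ennreal_mult')
    finally show ?thesis .
  qed
  define c2 where "c2 = 2 * lam * t / pi"
  have c2: "0 \<le> c2" using lam t by (simp add: c2_def)
  have "ennreal (bessel_poisson_kernel lam t x y) = ennreal c2 * ennreal (LINT \<theta>:{0..pi}|lborel. ?w \<theta> / A \<theta> powr (lam + 1))"
    unfolding bessel_poisson_kernel_def A_def c2_def[symmetric] by (rule ennreal_mult'[OF c2])
  also have "ennreal (LINT \<theta>:{0..pi}|lborel. ?w \<theta> / A \<theta> powr (lam + 1))
      = (\<integral>\<^sup>+\<theta>. ennreal (indicator {0..pi} \<theta> *\<^sub>R (?w \<theta> / A \<theta> powr (lam + 1))) \<partial>lborel)"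
    unfolding set_lebesgue_integral_def
    using poisson_integrand_integrable[OF lam t less_imp_le[OF xy(1)] less_imp_le[OF xy(2)]]
    by (intro nn_integral_eq_integral[symmetric]) (auto simp: set_integrable_def A_def indicator_def)
  also have "\<dots> = (\<integral>\<^sup>+\<theta>. ennreal c1 * (\<integral>\<^sup>+s. ennreal (F s \<theta>) * indicator {0<..} s * indicator {0..pi} \<theta> \<partial>lborel) \<partial>lborel)"
    by (intro nn_integral_cong) (auto simp: indicator_def Gi)
  also have "\<dots> = ennreal c1 * (\<integral>\<^sup>+\<theta>. (\<integral>\<^sup>+s. ennreal (F s \<theta>) * indicator {0<..} s * indicator {0..pi} \<theta> \<partial>lborel) \<partial>lborel)"
    unfolding F_def by (intro nn_integral_cmult) measurable
  also have "(\<integral>\<^sup>+\<theta>. (\<integral>\<^sup>+s. ennreal (F s \<theta>) * indicator {0<..} s * indicator {0..pi} \<theta> \<partial>lborel) \<partial>lborel)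
     = (\<integral>\<^sup>+s. (\<integral>\<^sup>+\<theta>. ennreal (F s \<theta>) * indicator {0<..} s * indicator {0..pi} \<theta> \<partial>lborel) \<partial>lborel)"
    unfolding F_def by (intro lborel_pair.Fubini') measurable
  also have "\<dots> = (\<integral>\<^sup>+s. ennreal (D * (t\<^sup>2) powr ?\<beta> / 2 * Gamma (1/2)) * (ennreal (s powr (- 1/2) * exp (- s) / Gamma (1/2)) * ennreal (bessel_heat lam (t\<^sup>2 / s) x y) * indicator {0<..} s) \<partial>lborel)"
  proof (rule nn_integral_cong)
    fix s :: real
    have "ennreal (D * (t\<^sup>2) powr ?\<beta> / 2) * ennreal (s powr (- 1/2) * exp (- s))
      = ennreal (D * (t\<^sup>2) powr ?\<beta> / 2 * Gamma (1/2)) * ennreal (s powr (- 1/2) * exp (- s) / Gamma (1/2))"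
    proof -
      have g: "0 < Gamma (1/2 :: real)" by simp
      then have nn: "0 \<le> D * (t\<^sup>2) powr ?\<beta> / 2 * Gamma (1/2)" "0 \<le> D * (t\<^sup>2) powr ?\<beta> / 2" using D by simp_all
      have "D * (t\<^sup>2) powr ?\<beta> / 2 * (s powr (- 1/2) * exp (- s)) = D * (t\<^sup>2) powr ?\<beta> / 2 * Gamma (1/2) * (s powr (- 1/2) * exp (- s) / Gamma (1/2))"
        by (simp add: Gamma_one_half_real)
      then show ?thesis by (simp only: ennreal_mult'[OF nn(1), symmetric] ennreal_mult'[OF nn(2), symmetric])
    qed
    then show "(\<integral>\<^sup>+\<theta>. ennreal (F s \<theta>) * indicator {0<..} s * indicator {0..pi} \<theta> \<partial>lborel)
      = ennreal (D * (t\<^sup>2) powr ?\<beta> / 2 * Gamma (1/2)) * (ennreal (s powr (- 1/2) * exp (- s) / Gamma (1/2)) * ennreal (bessel_heat lam (t\<^sup>2 / s) x y) * indicator {0<..} s)"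
      using Th[of s] by (cases "0 < s") (simp_all add: mult.assoc[symmetric])
  qed
  also have "\<dots> = ennreal (D * (t\<^sup>2) powr ?\<beta> / 2 * Gamma (1/2)) * (\<integral>\<^sup>+s\<in>{0<..}. ennreal (s powr (- 1/2) * exp (- s) / Gamma (1/2)) * ennreal (bessel_heat lam (t\<^sup>2 / s) x y) \<partial>lborel)"
    unfolding bessel_heat_def by (intro nn_integral_cmult) measurable
  also have "(\<integral>\<^sup>+s\<in>{0<..}. ennreal (s powr (- 1/2) * exp (- s) / Gamma (1/2)) * ennreal (bessel_heat lam (t\<^sup>2 / s) x y) \<partial>lborel)
     = (\<integral>\<^sup>+s. ennreal (bessel_heat lam (t\<^sup>2 / s) x y) \<partial>subordinator)"
    unfolding bessel_heat_def by (intro nn_integral_subordinator[symmetric]) measurable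
  also have "ennreal c2 * (ennreal c1 * (ennreal (D * (t\<^sup>2) powr ?\<beta> / 2 * Gamma (1/2)) * (\<integral>\<^sup>+s. ennreal (bessel_heat lam (t\<^sup>2 / s) x y) \<partial>subordinator)))
     = ennreal (poisson_const lam) * (\<integral>\<^sup>+s. ennreal (bessel_heat lam (t\<^sup>2 / s) x y) \<partial>subordinator)"
  proof -
    \<comment> \<open>Splitting \<open>lam + 1\<close> as \<open>?\<beta> + 1/2\<close> leaves one
      factor \<open>t\<close>, which cancels the \<open>t\<close> in front of the kernel; the
      resulting constant does not depend on \<open>t\<close>.\<close>
    have "(t\<^sup>2) powr (lam + 1) = (t\<^sup>2) powr (?\<beta> + 1/2)"
      by (rule arg_cong[where f = "\<lambda>r. (t\<^sup>2) powr r"]) simp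
    also have "\<dots> = (t\<^sup>2) powr ?\<beta> * (t\<^sup>2) powr (1/2)" by (rule powr_add)
    also have "(t\<^sup>2) powr (1/2) = t" using t by (simp add: powr_half_sqrt)
    finally have tp: "(t\<^sup>2) powr (lam + 1) = (t\<^sup>2) powr ?\<beta> * t" .
    have "c2 * c1 * (D * (t\<^sup>2) powr ?\<beta> / 2 * Gamma (1/2)) = poisson_const lam"
      using t G unfolding c1_def c2_def tp D_def poisson_const_def by simp
    then show ?thesis
      by (simp only: mult.assoc[symmetric] ennreal_mult'[OF c2, symmetric] ennreal_mult'[OF mult_nonneg_nonneg[OF c2 c1], symmetric])
  qed
  finally show ?thesis .
qed

section \<open>Mixed differences of the Poisson profile\<close>

text \<open>For \<open>k = cos \<theta>\<close> this is the law of cosines: the squared distance of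
  two points of the plane at distances \<open>x\<close> and \<open>y\<close> from the origin, seen
  under the angle \<theta>.\<close>

definition chord :: "real \<Rightarrow> real \<Rightarrow> real \<Rightarrow> real" where
  "chord k x y = x\<^sup>2 + y\<^sup>2 - 2 * x * y * k"

lemma chord_eq: "chord k x y = (y - x * k)\<^sup>2 + x\<^sup>2 * (1 - k\<^sup>2)"
  by (simp add: chord_def power2_eq_square algebra_simps)

text \<open>By \<open>chord_eq\<close>, as \<open>y\<close> moves along a line the chord is the
  squared distance to a fixed point of the plane; going over to the base point \<open>c\<close>
  costs the usual factor 2.\<close>

lemma chord_props:
  assumes k: "\<bar>k\<bar> \<le> 1"
  shows "(y - x * k)\<^sup>2 \<le> chord k x y" "chord k x y \<le> 2 * chord k x c + 2 * (y - c)\<^sup>2"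
proof -
  have "k\<^sup>2 \<le> 1" using k by (simp add: abs_square_le_1)
  then have nn: "0 \<le> x\<^sup>2 * (1 - k\<^sup>2)" by simp
  then show "(y - x * k)\<^sup>2 \<le> chord k x y" by (simp add: chord_eq)
  have "0 \<le> (c - x * k - (y - c))\<^sup>2" by simp
  then have "(y - x * k)\<^sup>2 \<le> 2 * (c - x * k)\<^sup>2 + 2 * (y - c)\<^sup>2"
    by (simp add: power2_eq_square algebra_simps)
  then show "chord k x y \<le> 2 * chord k x c + 2 * (y - c)\<^sup>2"
    using nn by (simp add: chord_eq)
qed

lemma chord_ge:
  assumes "\<bar>k\<bar> \<le> 1" "0 \<le> x" "0 \<le> y"
  shows "(x - y)\<^sup>2 \<le> chord k x y"
proof -
  have "x * y * k \<le> x * y * 1" using assms by (intro mult_left_mono) auto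
  then show ?thesis by (simp add: chord_def power2_eq_square algebra_simps)
qed

lemma chord_deriv: "((\<lambda>y. chord k x y) has_real_derivative 2 * (y - x * k)) (at y)"
  unfolding chord_def by (auto intro!: derivative_eq_intros)

text \<open>\<open>4 * (lam + 1)\<close> comes from the derivative in space together with
  \<open>\<bar>s\<bar> \<le> 2 * sqrt Q\<close>, the factor \<open>2 * lam + 5\<close> from the
  derivative in time, and the power of 3 from comparing \<open>Q\<close> with
  \<open>q\<close>.\<close>

definition mixed_const :: "real \<Rightarrow> real" where
  "mixed_const lam = 4 * (lam + 1) * (2 * lam + 5) * 3 powr (lam + 2)"

lemma poisson_profile_y_deriv:
  assumes "0 < chord k x y + t\<^sup>2"
  shows "((\<lambda>y. t / (chord k x y + t\<^sup>2) powr (lam + 1)) has_real_derivative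
     - 2 * (lam + 1) * (y - x * k) * (t / (chord k x y + t\<^sup>2) powr (lam + 2))) (at y)"
proof -
  let ?q = "chord k x y + t\<^sup>2"
  have p: "?q powr (lam + 2) = ?q * ?q powr (lam + 1)" "?q powr (lam + 1) = ?q * ?q powr lam"
    using powr_mult_base[of ?q "lam + 1"] powr_mult_base[of ?q lam] assms by (simp_all add: add_ac)
  have "((\<lambda>y. (chord k x y + t\<^sup>2) powr (lam + 1)) has_real_derivative (lam + 1) * ?q powr lam * (2 * (y - x * k))) (at y)"
    using assms by (auto intro!: derivative_eq_intros chord_deriv)
  then have "((\<lambda>y. t / (chord k x y + t\<^sup>2) powr (lam + 1)) has_real_derivative
      (0 * ?q powr (lam + 1) - t * ((lam + 1) * ?q powr lam * (2 * (y - x * k)))) / (?q powr (lam + 1) * ?q powr (lam + 1))) (at y)"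
    using assms by (intro DERIV_divide) auto
  moreover have "(0 * (q * L) - t * ((lam + 1) * L * (2 * d))) / ((q * L) * (q * L)) = - 2 * (lam + 1) * d * (t / (q * (q * L)))"
    if "0 < q" "0 < L" for q L d :: real
    using that by (simp add: divide_simps) (simp add: algebra_simps)
  from this[OF assms, of "?q powr lam" "y - x * k"]
  have "(0 * ?q powr (lam + 1) - t * ((lam + 1) * ?q powr lam * (2 * (y - x * k)))) / (?q powr (lam + 1) * ?q powr (lam + 1))
     = - 2 * (lam + 1) * (y - x * k) * (t / ?q powr (lam + 2))"
    unfolding p using assms by simp
  ultimately show ?thesis by (rule DERIV_cong)
qed

lemma poisson_profile_t_deriv:
  fixes q t lam :: real
  assumes "0 < q + t\<^sup>2"
  shows "((\<lambda>t. t / (q + t\<^sup>2) powr (lam + 2)) has_real_derivative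
     (1 - 2 * (lam + 2) * (t\<^sup>2 / (q + t\<^sup>2))) / (q + t\<^sup>2) powr (lam + 2)) (at t)"
proof -
  let ?q = "q + t\<^sup>2"
  have p: "?q powr (lam + 2) = ?q * ?q powr (lam + 1)"
    using powr_mult_base[of ?q "lam + 1"] assms by (simp add: add_ac)
  have "((\<lambda>t. (q + t\<^sup>2) powr (lam + 2)) has_real_derivative (lam + 2) * ?q powr (lam + 1) * (2 * t)) (at t)"
    using assms by (auto intro!: derivative_eq_intros simp: add.commute)
  then have "((\<lambda>t. t / (q + t\<^sup>2) powr (lam + 2)) has_real_derivative
      (1 * ?q powr (lam + 2) - t * ((lam + 2) * ?q powr (lam + 1) * (2 * t))) / (?q powr (lam + 2) * ?q powr (lam + 2))) (at t)"
    using assms by (intro DERIV_divide DERIV_ident) auto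
  moreover have "(1 * (q * L) - t * ((lam + 2) * L * (2 * t))) / ((q * L) * (q * L)) = (1 - 2 * (lam + 2) * (t\<^sup>2 / q)) / (q * L)"
    if "0 < q" "0 < L" for q L :: real
    using that by (simp add: divide_simps power2_eq_square) (simp add: algebra_simps)
  from this[OF assms, of "?q powr (lam + 1)"]
  have "(1 * ?q powr (lam + 2) - t * ((lam + 2) * ?q powr (lam + 1) * (2 * t))) / (?q powr (lam + 2) * ?q powr (lam + 2))
     = (1 - 2 * (lam + 2) * (t\<^sup>2 / ?q)) / ?q powr (lam + 2)"
    unfolding p using assms by simp
  ultimately show ?thesis by (rule DERIV_cong)
qed

text \<open>The time derivative is at most a multiple of \<open>sqrt Q / (Q + t\<^sup>2)\<close>,
  whose primitive is \<open>arctan (t / sqrt Q)\<close>. Bounding by increments of one increasing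
  function, rather than by length times a maximum, gives an estimate that telescopes over
  nonoverlapping time intervals.\<close>

lemma poisson_profile_t_variation:
  fixes lam q Q s e e' :: real
  assumes lam: "0 < lam" and q: "0 < q" "Q \<le> 3 * q" and Q: "0 < Q" and s: "s\<^sup>2 \<le> 2 * Q" and e: "0 < e'" "e' \<le> e"
  shows "\<bar>- 2 * (lam + 1) * s * (e' / (q + e'\<^sup>2) powr (lam + 2)) - - 2 * (lam + 1) * s * (e / (q + e\<^sup>2) powr (lam + 2))\<bar>
    \<le> mixed_const lam / Q powr (lam + 1) * (arctan (e / sqrt Q) - arctan (e' / sqrt Q))"
proof -
  define g where "g t = - 2 * (lam + 1) * s * (t / (q + t\<^sup>2) powr (lam + 2))" for t
  define g' where "g' t = - 2 * (lam + 1) * s * ((1 - 2 * (lam + 2) * (t\<^sup>2 / (q + t\<^sup>2))) / (q + t\<^sup>2) powr (lam + 2))" for t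
  define H where "H t = mixed_const lam / Q powr (lam + 1) * arctan (t / sqrt Q)" for t
  define H' where "H' t = mixed_const lam / Q powr (lam + 1) * (sqrt Q / (Q + t\<^sup>2))" for t
  have qt: "0 < q + t\<^sup>2" for t using q by (simp add: add_pos_nonneg)
  have Qt: "0 < Q + t\<^sup>2" for t using Q by (simp add: add_pos_nonneg)
  have dg: "(g has_real_derivative g' t) (at t)" for t
    unfolding g_def g'_def by (intro DERIV_cmult poisson_profile_t_deriv qt)
  have dH: "(H has_real_derivative H' t) (at t)" for t
  proof -
    have "((\<lambda>t. arctan (t / sqrt Q)) has_real_derivative (1 / sqrt Q) / (1 + (t / sqrt Q)\<^sup>2)) (at t)"
      using DERIV_chain2[OF DERIV_arctan DERIV_cdivide[OF DERIV_ident]] by (simp add: divide_inverse mult.commute)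
    moreover have "(1 / sqrt Q) / (1 + (t / sqrt Q)\<^sup>2) = sqrt Q / (Q + t\<^sup>2)"
    proof -
      have "1 + (t / sqrt Q)\<^sup>2 = (Q + t\<^sup>2) / Q" using Q by (simp add: power_divide field_simps)
      moreover have "Q / sqrt Q = sqrt Q" using Q by (simp add: real_div_sqrt)
      ultimately show ?thesis by simp
    qed
    ultimately have "((\<lambda>t. arctan (t / sqrt Q)) has_real_derivative sqrt Q / (Q + t\<^sup>2)) (at t)" by metis
    then show ?thesis unfolding H_def H'_def by (rule DERIV_cmult)
  qed
  have bound: "\<bar>g' t\<bar> \<le> H' t" for t
  proof -
    have f: "0 \<le> t\<^sup>2 / (q + t\<^sup>2)" "t\<^sup>2 / (q + t\<^sup>2) \<le> 1" using qt[of t] q by (auto simp: divide_simps)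
    have "2 * (lam + 2) * (t\<^sup>2 / (q + t\<^sup>2)) \<le> 2 * (lam + 2) * 1" using lam f by (intro mult_left_mono) auto
    moreover have "0 \<le> 2 * (lam + 2) * (t\<^sup>2 / (q + t\<^sup>2))" using lam f by (intro mult_nonneg_nonneg) auto
    ultimately have a: "\<bar>1 - 2 * (lam + 2) * (t\<^sup>2 / (q + t\<^sup>2))\<bar> \<le> 2 * lam + 5" using lam by simp
    have "s\<^sup>2 \<le> (2 * sqrt Q)\<^sup>2" using s Q by simp
    then have b: "\<bar>s\<bar> \<le> 2 * sqrt Q" using Q by (intro power2_le_imp_le[of "\<bar>s\<bar>"]) auto
    \<comment> \<open>The power \<open>lam + 2\<close> is split: \<open>Q powr (lam + 1)\<close> is
      constant in \<open>t\<close>, and one factor \<open>Q + t\<^sup>2\<close> is kept to make the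
      bound integrable in \<open>t\<close>.\<close>
    have c: "1 / (q + t\<^sup>2) powr (lam + 2) \<le> 3 powr (lam + 2) / (Q powr (lam + 1) * (Q + t\<^sup>2))"
    proof -
      have "Q powr (lam + 1) * (Q + t\<^sup>2) \<le> (Q + t\<^sup>2) powr (lam + 1) * (Q + t\<^sup>2)"
        using Q lam Qt[of t] by (intro mult_right_mono powr_mono2) auto
      also have "\<dots> = (Q + t\<^sup>2) powr (lam + 2)" using Qt[of t] powr_mult_base[of "Q + t\<^sup>2" "lam + 1"] by (simp add: add_ac mult_ac)
      also have "\<dots> \<le> (3 * (q + t\<^sup>2)) powr (lam + 2)"
      proof (rule powr_mono2)
        show "Q + t\<^sup>2 \<le> 3 * (q + t\<^sup>2)" using q zero_le_power2[of t] by (simp only: distrib_left)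
      qed (use Qt[of t] lam in auto)
      also have "\<dots> = 3 powr (lam + 2) * (q + t\<^sup>2) powr (lam + 2)" by (rule powr_mult)
      finally show ?thesis using qt[of t] Qt[of t] Q by (simp add: divide_simps mult_ac)
    qed
    have "\<bar>g' t\<bar> = 2 * (lam + 1) * \<bar>s\<bar> * (\<bar>1 - 2 * (lam + 2) * (t\<^sup>2 / (q + t\<^sup>2))\<bar> * (1 / (q + t\<^sup>2) powr (lam + 2)))"
      using lam unfolding g'_def by (simp add: abs_mult)
    also have "\<dots> \<le> 2 * (lam + 1) * (2 * sqrt Q) * ((2 * lam + 5) * (3 powr (lam + 2) / (Q powr (lam + 1) * (Q + t\<^sup>2))))"
      using lam a b c Q by (intro mult_mono mult_nonneg_nonneg) auto
    also have "\<dots> = H' t" by (simp add: H'_def mixed_const_def)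
    finally show ?thesis .
  qed
  \<comment> \<open>Monotonicity of \<open>H + g\<close> and of \<open>H - g\<close> replaces an
    integration of \<open>g'\<close>.\<close>
  have "H e' + g e' \<le> H e + g e"
  proof (rule DERIV_nonneg_imp_nondecreasing[OF e(2)])
    fix t
    show "\<exists>y. ((\<lambda>t. H t + g t) has_real_derivative y) (at t) \<and> 0 \<le> y"
      using DERIV_add[OF dH dg, of t] bound[of t] by (intro exI[of _ "H' t + g' t"]) auto
  qed
  moreover have "H e' - g e' \<le> H e - g e"
  proof (rule DERIV_nonneg_imp_nondecreasing[OF e(2)])
    fix t
    show "\<exists>y. ((\<lambda>t. H t - g t) has_real_derivative y) (at t) \<and> 0 \<le> y"
      using DERIV_diff[OF dH dg, of t] bound[of t] by (intro exI[of _ "H' t - g' t"]) auto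
  qed
  ultimately have "\<bar>g e' - g e\<bar> \<le> H e - H e'" by linarith
  then show ?thesis unfolding g_def H_def by (simp add: right_diff_distrib)
qed

text \<open>The mean value inequality in space, applied to the difference over a time interval. The
  separation \<open>3 * r \<le> \<bar>x - c\<bar>\<close> makes \<open>Q\<close>, taken at the
  centre, comparable to the chord at every intermediate point.\<close>

lemma poisson_profile_mixed_difference:
  fixes lam k x y c r e e' :: real
  assumes lam: "0 < lam" and k: "\<bar>k\<bar> \<le> 1" and pos: "0 \<le> x" "0 \<le> y" "0 \<le> c"
    and r: "0 < r" "\<bar>y - c\<bar> \<le> r" "3 * r \<le> \<bar>x - c\<bar>" and e: "0 < e'" "e' \<le> e"
  defines "Q \<equiv> chord k x c + r\<^sup>2"
  shows "\<bar>(e' / (chord k x y + e'\<^sup>2) powr (lam + 1) - e / (chord k x y + e\<^sup>2) powr (lam + 1))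
      - (e' / (chord k x c + e'\<^sup>2) powr (lam + 1) - e / (chord k x c + e\<^sup>2) powr (lam + 1))\<bar>
    \<le> r * (mixed_const lam / Q powr (lam + 1) * (arctan (e / sqrt Q) - arctan (e' / sqrt Q)))"
proof -
  define h where "h y = e' / (chord k x y + e'\<^sup>2) powr (lam + 1) - e / (chord k x y + e\<^sup>2) powr (lam + 1)" for y
  define h' where "h' y = - 2 * (lam + 1) * (y - x * k) * (e' / (chord k x y + e'\<^sup>2) powr (lam + 2))
     - - 2 * (lam + 1) * (y - x * k) * (e / (chord k x y + e\<^sup>2) powr (lam + 2))" for y
  define B where "B = mixed_const lam / Q powr (lam + 1) * (arctan (e / sqrt Q) - arctan (e' / sqrt Q))"
  have nnc: "0 \<le> chord k x z" for z
    using chord_props(1)[OF k, of z x] zero_le_power2[of "z - x * k"] by linarith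
  have r2: "0 < r\<^sup>2" using r by simp
  have Q: "0 < Q" unfolding Q_def using nnc[of c] r2 by linarith
  have dh: "(h has_real_derivative h' z) (at z)" for z
    unfolding h_def h'_def using nnc[of z] e
    by (intro DERIV_diff poisson_profile_y_deriv) (auto intro: add_nonneg_pos)
  have hB: "\<bar>h' z\<bar> \<le> B" if z: "z \<in> closed_segment c y" for z
  proof -
    have zc: "\<bar>z - c\<bar> \<le> r" and z0: "0 \<le> z"
      using z r(2) pos by (auto simp: closed_segment_eq_real_ivl split: if_splits)
    have "2 * r \<le> \<bar>x - z\<bar>" using zc r(3) by linarith
    then have "(2 * r)\<^sup>2 \<le> (x - z)\<^sup>2" using r(1) by (intro abs_le_square_iff[THEN iffD1]) auto
    also have "\<dots> \<le> chord k x z" by (rule chord_ge[OF k pos(1) z0])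
    finally have q4: "4 * r\<^sup>2 \<le> chord k x z" by (simp add: power_mult_distrib)
    have zc2: "(z - c)\<^sup>2 \<le> r\<^sup>2" using zc r(1) by (intro abs_le_square_iff[THEN iffD1]) auto
    \<comment> \<open>\<open>Q\<close> is at most \<open>2 * chord k x z\<close> plus
      \<open>3 * r^2\<close>, and by \<open>q4\<close> the latter is at most
      \<open>chord k x z\<close>.\<close>
    have "Q \<le> 3 * chord k x z"
      using chord_props(2)[OF k, of x c z] zc2 q4 r2 unfolding Q_def power2_commute[of c z] by linarith
    moreover have "(z - x * k)\<^sup>2 \<le> 2 * Q"
      using chord_props(1)[OF k, of z x] chord_props(2)[OF k, of x z c] zc2 unfolding Q_def by simp
    moreover have "0 < chord k x z" using q4 r2 by linarith
    ultimately show ?thesis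
      unfolding h'_def B_def by (intro poisson_profile_t_variation lam Q e)
  qed
  have "norm (h y - h c) \<le> B * norm (y - c)"
    by (rule field_differentiable_bound[of "closed_segment c y" h h' B])
      (use dh hB in \<open>auto intro: has_field_derivative_at_within\<close>)
  also have "\<dots> \<le> B * r"
  proof (rule mult_left_mono)
    show "0 \<le> B" using hB[of c] by auto
  qed (use r in simp)
  finally show ?thesis unfolding h_def B_def by (simp add: mult.commute)
qed

section \<open>Finite sequence norms and countable suprema\<close>

definition lp_norm :: "real \<Rightarrow> nat \<Rightarrow> (nat \<Rightarrow> complex) \<Rightarrow> real" where
  "lp_norm p N v = (\<Sum>j<N. cmod (v j) powr p) powr (1 / p)"

lemma lp_norm_nonneg [simp]: "0 \<le> lp_norm p N v"
  by (simp add: lp_norm_def)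

lemma lp_norm_cong: "(\<And>j. j < N \<Longrightarrow> u j = v j) \<Longrightarrow> lp_norm p N u = lp_norm p N v"
  by (simp add: lp_norm_def)

lemma lp_norm_powr: "0 < p \<Longrightarrow> lp_norm p N v powr p = (\<Sum>j<N. cmod (v j) powr p)"
  by (simp add: lp_norm_def powr_powr sum_nonneg)

lemma lp_norm_le_iff:
  assumes "0 < p" "0 \<le> A"
  shows "lp_norm p N v \<le> A \<longleftrightarrow> (\<Sum>j<N. cmod (v j) powr p) \<le> A powr p"
proof
  assume "lp_norm p N v \<le> A"
  then have "lp_norm p N v powr p \<le> A powr p" using assms by (intro powr_mono2) auto
  then show "(\<Sum>j<N. cmod (v j) powr p) \<le> A powr p" using assms by (simp add: lp_norm_powr)
next
  assume "(\<Sum>j<N. cmod (v j) powr p) \<le> A powr p"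
  then have "lp_norm p N v \<le> (A powr p) powr (1 / p)"
    unfolding lp_norm_def using assms by (intro powr_mono2) (auto intro: sum_nonneg)
  then show "lp_norm p N v \<le> A" using assms by (simp add: powr_powr)
qed

lemma lp_norm_eq_0: "0 < p \<Longrightarrow> lp_norm p N v = 0 \<Longrightarrow> j < N \<Longrightarrow> v j = 0"
  by (auto simp: lp_norm_def sum_nonneg_eq_0_iff)

lemma lp_norm_scale:
  assumes "0 < p"
  shows "lp_norm p N (\<lambda>j. c * v j) = cmod c * lp_norm p N v"
proof -
  have "(\<Sum>j<N. cmod (c * v j) powr p) = cmod c powr p * (\<Sum>j<N. cmod (v j) powr p)"
    by (simp add: norm_mult powr_mult sum_distrib_left)
  then show ?thesis using assms by (simp add: lp_norm_def powr_mult powr_powr)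
qed

text \<open>Minkowski's inequality. Both vectors are normalised by their norms \<open>A\<close> and
  \<open>B\<close>, and convexity of the power is applied to the mean with weights
  \<open>A / (A + B)\<close> and \<open>B / (A + B)\<close>. Vanishing norms are treated apart
  because of the normalisation.\<close>

lemma lp_norm_triangle:
  assumes p: "1 \<le> p"
  shows "lp_norm p N (\<lambda>j. u j + v j) \<le> lp_norm p N u + lp_norm p N v"
proof -
  define A B where "A = lp_norm p N u" and "B = lp_norm p N v"
  have p0: "0 < p" using p by simp
  have AB: "0 \<le> A" "0 \<le> B" by (simp_all add: A_def B_def)
  consider "A = 0" | "B = 0" | "0 < A" "0 < B" using AB by linarith
  then show ?thesis
  proof cases
    case 1
    then have "lp_norm p N (\<lambda>j. u j + v j) = lp_norm p N v"
      using lp_norm_eq_0[OF p0, of N u] by (intro lp_norm_cong) (simp add: A_def)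
    then show ?thesis by simp
  next
    case 2
    then have "lp_norm p N (\<lambda>j. u j + v j) = lp_norm p N u"
      using lp_norm_eq_0[OF p0, of N v] by (intro lp_norm_cong) (simp add: B_def)
    then show ?thesis by simp
  next
    case 3
    define \<tau> where "\<tau> = B / (A + B)"
    have \<tau>: "0 \<le> \<tau>" "\<tau> \<le> 1" "1 - \<tau> = A / (A + B)" using 3 by (auto simp: \<tau>_def field_simps)
    have "(\<Sum>j<N. cmod (u j + v j) powr p) \<le> (\<Sum>j<N. (A + B) powr p * ((1 - \<tau>) * (cmod (u j) powr p / A powr p) + \<tau> * (cmod (v j) powr p / B powr p)))"
    proof (rule sum_mono)
      fix j
      have "cmod (u j + v j) powr p \<le> (cmod (u j) + cmod (v j)) powr p"
        using p0 by (intro powr_mono2 norm_triangle_ineq) auto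
      also have "cmod (u j) + cmod (v j) = (A + B) * ((1 - \<tau>) * (cmod (u j) / A) + \<tau> * (cmod (v j) / B))"
      proof -
        have "(A + B) * (1 - \<tau>) = A" "(A + B) * \<tau> = B" using 3 by (simp add: \<tau>(3), simp add: \<tau>_def)
        then show ?thesis using 3 by (simp add: distrib_left flip: mult.assoc)
      qed
      also have "\<dots> powr p = (A + B) powr p * ((1 - \<tau>) * (cmod (u j) / A) + \<tau> * (cmod (v j) / B)) powr p"
        by (rule powr_mult)
      also have "((1 - \<tau>) * (cmod (u j) / A) + \<tau> * (cmod (v j) / B)) powr p
          \<le> (1 - \<tau>) * (cmod (u j) / A) powr p + \<tau> * (cmod (v j) / B) powr p"
        using convex_onD[OF convex_abs_powr[OF p], of \<tau> "cmod (u j) / A" "cmod (v j) / B"] \<tau> 3 by simp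
      finally show "cmod (u j + v j) powr p \<le> (A + B) powr p * ((1 - \<tau>) * (cmod (u j) powr p / A powr p) + \<tau> * (cmod (v j) powr p / B powr p))"
        using 3 by (simp add: powr_divide mult_left_mono)
    qed
    also have "\<dots> = (A + B) powr p * ((1 - \<tau>) * (\<Sum>j<N. cmod (u j) powr p / A powr p) + \<tau> * (\<Sum>j<N. cmod (v j) powr p / B powr p))"
      by (simp only: sum_distrib_left sum.distrib distrib_left)
    also have "\<dots> = (A + B) powr p * ((1 - \<tau>) * ((\<Sum>j<N. cmod (u j) powr p) / A powr p) + \<tau> * ((\<Sum>j<N. cmod (v j) powr p) / B powr p))"
      by (simp only: sum_divide_distrib)
    also have "\<dots> = (A + B) powr p"
      unfolding lp_norm_powr[OF p0, symmetric] A_def[symmetric] B_def[symmetric] using 3 by simp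
    finally show ?thesis using AB by (subst lp_norm_le_iff[OF p0]) (auto simp: A_def B_def)
  qed
qed

lemma lp_norm_sum:
  fixes n :: nat
  assumes "1 \<le> p"
  shows "lp_norm p N (\<lambda>j. \<Sum>i<n. v i j) \<le> (\<Sum>i<n. lp_norm p N (v i))"
proof (induction n)
  case 0
  show ?case using assms by (simp add: lp_norm_def)
next
  case (Suc n)
  then show ?case using lp_norm_triangle[OF assms, of N "\<lambda>j. \<Sum>i<n. v i j" "v n"] by simp
qed

lemma lp_norm_le_sum:
  assumes p: "1 \<le> p"
  shows "lp_norm p N v \<le> (\<Sum>j<N. cmod (v j))"
proof -
  define A where "A = (\<Sum>j<N. cmod (v j))"
  have A: "0 \<le> A" by (simp add: A_def sum_nonneg)
  have "(\<Sum>j<N. cmod (v j) powr p) \<le> (\<Sum>j<N. cmod (v j) * A powr (p - 1))"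
  proof (rule sum_mono)
    fix j assume "j \<in> {..<N}"
    then have "cmod (v j) \<le> A" unfolding A_def by (intro member_le_sum) auto
    then have "cmod (v j) powr (p - 1) \<le> A powr (p - 1)" using p by (intro powr_mono2) auto
    then have "cmod (v j) * cmod (v j) powr (p - 1) \<le> cmod (v j) * A powr (p - 1)"
      by (intro mult_left_mono) auto
    then show "cmod (v j) powr p \<le> cmod (v j) * A powr (p - 1)"
      by (simp add: powr_mult_base)
  qed
  also have "\<dots> = A * A powr (p - 1)" by (simp add: A_def sum_distrib_right)
  also have "\<dots> = A powr p" using A by (simp add: powr_mult_base)
  finally show ?thesis using A p by (subst lp_norm_le_iff) (auto simp: A_def)
qed

lemma lp_norm_continuous_on:
  assumes "0 < p" "\<And>j. j < N \<Longrightarrow> continuous_on S (\<lambda>x. v x j)"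
  shows "continuous_on S (\<lambda>x. lp_norm p N (v x))"
  unfolding lp_norm_def using assms
  by (intro continuous_on_powr' continuous_on_sum continuous_on_norm continuous_on_const) (auto intro!: sum_nonneg)

text \<open>For each level \<open>q\<close> the sets where \<open>h i\<close> exceeds
  \<open>q\<close> are open, so by Lindelof countably many indices cover their union; rational
  levels suffice to recover the supremum. This makes suprema over uncountably many choices of times
  measurable.\<close>

lemma countable_subfamily_same_sup:
  fixes h :: "'i \<Rightarrow> real \<Rightarrow> real"
  assumes c: "\<And>i. i \<in> I \<Longrightarrow> continuous_on {0<..} (h i)" and nn: "\<And>i x. i \<in> I \<Longrightarrow> 0 \<le> h i x" and ne: "I \<noteq> {}"
  obtains J where "J \<subseteq> I" "countable J" "J \<noteq> {}"
    "\<And>x. 0 < x \<Longrightarrow> (SUP i\<in>I. ennreal (h i x)) = (SUP i\<in>J. ennreal (h i x))"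
proof -
  define U where "U q i = {x. 0 < x \<and> q < h i x}" for q i
  have "\<exists>K\<subseteq>I. countable K \<and> (\<Union>i\<in>K. U q i) = (\<Union>i\<in>I. U q i)" for q
  proof -
    have op: "open S" if S: "S \<in> U q ` I" for S
    proof -
      obtain i where i: "i \<in> I" "S = U q i" using S by auto
      have "open ({0<..} \<inter> h i -` {q<..})"
        by (rule continuous_open_preimage[OF c[OF i(1)]]) auto
      moreover have "{0<..} \<inter> h i -` {q<..} = S" using i by (auto simp: U_def)
      ultimately show ?thesis by simp
    qed
    obtain F where F: "F \<subseteq> U q ` I" "countable F" "\<Union>F = \<Union>(U q ` I)"
      using Lindelof[OF op] by blast
    obtain K where "K \<subseteq> I" "countable K" "F = U q ` K"
      using F(1,2) by (meson countable_subset_image)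
    then show ?thesis using F(3) by blast
  qed
  then obtain K where K: "\<And>q. K q \<subseteq> I" "\<And>q. countable (K q)" "\<And>q. (\<Union>i\<in>K q. U q i) = (\<Union>i\<in>I. U q i)"
    by metis
  obtain i0 where i0: "i0 \<in> I" using ne by auto
  \<comment> \<open>\<open>i0\<close> guards against all the sets \<open>K q\<close> being
    empty.\<close>
  let ?J = "insert i0 (\<Union>q\<in>\<rat>. K q)"
  show ?thesis
  proof (rule that[of ?J])
    show "?J \<subseteq> I" using K(1) i0 by auto
    show "countable ?J" using K(2) countable_rat by auto
    fix x :: real assume x: "0 < x"
    show "(SUP i\<in>I. ennreal (h i x)) = (SUP i\<in>?J. ennreal (h i x))"
    proof (rule antisym)
      show "(SUP i\<in>?J. ennreal (h i x)) \<le> (SUP i\<in>I. ennreal (h i x))"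
        using K(1) i0 by (intro SUP_subset_mono) auto
      show "(SUP i\<in>I. ennreal (h i x)) \<le> (SUP i\<in>?J. ennreal (h i x))"
      proof (rule SUP_least)
        fix i assume i: "i \<in> I"
        show "ennreal (h i x) \<le> (SUP i\<in>?J. ennreal (h i x))"
        proof (rule ccontr)
          assume "\<not> ?thesis"
          then have lt: "(SUP i\<in>?J. ennreal (h i x)) < ennreal (h i x)" by simp
          define s where "s = enn2real (SUP i\<in>?J. ennreal (h i x))"
          have s: "(SUP i\<in>?J. ennreal (h i x)) = ennreal s" "0 \<le> s"
            using lt unfolding s_def by (auto simp: ennreal_enn2real_if)
          have "s < h i x" using lt unfolding s(1) using s(2) by (simp add: ennreal_less_iff)
          then obtain q where q: "q \<in> \<rat>" "s < q" "q < h i x" using Rats_dense_in_real by blast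
          then have "x \<in> (\<Union>i\<in>I. U q i)" using x i by (auto simp: U_def)
          then obtain j where j: "j \<in> K q" "q < h j x" unfolding K(3)[symmetric] by (auto simp: U_def)
          have "ennreal (h j x) \<le> ennreal s"
            unfolding s(1)[symmetric] using j(1) q(1) by (intro SUP_upper) auto
          then show False using j(2) q(2) s(2) by (simp add: ennreal_le_iff)
        qed
      qed
    qed
  qed auto
qed

section \<open>The Poisson kernel\<close>

lemma poisson_kernel_measurable:
  assumes [measurable]: "f \<in> borel_measurable M" "g \<in> borel_measurable M"
  shows "(\<lambda>p. bessel_poisson_kernel lam t (f p) (g p)) \<in> borel_measurable M"
  unfolding bessel_poisson_kernel_def set_lebesgue_integral_def by measurable

lemma poisson_kernel_nonneg:
  assumes "0 < lam" "0 < t"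
  shows "0 \<le> bessel_poisson_kernel lam t x y"
  unfolding bessel_poisson_kernel_def set_lebesgue_integral_def using assms
  by (intro mult_nonneg_nonneg divide_nonneg_nonneg integral_nonneg_AE AE_I2) (auto simp: indicator_def)

text \<open>The bound left when the squared distance is dropped from the denominator. It is uniform
  in \<open>x\<close> and \<open>y\<close> but blows up as \<open>t\<close> tends to 0, so it serves
  for a fixed finite set of times.\<close>

definition poisson_bound :: "real \<Rightarrow> real \<Rightarrow> real" where
  "poisson_bound lam t = 2 * lam * t / pi * (sine_moment lam 0 / (t\<^sup>2) powr (lam + 1))"

lemma poisson_integrand_bound:
  fixes lam t x y \<theta> :: real
  assumes "0 < lam" "0 < t" "0 \<le> x" "0 \<le> y"
  shows "sin \<theta> powr (2 * lam - 1) / (x\<^sup>2 + y\<^sup>2 + t\<^sup>2 - 2 * x * y * cos \<theta>) powr (lam + 1)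
    \<le> sin \<theta> powr (2 * lam - 1) * (1 / (t\<^sup>2) powr (lam + 1))"
proof -
  have t2: "0 < t\<^sup>2" using assms by simp
  have "t\<^sup>2 \<le> x\<^sup>2 + y\<^sup>2 + t\<^sup>2 - 2 * x * y * cos \<theta>"
    using poisson_denominator_ge[OF assms(3,4), of t \<theta>] zero_le_power2[of "x - y"] by linarith
  then have "(t\<^sup>2) powr (lam + 1) \<le> (x\<^sup>2 + y\<^sup>2 + t\<^sup>2 - 2 * x * y * cos \<theta>) powr (lam + 1)"
    using assms t2 by (intro powr_mono2) auto
  then have "1 / (x\<^sup>2 + y\<^sup>2 + t\<^sup>2 - 2 * x * y * cos \<theta>) powr (lam + 1) \<le> 1 / (t\<^sup>2) powr (lam + 1)"
    using t2 by (intro divide_left_mono) (auto intro!: mult_pos_pos)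
  then have "sin \<theta> powr (2 * lam - 1) * (1 / (x\<^sup>2 + y\<^sup>2 + t\<^sup>2 - 2 * x * y * cos \<theta>) powr (lam + 1))
     \<le> sin \<theta> powr (2 * lam - 1) * (1 / (t\<^sup>2) powr (lam + 1))"
    by (rule mult_left_mono) simp
  then show ?thesis by simp
qed

lemma poisson_kernel_le:
  assumes "0 < lam" "0 < t" "0 \<le> x" "0 \<le> y"
  shows "bessel_poisson_kernel lam t x y \<le> poisson_bound lam t"
proof -
  have "(LINT \<theta>:{0..pi}|lborel. sin \<theta> powr (2 * lam - 1) / (x\<^sup>2 + y\<^sup>2 + t\<^sup>2 - 2 * x * y * cos \<theta>) powr (lam + 1))
    \<le> (LINT \<theta>:{0..pi}|lborel. sin \<theta> powr (2 * lam - 1) * (1 / (t\<^sup>2) powr (lam + 1)))"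
    by (intro set_integral_mono poisson_integrand_integrable assms poisson_integrand_bound set_integrable_mult_left sine_weight_integrable)
  also have "\<dots> = sine_moment lam 0 / (t\<^sup>2) powr (lam + 1)"
    by (simp add: sine_moment_def)
  finally show ?thesis
    unfolding bessel_poisson_kernel_def poisson_bound_def using assms by (intro mult_left_mono) auto
qed

lemma poisson_kernel_continuous:
  assumes lam: "0 < lam" and t: "0 < t" and y: "0 < y" and x: "0 < x" and X: "\<And>n. 0 < X n" "X \<longlonglongrightarrow> x"
  shows "(\<lambda>n. bessel_poisson_kernel lam t (X n) y) \<longlonglongrightarrow> bessel_poisson_kernel lam t x y"
  unfolding bessel_poisson_kernel_def set_lebesgue_integral_def
proof (intro tendsto_mult_left integral_dominated_convergence)
  show "integrable lborel (\<lambda>\<theta>. indicator {0..pi} \<theta> *\<^sub>R sin \<theta> powr (2 * lam - 1) * (1 / (t\<^sup>2) powr (lam + 1)))"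
    using sine_weight_integrable[OF lam] by (simp add: set_integrable_def)
  show "AE \<theta> in lborel. (\<lambda>n. indicat_real {0..pi} \<theta> *\<^sub>R (sin \<theta> powr (2 * lam - 1) / ((X n)\<^sup>2 + y\<^sup>2 + t\<^sup>2 - 2 * X n * y * cos \<theta>) powr (lam + 1)))
     \<longlonglongrightarrow> indicat_real {0..pi} \<theta> *\<^sub>R (sin \<theta> powr (2 * lam - 1) / (x\<^sup>2 + y\<^sup>2 + t\<^sup>2 - 2 * x * y * cos \<theta>) powr (lam + 1))"
  proof (rule AE_I2)
    fix \<theta>
    have "t\<^sup>2 \<le> x\<^sup>2 + y\<^sup>2 + t\<^sup>2 - 2 * x * y * cos \<theta>"
      using poisson_denominator_ge[OF less_imp_le[OF x] less_imp_le[OF y], of t \<theta>] zero_le_power2[of "x - y"] by linarith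
    moreover have "0 < t\<^sup>2" using t by simp
    ultimately have "0 < x\<^sup>2 + y\<^sup>2 + t\<^sup>2 - 2 * x * y * cos \<theta>" by linarith
    then show "(\<lambda>n. indicat_real {0..pi} \<theta> *\<^sub>R (sin \<theta> powr (2 * lam - 1) / ((X n)\<^sup>2 + y\<^sup>2 + t\<^sup>2 - 2 * X n * y * cos \<theta>) powr (lam + 1)))
     \<longlonglongrightarrow> indicat_real {0..pi} \<theta> *\<^sub>R (sin \<theta> powr (2 * lam - 1) / (x\<^sup>2 + y\<^sup>2 + t\<^sup>2 - 2 * x * y * cos \<theta>) powr (lam + 1))"
      by (intro tendsto_intros X) auto
  qed
  fix n
  show "AE \<theta> in lborel. norm (indicat_real {0..pi} \<theta> *\<^sub>R (sin \<theta> powr (2 * lam - 1) / ((X n)\<^sup>2 + y\<^sup>2 + t\<^sup>2 - 2 * X n * y * cos \<theta>) powr (lam + 1)))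
      \<le> indicator {0..pi} \<theta> *\<^sub>R sin \<theta> powr (2 * lam - 1) * (1 / (t\<^sup>2) powr (lam + 1))"
    using poisson_integrand_bound[OF lam t, of "X n" y] X(1)[of n] y by (intro AE_I2) (auto simp: indicator_def)
qed measurable

text \<open>Subordination reduces the claim to the unit mass of the heat kernels, whose symmetry
  allows integration in the first argument.\<close>

lemma poisson_kernel_mass:
  assumes lam: "0 < lam" and t: "0 < t" and y: "0 < y"
  shows "(\<integral>\<^sup>+x. ennreal (bessel_poisson_kernel lam t x y) \<partial>bessel_measure lam) = ennreal (poisson_const lam)"
proof -
  interpret S: prob_space subordinator by (rule prob_space_subordinator)
  interpret B: sigma_finite_measure "bessel_measure lam" by (rule sigma_finite_bessel_measure)
  interpret pair_sigma_finite subordinator "bessel_measure lam" ..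
  note [measurable] = measurable_bessel_id[of lam]
  have [measurable]: "(\<lambda>p. bessel_heat lam (t\<^sup>2 / fst p) (snd p) y) \<in> borel_measurable (subordinator \<Otimes>\<^sub>M bessel_measure lam)"
    by (intro bessel_heat_measurable measurable_const measurable_compose[OF measurable_snd measurable_bessel_id]) measurable
  have [measurable]: "(\<lambda>p. bessel_heat lam (t\<^sup>2 / snd p) (fst p) y) \<in> borel_measurable (bessel_measure lam \<Otimes>\<^sub>M subordinator)"
    by (intro bessel_heat_measurable measurable_const measurable_compose[OF measurable_fst measurable_bessel_id]) measurable
  have "(\<integral>\<^sup>+x. ennreal (bessel_poisson_kernel lam t x y) \<partial>bessel_measure lam)
     = (\<integral>\<^sup>+x. ennreal (poisson_const lam) * (\<integral>\<^sup>+s. ennreal (bessel_heat lam (t\<^sup>2 / s) x y) \<partial>subordinator) \<partial>bessel_measure lam)"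
    by (intro nn_integral_cong poisson_kernel_subordination lam t y) simp
  also have "\<dots> = ennreal (poisson_const lam) * (\<integral>\<^sup>+x. (\<integral>\<^sup>+s. ennreal (bessel_heat lam (t\<^sup>2 / s) x y) \<partial>subordinator) \<partial>bessel_measure lam)"
    by (intro nn_integral_cmult) (simp add: split_beta')
  also have "(\<integral>\<^sup>+x. (\<integral>\<^sup>+s. ennreal (bessel_heat lam (t\<^sup>2 / s) x y) \<partial>subordinator) \<partial>bessel_measure lam)
     = (\<integral>\<^sup>+s. (\<integral>\<^sup>+x. ennreal (bessel_heat lam (t\<^sup>2 / s) x y) \<partial>bessel_measure lam) \<partial>subordinator)"
    by (intro Fubini') (simp add: split_beta')
  also have "\<dots> = (\<integral>\<^sup>+s. 1 \<partial>subordinator)"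
    using AE_subordinator_pos t
    by (intro nn_integral_cong_AE) (auto elim!: eventually_mono simp: bessel_heat_sym[of lam _ _ y] bessel_heat_mass[OF lam])
  also have "\<dots> = 1" using S.emeasure_space_1 by simp
  finally show ?thesis by simp
qed

lemma poisson_integrable:
  fixes f :: "real \<Rightarrow> complex"
  assumes lam: "0 < lam" and t: "0 < t" and x: "0 < x" and f: "integrable (bessel_measure lam) f"
  shows "integrable (bessel_measure lam) (\<lambda>y. bessel_poisson_kernel lam t x y *\<^sub>R f y)"
proof (rule Bochner_Integration.integrable_bound)
  show "integrable (bessel_measure lam) (\<lambda>y. poisson_bound lam t *\<^sub>R f y)" using f by simp
  show "(\<lambda>y. bessel_poisson_kernel lam t x y *\<^sub>R f y) \<in> borel_measurable (bessel_measure lam)"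
    using f by (intro borel_measurable_scaleR poisson_kernel_measurable measurable_const measurable_bessel_id) auto
  show "AE y in bessel_measure lam. norm (bessel_poisson_kernel lam t x y *\<^sub>R f y) \<le> norm (poisson_bound lam t *\<^sub>R f y)"
  proof (rule AE_I2)
    fix y assume "y \<in> space (bessel_measure lam)"
    then have "\<bar>bessel_poisson_kernel lam t x y\<bar> \<le> \<bar>poisson_bound lam t\<bar>"
      using poisson_kernel_nonneg[OF lam t, of x y] poisson_kernel_le[OF lam t, of x y] x by simp
    then show "norm (bessel_poisson_kernel lam t x y *\<^sub>R f y) \<le> norm (poisson_bound lam t *\<^sub>R f y)"
      by (simp add: mult_right_mono)
  qed
qed

lemma poisson_le:
  assumes lam: "0 < lam" and t: "0 < t" and x: "0 < x" and f: "integrable (bessel_measure lam) f"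
  shows "cmod (bessel_poisson lam t f x) \<le> poisson_bound lam t * (LINT y|bessel_measure lam. cmod (f y))"
proof -
  have "cmod (bessel_poisson lam t f x) \<le> (LINT y|bessel_measure lam. norm (bessel_poisson_kernel lam t x y *\<^sub>R f y))"
    unfolding bessel_poisson_def by (rule integral_norm_bound)
  also have "\<dots> \<le> (LINT y|bessel_measure lam. poisson_bound lam t * cmod (f y))"
    using poisson_kernel_nonneg[OF lam t, of x] poisson_kernel_le[OF lam t, of x] x f
    by (intro integral_mono integrable_norm poisson_integrable lam t x) (auto intro!: mult_right_mono)
  finally show ?thesis by simp
qed

lemma poisson_continuous_on:
  assumes lam: "0 < lam" and t: "0 < t" and f: "integrable (bessel_measure lam) f"
  shows "continuous_on {0<..} (bessel_poisson lam t f)"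
  unfolding continuous_on_sequentially
proof (intro ballI allI impI, elim conjE)
  fix X x assume X: "\<forall>n. X n \<in> {0<..}" "X \<longlonglongrightarrow> x" and x: "x \<in> {0::real<..}"
  have "(\<lambda>n. LINT y|bessel_measure lam. bessel_poisson_kernel lam t (X n) y *\<^sub>R f y)
     \<longlonglongrightarrow> (LINT y|bessel_measure lam. bessel_poisson_kernel lam t x y *\<^sub>R f y)"
  proof (rule integral_dominated_convergence)
    show "(\<lambda>y. bessel_poisson_kernel lam t x y *\<^sub>R f y) \<in> borel_measurable (bessel_measure lam)"
      "\<And>n. (\<lambda>y. bessel_poisson_kernel lam t (X n) y *\<^sub>R f y) \<in> borel_measurable (bessel_measure lam)"
      using f by (intro borel_measurable_scaleR poisson_kernel_measurable measurable_const measurable_bessel_id; auto)+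
    show "integrable (bessel_measure lam) (\<lambda>y. poisson_bound lam t * cmod (f y))" using f by simp
    show "AE y in bessel_measure lam. (\<lambda>n. bessel_poisson_kernel lam t (X n) y *\<^sub>R f y) \<longlonglongrightarrow> bessel_poisson_kernel lam t x y *\<^sub>R f y"
      using X x by (intro AE_I2 tendsto_scaleR poisson_kernel_continuous lam t tendsto_const) auto
    show "AE y in bessel_measure lam. norm (bessel_poisson_kernel lam t (X n) y *\<^sub>R f y) \<le> poisson_bound lam t * cmod (f y)" for n
      using poisson_kernel_nonneg[OF lam t, of "X n"] poisson_kernel_le[OF lam t, of "X n"] X(1)[rule_format, of n]
      by (intro AE_I2) (auto intro!: mult_right_mono)
  qed
  then show "(bessel_poisson lam t f \<circ> X) \<longlonglongrightarrow> bessel_poisson lam t f x"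
    by (simp add: bessel_poisson_def o_def)
qed

section \<open>Subordinated estimates for finitely many times\<close>

definition poisson_real :: "real \<Rightarrow> real \<Rightarrow> (real \<Rightarrow> real) \<Rightarrow> real \<Rightarrow> real" where
  "poisson_real lam t g x = (LINT y|bessel_measure lam. bessel_poisson_kernel lam t x y * g y)"

lemma bessel_poisson_of_real:
  "bessel_poisson lam t (\<lambda>y. complex_of_real (g y)) x = complex_of_real (poisson_real lam t g x)"
  unfolding bessel_poisson_def poisson_real_def
  by (subst integral_complex_of_real[symmetric]) (simp add: scaleR_conv_of_real)

text \<open>\<open>V t s\<close> is the heat flow of \<open>g\<close> at the random time attached to
  \<open>s\<close>. The value zero for \<open>s \<le> 0\<close> is taken on a null set of the law
  and keeps \<open>V\<close> in \<open>[0, M]\<close> for every \<open>s\<close>.\<close>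

lemma poisson_real_subordination:
  fixes g :: "real \<Rightarrow> real"
  assumes lam: "0 < lam" and g[measurable]: "g \<in> borel_measurable (bessel_measure lam)"
    and b: "\<And>y. 0 < y \<Longrightarrow> 0 \<le> g y \<and> g y \<le> M"
  defines "W \<equiv> symmetric_markov_semigroup.W (bessel_measure lam) (bessel_heat lam)"
  defines "V \<equiv> \<lambda>t s x. if 0 < s then W (t\<^sup>2 / s) g x else 0"
  shows "(\<lambda>p. V t (fst p) (snd p)) \<in> borel_measurable (subordinator \<Otimes>\<^sub>M bessel_measure lam)"
    and "0 < t \<Longrightarrow> 0 < x \<Longrightarrow> 0 \<le> V t s x \<and> V t s x \<le> M"
    and "0 < t \<Longrightarrow> 0 < x \<Longrightarrow> poisson_real lam t g x = poisson_const lam * (LINT s|subordinator. V t s x)"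
proof -
  interpret H: symmetric_markov_semigroup "bessel_measure lam" "bessel_heat lam"
    by (rule bessel_heat_semigroup_locale[OF lam])
  interpret S: prob_space subordinator by (rule prob_space_subordinator)
  interpret SB: pair_sigma_finite subordinator "bessel_measure lam" ..
  have W: "W = H.W" by (simp add: W_def)
  have M: "0 \<le> M" using b[of 1] by simp
  show Vm: "(\<lambda>p. V t (fst p) (snd p)) \<in> borel_measurable (subordinator \<Otimes>\<^sub>M bessel_measure lam)" for t
  proof -
    have f: "fst \<in> borel_measurable (subordinator \<Otimes>\<^sub>M bessel_measure lam)"
      using measurable_fst[of subordinator "bessel_measure lam"] by (simp cong: measurable_cong_sets)
    have h: "(\<lambda>q. bessel_heat lam (t\<^sup>2 / fst (fst q)) (snd (fst q)) (snd q)) \<in> borel_measurable ((subordinator \<Otimes>\<^sub>M bessel_measure lam) \<Otimes>\<^sub>M bessel_measure lam)"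
      by (intro bessel_heat_measurable measurable_compose[OF measurable_snd measurable_bessel_id]
          measurable_compose[OF measurable_compose[OF measurable_fst measurable_snd] measurable_bessel_id]
          borel_measurable_divide measurable_const measurable_compose[OF measurable_fst f]) simp
    have "(\<lambda>p. LINT y|bessel_measure lam. bessel_heat lam (t\<^sup>2 / fst p) (snd p) y * g y) \<in> borel_measurable (subordinator \<Otimes>\<^sub>M bessel_measure lam)"
      using borel_measurable_times[OF h measurable_compose[OF measurable_snd g]]
      by (intro H.borel_measurable_lebesgue_integral) (simp add: split_beta')
    then show ?thesis
      unfolding V_def W H.W_def by (intro measurable_If borel_measurable_less f) auto
  qed
  show Vb: "0 \<le> V t s x \<and> V t s x \<le> M" if "0 < t" "0 < x" for t s x
    using H.W_range[of "t\<^sup>2 / s" x g M] that b M by (auto simp: V_def W)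
  show "poisson_real lam t g x = poisson_const lam * (LINT s|subordinator. V t s x)" if t: "0 < t" and x: "0 < x"
  proof -
    have [measurable]: "(\<lambda>q. bessel_heat lam (t\<^sup>2 / fst q) x (snd q)) \<in> borel_measurable (subordinator \<Otimes>\<^sub>M bessel_measure lam)"
      "(\<lambda>q. bessel_heat lam (t\<^sup>2 / snd q) x (fst q)) \<in> borel_measurable (bessel_measure lam \<Otimes>\<^sub>M subordinator)"
      by (intro bessel_heat_measurable measurable_const measurable_compose[OF measurable_snd measurable_bessel_id]
          measurable_compose[OF measurable_fst measurable_bessel_id]; measurable)+
    have Vmx[measurable]: "(\<lambda>s. V t s x) \<in> borel_measurable subordinator"
      using measurable_compose[OF measurable_Pair2'[of x "bessel_measure lam" subordinator] Vm] x by simp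
    have iV: "integrable subordinator (\<lambda>s. V t s x)"
      by (rule S.integrable_const_bound[of _ M]) (use Vb[OF t x] in auto)
    have "(\<integral>\<^sup>+y. ennreal (bessel_poisson_kernel lam t x y * g y) \<partial>bessel_measure lam)
      = (\<integral>\<^sup>+y. ennreal (poisson_const lam) * (\<integral>\<^sup>+s. ennreal (bessel_heat lam (t\<^sup>2 / s) x y) * ennreal (g y) \<partial>subordinator) \<partial>bessel_measure lam)"
    proof (rule nn_integral_cong)
      fix y assume "y \<in> space (bessel_measure lam)"
      then have y: "0 < y" by simp
      have [measurable]: "(\<lambda>s. bessel_heat lam (t\<^sup>2 / s) x y) \<in> borel_measurable subordinator"
        by (intro bessel_heat_measurable) measurable
      have "ennreal (bessel_poisson_kernel lam t x y * g y) = ennreal (bessel_poisson_kernel lam t x y) * ennreal (g y)"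
        using b[OF y] by (intro ennreal_mult poisson_kernel_nonneg lam t) auto
      also have "\<dots> = ennreal (poisson_const lam) * ((\<integral>\<^sup>+s. ennreal (bessel_heat lam (t\<^sup>2 / s) x y) \<partial>subordinator) * ennreal (g y))"
        unfolding poisson_kernel_subordination[OF lam t x y] by (simp only: mult.assoc)
      also have "(\<integral>\<^sup>+s. ennreal (bessel_heat lam (t\<^sup>2 / s) x y) \<partial>subordinator) * ennreal (g y)
         = (\<integral>\<^sup>+s. ennreal (bessel_heat lam (t\<^sup>2 / s) x y) * ennreal (g y) \<partial>subordinator)"
        by (rule nn_integral_multc[symmetric]) measurable
      finally show "ennreal (bessel_poisson_kernel lam t x y * g y)
        = ennreal (poisson_const lam) * (\<integral>\<^sup>+s. ennreal (bessel_heat lam (t\<^sup>2 / s) x y) * ennreal (g y) \<partial>subordinator)" .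
    qed
    also have "\<dots> = ennreal (poisson_const lam) * (\<integral>\<^sup>+y. (\<integral>\<^sup>+s. ennreal (bessel_heat lam (t\<^sup>2 / s) x y) * ennreal (g y) \<partial>subordinator) \<partial>bessel_measure lam)"
      by (intro nn_integral_cmult S.borel_measurable_nn_integral) (simp add: split_beta')
    also have "(\<integral>\<^sup>+y. (\<integral>\<^sup>+s. ennreal (bessel_heat lam (t\<^sup>2 / s) x y) * ennreal (g y) \<partial>subordinator) \<partial>bessel_measure lam)
       = (\<integral>\<^sup>+s. (\<integral>\<^sup>+y. ennreal (bessel_heat lam (t\<^sup>2 / s) x y) * ennreal (g y) \<partial>bessel_measure lam) \<partial>subordinator)"
      by (intro SB.Fubini') (simp add: split_beta')
    also have "\<dots> = (\<integral>\<^sup>+s. ennreal (V t s x) \<partial>subordinator)"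
      using AE_subordinator_pos
    proof (intro nn_integral_cong_AE, eventually_elim)
      case (elim s)
      have "ennreal (H.W (t\<^sup>2 / s) g x) = (\<integral>\<^sup>+y. ennreal (bessel_heat lam (t\<^sup>2 / s) x y) * ennreal (g y) \<partial>bessel_measure lam)"
        using elim t x b by (intro H.nn_W[where B = M]) auto
      then show ?case using elim by (simp add: V_def W)
    qed
    also have "\<dots> = ennreal (LINT s|subordinator. V t s x)"
      using iV Vb[OF t x] by (intro nn_integral_eq_integral) auto
    also have "ennreal (poisson_const lam) * \<dots> = ennreal (poisson_const lam * (LINT s|subordinator. V t s x))"
      using poisson_const_pos[OF lam] by (intro ennreal_mult'[symmetric]) simp
    finally have nn: "(\<integral>\<^sup>+y. ennreal (bessel_poisson_kernel lam t x y * g y) \<partial>bessel_measure lam)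
       = ennreal (poisson_const lam * (LINT s|subordinator. V t s x))" .
    have Kg[measurable]: "(\<lambda>y. bessel_poisson_kernel lam t x y * g y) \<in> borel_measurable (bessel_measure lam)"
      by (intro borel_measurable_times poisson_kernel_measurable measurable_const measurable_bessel_id g) simp
    have "poisson_real lam t g x = enn2real (\<integral>\<^sup>+y. ennreal (bessel_poisson_kernel lam t x y * g y) \<partial>bessel_measure lam)"
      unfolding poisson_real_def
      by (intro integral_eq_nn_integral Kg AE_I2 mult_nonneg_nonneg poisson_kernel_nonneg lam t) (use b in simp)
    moreover have "0 \<le> (LINT s|subordinator. V t s x)"
      using Vb[OF t x] by (intro integral_nonneg_AE) auto
    ultimately show ?thesis
      unfolding nn using poisson_const_pos[OF lam] by simp
  qed
qed

text \<open>Jensen's inequality under the law of the subordinator moves the power of each increment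
  inside the average over \<open>s\<close>. For fixed \<open>s > 0\<close> the heat times
  \<open>(tm i)\<^sup>2 / s\<close> still decrease, and \<open>ctrl\<close> refers to indices only,
  so \<open>rota_maximal\<close> applies with the same \<open>G\<close> and \<open>C\<close> for
  every \<open>s\<close>.\<close>

lemma poisson_finite_family_bound:
  fixes g :: "real \<Rightarrow> real"
  assumes lam: "0 < lam" and g[measurable]: "g \<in> borel_measurable (bessel_measure lam)"
    and b: "\<And>y. 0 < y \<Longrightarrow> 0 \<le> g y \<and> g y \<le> M"
    and G: "predictable G" and C: "0 \<le> C" and p: "1 \<le> p" and A: "finite A" "A \<noteq> {}"
    and tm: "\<And>i. i < n \<Longrightarrow> tm (Suc i) < tm i" "\<And>i. i \<le> n \<Longrightarrow> 0 < tm i"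
    and kl: "\<And>a j. a \<in> A \<Longrightarrow> j < N a \<Longrightarrow> k a j \<le> n \<and> l a j \<le> n"
    and ctrl: "\<And>z a. a \<in> A \<Longrightarrow> (\<And>i. i \<le> n \<Longrightarrow> z i \<in> {0..M}) \<Longrightarrow>
       (\<Sum>j<N a. \<bar>z (k a j) - z (l a j)\<bar> powr p) \<le> C * (z n)\<^sup>2 + (\<Sum>i<n. G i z * (z (Suc i) - z i))"
  shows "(\<integral>\<^sup>+x. (SUP a\<in>A. \<Sum>j<N a. ennreal (\<bar>poisson_real lam (tm (k a j)) g x - poisson_real lam (tm (l a j)) g x\<bar> powr p)) \<partial>bessel_measure lam)
     \<le> ennreal (poisson_const lam powr p) * (ennreal C * (\<integral>\<^sup>+x. ennreal ((g x)\<^sup>2) \<partial>bessel_measure lam))"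
proof -
  interpret H: symmetric_markov_semigroup "bessel_measure lam" "bessel_heat lam"
    by (rule bessel_heat_semigroup_locale[OF lam])
  interpret S: prob_space subordinator by (rule prob_space_subordinator)
  interpret SB: pair_sigma_finite subordinator "bessel_measure lam" ..
  define V where "V t s x = (if 0 < s then H.W (t\<^sup>2 / s) g x else 0)" for t s x
  have sub1: "(\<lambda>p. V t (fst p) (snd p)) \<in> borel_measurable (subordinator \<Otimes>\<^sub>M bessel_measure lam)" for t
    unfolding V_def by (rule poisson_real_subordination(1)[OF lam g b])
  have sub2: "0 \<le> V t s x \<and> V t s x \<le> M" if "0 < t" "0 < x" for t s x
    unfolding V_def by (rule poisson_real_subordination(2)[OF lam g b that])
  have sub3: "poisson_real lam t g x = poisson_const lam * (LINT s|subordinator. V t s x)" if "0 < t" "0 < x" for t x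
    unfolding V_def by (rule poisson_real_subordination(3)[OF lam g b that])
  have Vm[measurable]: "(\<lambda>p. V t (fst p) (snd p)) \<in> borel_measurable (subordinator \<Otimes>\<^sub>M bessel_measure lam)" for t
    by (rule sub1)
  have Vm': "(\<lambda>p. V t (snd p) (fst p)) \<in> borel_measurable (bessel_measure lam \<Otimes>\<^sub>M subordinator)" for t
    using measurable_compose[OF measurable_pair_swap' Vm[of t]] by (simp add: split_beta')
  note Vm'[measurable]
  define F where "F s x = (SUP a\<in>A. \<Sum>j<N a. ennreal (\<bar>V (tm (k a j)) s x - V (tm (l a j)) s x\<bar> powr p))" for s x
  have Fm[measurable]: "(\<lambda>p. F (fst p) (snd p)) \<in> borel_measurable (subordinator \<Otimes>\<^sub>M bessel_measure lam)"
    "(\<lambda>p. F (snd p) (fst p)) \<in> borel_measurable (bessel_measure lam \<Otimes>\<^sub>M subordinator)"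
    unfolding F_def using A by (intro borel_measurable_SUP countable_finite; measurable)+
  let ?\<kappa> = "poisson_const lam"
  have \<kappa>: "0 < ?\<kappa>" by (rule poisson_const_pos[OF lam])
  have "(\<integral>\<^sup>+x. (SUP a\<in>A. \<Sum>j<N a. ennreal (\<bar>poisson_real lam (tm (k a j)) g x - poisson_real lam (tm (l a j)) g x\<bar> powr p)) \<partial>bessel_measure lam)
     \<le> (\<integral>\<^sup>+x. ennreal (?\<kappa> powr p) * (\<integral>\<^sup>+s. F s x \<partial>subordinator) \<partial>bessel_measure lam)"
  proof (intro nn_integral_mono SUP_least)
    fix x a assume "x \<in> space (bessel_measure lam)" and a: "a \<in> A"
    then have x: "0 < x" by simp
    have Vmx[measurable]: "(\<lambda>s. V t s x) \<in> borel_measurable subordinator" for t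
      using measurable_compose[OF measurable_Pair2'[of x "bessel_measure lam" subordinator] Vm[of t]] x by simp
    have "(\<Sum>j<N a. ennreal (\<bar>poisson_real lam (tm (k a j)) g x - poisson_real lam (tm (l a j)) g x\<bar> powr p))
      \<le> (\<Sum>j<N a. ennreal (?\<kappa> powr p) * (\<integral>\<^sup>+s. ennreal (\<bar>V (tm (k a j)) s x - V (tm (l a j)) s x\<bar> powr p) \<partial>subordinator))"
    proof (rule sum_mono)
      fix j assume "j \<in> {..<N a}"
      then have t: "0 < tm (k a j)" "0 < tm (l a j)" using kl[OF a, of j] tm(2) by auto
      note Vk = sub2[OF t(1) x] and Vl = sub2[OF t(2) x]
      have i: "integrable subordinator (\<lambda>s. V (tm (k a j)) s x)" "integrable subordinator (\<lambda>s. V (tm (l a j)) s x)"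
        using Vk Vl by (intro S.integrable_const_bound[of _ M]; auto)+
      have "\<bar>poisson_real lam (tm (k a j)) g x - poisson_real lam (tm (l a j)) g x\<bar>
         = ?\<kappa> * \<bar>LINT s|subordinator. V (tm (k a j)) s x - V (tm (l a j)) s x\<bar>"
        unfolding sub3[OF t(1) x] sub3[OF t(2) x] using i \<kappa>
        by (simp add: abs_mult flip: right_diff_distrib)
      then have "ennreal (\<bar>poisson_real lam (tm (k a j)) g x - poisson_real lam (tm (l a j)) g x\<bar> powr p)
         = ennreal (?\<kappa> powr p) * ennreal (\<bar>LINT s|subordinator. V (tm (k a j)) s x - V (tm (l a j)) s x\<bar> powr p)"
        using \<kappa> by (simp add: powr_mult ennreal_mult)
      also have "\<dots> \<le> ennreal (?\<kappa> powr p) * (\<integral>\<^sup>+s. ennreal (\<bar>V (tm (k a j)) s x - V (tm (l a j)) s x\<bar> powr p) \<partial>subordinator)"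
      proof (intro mult_left_mono S.jensen_abs_powr[OF p, where B = M])
        fix s show "\<bar>V (tm (k a j)) s x - V (tm (l a j)) s x\<bar> \<le> M"
          using Vk[of s] Vl[of s] by linarith
      qed auto
      finally show "ennreal (\<bar>poisson_real lam (tm (k a j)) g x - poisson_real lam (tm (l a j)) g x\<bar> powr p)
        \<le> ennreal (?\<kappa> powr p) * (\<integral>\<^sup>+s. ennreal (\<bar>V (tm (k a j)) s x - V (tm (l a j)) s x\<bar> powr p) \<partial>subordinator)" .
    qed
    also have "\<dots> = ennreal (?\<kappa> powr p) * (\<integral>\<^sup>+s. (\<Sum>j<N a. ennreal (\<bar>V (tm (k a j)) s x - V (tm (l a j)) s x\<bar> powr p)) \<partial>subordinator)"
      by (subst nn_integral_sum) (simp_all add: sum_distrib_left)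
    also have "\<dots> \<le> ennreal (?\<kappa> powr p) * (\<integral>\<^sup>+s. F s x \<partial>subordinator)"
      unfolding F_def by (intro mult_left_mono nn_integral_mono SUP_upper a) simp
    finally show "(\<Sum>j<N a. ennreal (\<bar>poisson_real lam (tm (k a j)) g x - poisson_real lam (tm (l a j)) g x\<bar> powr p))
      \<le> ennreal (?\<kappa> powr p) * (\<integral>\<^sup>+s. F s x \<partial>subordinator)" .
  qed
  also have "\<dots> = ennreal (?\<kappa> powr p) * (\<integral>\<^sup>+x. (\<integral>\<^sup>+s. F s x \<partial>subordinator) \<partial>bessel_measure lam)"
    by (intro nn_integral_cmult S.borel_measurable_nn_integral) (simp add: split_beta')
  also have "(\<integral>\<^sup>+x. (\<integral>\<^sup>+s. F s x \<partial>subordinator) \<partial>bessel_measure lam) = (\<integral>\<^sup>+s. (\<integral>\<^sup>+x. F s x \<partial>bessel_measure lam) \<partial>subordinator)"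
    by (intro SB.Fubini') (simp add: split_beta')
  also have "\<dots> \<le> (\<integral>\<^sup>+s. ennreal C * (\<integral>\<^sup>+x. ennreal ((g x)\<^sup>2) \<partial>bessel_measure lam) \<partial>subordinator)"
    using AE_subordinator_pos
  proof (intro nn_integral_mono_AE, eventually_elim)
    case (elim s)
    have "(\<integral>\<^sup>+x. (SUP a\<in>A. \<Sum>j<N a. ennreal (\<bar>H.W ((tm (k a j))\<^sup>2 / s) g x - H.W ((tm (l a j))\<^sup>2 / s) g x\<bar> powr p)) \<partial>bessel_measure lam)
      \<le> ennreal C * (\<integral>\<^sup>+x. ennreal ((g x)\<^sup>2) \<partial>bessel_measure lam)"
    proof (rule H.rota_maximal[where u = "\<lambda>i. (tm i)\<^sup>2 / s" and n = n and M = M and G = G])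
      show "(tm (Suc i))\<^sup>2 / s < (tm i)\<^sup>2 / s" if "i < n" for i
        using tm(1)[OF that] tm(2)[of "Suc i"] that elim by (auto intro!: divide_strict_right_mono power_strict_mono)
      show "0 < (tm i)\<^sup>2 / s" if "i \<le> n" for i using tm(2)[OF that] elim by simp
    qed (use g b G C p A kl ctrl in auto)
    then show ?case using elim by (simp add: F_def V_def)
  qed
  also have "\<dots> = ennreal C * (\<integral>\<^sup>+x. ennreal ((g x)\<^sup>2) \<partial>bessel_measure lam)"
    using S.emeasure_space_1 by simp
  finally show ?thesis by (simp add: mult_left_mono)
qed

section \<open>Variational operators as suprema over families of time intervals\<close>

text \<open>A member \<open>(N, e', e)\<close> of a family stands for the intervals \<open>[e' j, e j]\<close> with \<open>j < N\<close>.\<close>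

type_synonym intervals = "nat \<times> (nat \<Rightarrow> real) \<times> (nat \<Rightarrow> real)"

definition increments :: "(real \<Rightarrow> (real \<Rightarrow> complex) \<Rightarrow> real \<Rightarrow> complex) \<Rightarrow> (real \<Rightarrow> complex) \<Rightarrow> real \<Rightarrow> intervals \<Rightarrow> nat \<Rightarrow> complex" where
  "increments P f x S j = P (fst (snd S) j) f x - P (snd (snd S) j) f x"

text \<open>Variation and oscillation differ only in the exponent and in the family of intervals, so
  the estimates are proved for this common form. Each member carries finitely many intervals;
  infinite sums are recovered through the supremum.\<close>

definition family_op :: "real \<Rightarrow> intervals set \<Rightarrow> (real \<Rightarrow> (real \<Rightarrow> complex) \<Rightarrow> real \<Rightarrow> complex) \<Rightarrow> (real \<Rightarrow> complex) \<Rightarrow> real \<Rightarrow> ennreal" where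
  "family_op p \<F> P f x = (SUP S\<in>\<F>. ennreal (lp_norm p (fst S) (increments P f x S)))"

definition nonoverlapping :: "intervals set \<Rightarrow> bool" where
  "nonoverlapping \<F> \<longleftrightarrow> (\<forall>(N, e', e)\<in>\<F>. (\<forall>j<N. 0 < e' j \<and> e' j \<le> e j) \<and> (\<forall>j. Suc j < N \<longrightarrow> e (Suc j) \<le> e' j))"

text \<open>Along a martingale the sum with the predictable weights \<open>G\<close> has mean zero, so only the
  quadratic term survives.\<close>

definition controlled :: "real \<Rightarrow> real \<Rightarrow> intervals set \<Rightarrow> bool" where
  "controlled p C \<F> \<longleftrightarrow> (\<forall>M>0. \<forall>A\<subseteq>\<F>. finite A \<longrightarrow> A \<noteq> {} \<longrightarrow> (\<exists>n tm G. predictable G \<and>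
     (\<forall>i<n. tm (Suc i) < tm i) \<and> (\<forall>i\<le>n. 0 < tm i) \<and>
     (\<forall>(N, e', e)\<in>A. \<forall>j<N. e' j \<in> tm ` {..n} \<and> e j \<in> tm ` {..n}) \<and>
     (\<forall>\<zeta>. (\<forall>i\<le>n. \<zeta> (tm i) \<in> {0..M}) \<longrightarrow> (\<forall>(N, e', e)\<in>A.
        (\<Sum>j<N. \<bar>\<zeta> (e' j) - \<zeta> (e j)\<bar> powr p)
          \<le> C * M powr (p - 2) * (\<zeta> (tm n))\<^sup>2 + (\<Sum>i<n. G i (\<lambda>i. \<zeta> (tm i)) * (\<zeta> (tm (Suc i)) - \<zeta> (tm i)))))))"

lemma nonoverlapping_times:
  assumes "nonoverlapping \<F>" "S \<in> \<F>" "j < fst S"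
  shows "0 < fst (snd S) j" "fst (snd S) j \<le> snd (snd S) j" "0 < snd (snd S) j"
  using assms by (auto simp: nonoverlapping_def split_beta' dest!: bspec[of _ _ S])

lemma lp_norm_increments_continuous_on:
  assumes lam: "0 < lam" and F: "nonoverlapping \<F>" "S \<in> \<F>" and p: "0 < p" and f: "integrable (bessel_measure lam) f"
  shows "continuous_on {0<..} (\<lambda>x. lp_norm p (fst S) (increments (bessel_poisson lam) f x S))"
  unfolding increments_def
  by (intro lp_norm_continuous_on p continuous_on_diff poisson_continuous_on lam f nonoverlapping_times[OF F])

lemma family_op_measurable:
  assumes lam: "0 < lam" and F: "nonoverlapping \<F>" "\<F> \<noteq> {}" and p: "0 < p" and f: "integrable (bessel_measure lam) f"
  shows "family_op p \<F> (bessel_poisson lam) f \<in> borel_measurable (bessel_measure lam)"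
proof -
  let ?h = "\<lambda>S x. lp_norm p (fst S) (increments (bessel_poisson lam) f x S)"
  have c: "continuous_on {0<..} (?h S)" if "S \<in> \<F>" for S
    by (rule lp_norm_increments_continuous_on[OF lam F(1) that p f])
  obtain J where J: "J \<subseteq> \<F>" "countable J" "J \<noteq> {}"
    "\<And>x. 0 < x \<Longrightarrow> (SUP S\<in>\<F>. ennreal (?h S x)) = (SUP S\<in>J. ennreal (?h S x))"
    using countable_subfamily_same_sup[of \<F> ?h] c F(2) by auto
  have m: "(\<lambda>x. ennreal (?h S x)) \<in> borel_measurable (bessel_measure lam)" if "S \<in> J" for S
  proof -
    have "continuous_on {0<..} (?h S)" using c J(1) that by blast
    then have "(\<lambda>x. indicator {0<..} x *\<^sub>R ?h S x) \<in> borel_measurable borel"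
      by (rule borel_measurable_continuous_on_indicator[rotated]) simp
    then have "(\<lambda>x. indicator {0<..} x *\<^sub>R ?h S x) \<in> borel_measurable (bessel_measure lam)"
      by (rule borel_measurable_bessel)
    then have "?h S \<in> borel_measurable (bessel_measure lam)"
      by (rule measurable_cong[THEN iffD1, rotated]) simp
    then show ?thesis by measurable
  qed
  have "(\<lambda>x. SUP S\<in>J. ennreal (?h S x)) \<in> borel_measurable (bessel_measure lam)"
    using J(2) m by (rule borel_measurable_SUP)
  then show ?thesis
    unfolding family_op_def by (rule measurable_cong[THEN iffD1, rotated]) (simp add: J(4))
qed

text \<open>\<open>controlled\<close> speaks of finite subfamilies. A countable subfamily with the
  same supremum is exhausted by finite ones, and monotone convergence passes their common bound to
  the limit. The function \<Phi> packages a measurable version of the supremum with its integral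
  bound.\<close>

lemma family_power_bound:
  fixes g :: "real \<Rightarrow> real"
  assumes lam: "0 < lam" and g: "integrable (bessel_measure lam) g"
    and b: "\<And>y. 0 < y \<Longrightarrow> 0 \<le> g y \<and> g y \<le> M" and M: "0 < M"
    and F: "nonoverlapping \<F>" "\<F> \<noteq> {}" "controlled p C \<F>" and p: "1 \<le> p" and C: "0 \<le> C"
  defines "h \<equiv> \<lambda>S x. \<Sum>j<fst S. cmod (increments (bessel_poisson lam) (\<lambda>y. complex_of_real (g y)) x S j) powr p"
  shows "\<exists>\<Phi>. \<Phi> \<in> borel_measurable (bessel_measure lam) \<and> (\<forall>x>0. \<Phi> x = (SUP S\<in>\<F>. ennreal (h S x))) \<and>
     (\<integral>\<^sup>+x. \<Phi> x \<partial>bessel_measure lam)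
     \<le> ennreal (poisson_const lam powr p) * (ennreal (C * M powr (p - 2)) * (\<integral>\<^sup>+x. ennreal ((g x)\<^sup>2) \<partial>bessel_measure lam))"
    (is "\<exists>\<Phi>. _ \<and> _ \<and> _ \<le> ?R")
proof -
  have cg: "integrable (bessel_measure lam) (\<lambda>y. complex_of_real (g y))" using g by simp
  have c: "continuous_on {0<..} (h S)" if S: "S \<in> \<F>" for S
    unfolding h_def increments_def using p
    by (intro continuous_on_sum continuous_on_powr' continuous_on_norm continuous_on_diff poisson_continuous_on lam cg
        continuous_on_const nonoverlapping_times[OF F(1) S]) auto
  have hnn: "0 \<le> h S x" for S x by (simp add: h_def sum_nonneg)
  obtain J where J: "J \<subseteq> \<F>" "countable J" "J \<noteq> {}"
    "\<And>x. 0 < x \<Longrightarrow> (SUP S\<in>\<F>. ennreal (h S x)) = (SUP S\<in>J. ennreal (h S x))"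
    using countable_subfamily_same_sup[of \<F> h] c hnn F(2) by auto
  define J' where "J' n = from_nat_into J ` {..n}" for n
  have J': "finite (J' n)" "J' n \<noteq> {}" "J' n \<subseteq> J" for n
    using from_nat_into[OF J(3)] by (auto simp: J'_def)
  have JU: "J = (\<Union>n. J' n)"
  proof -
    have "range f = (\<Union>n. f ` {..n})" for f :: "nat \<Rightarrow> intervals" by blast
    from this[of "from_nat_into J"] show ?thesis
      unfolding J'_def using range_from_nat_into[OF J(3,2)] by simp
  qed
  have m: "(\<lambda>x. ennreal (h S x)) \<in> borel_measurable (bessel_measure lam)" if "S \<in> J" for S
  proof -
    have "continuous_on {0<..} (h S)" using c J(1) that by blast
    then have "(\<lambda>x. indicator {0<..} x *\<^sub>R h S x) \<in> borel_measurable borel"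
      by (rule borel_measurable_continuous_on_indicator[rotated]) simp
    then have "(\<lambda>x. indicator {0<..} x *\<^sub>R h S x) \<in> borel_measurable (bessel_measure lam)"
      by (rule borel_measurable_bessel)
    then have "h S \<in> borel_measurable (bessel_measure lam)"
      by (rule measurable_cong[THEN iffD1, rotated]) simp
    then show ?thesis by measurable
  qed
  define \<Phi> where "\<Phi> n x = (SUP S\<in>J' n. ennreal (h S x))" for n x
  have \<Phi>m: "\<Phi> n \<in> borel_measurable (bessel_measure lam)" for n
    unfolding \<Phi>_def by (intro borel_measurable_SUP countable_finite J'(1) m) (use J'(3) in blast)
  have inc: "incseq \<Phi>"
    unfolding incseq_def le_fun_def \<Phi>_def by (intro allI impI SUP_subset_mono) (auto simp: J'_def)
  have bound: "(\<integral>\<^sup>+x. \<Phi> n x \<partial>bessel_measure lam) \<le> ?R" for n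
  proof -
    have "J' n \<subseteq> \<F>" using J'(3) J(1) by blast
    from F(3)[unfolded controlled_def, THEN spec, THEN mp, OF M, THEN spec, THEN mp, OF this, THEN mp, OF J'(1), THEN mp, OF J'(2)]
    obtain k tm G where ctrl: "predictable G" "\<forall>i<k. tm (Suc i) < tm i" "\<forall>i\<le>k. 0 < tm i"
      "\<forall>(N, e', e)\<in>J' n. \<forall>j<N. e' j \<in> tm ` {..k} \<and> e j \<in> tm ` {..k}"
      "\<forall>\<zeta>. (\<forall>i\<le>k. \<zeta> (tm i) \<in> {0..M}) \<longrightarrow> (\<forall>(N, e', e)\<in>J' n.
        (\<Sum>j<N. \<bar>\<zeta> (e' j) - \<zeta> (e j)\<bar> powr p)
          \<le> C * M powr (p - 2) * (\<zeta> (tm k))\<^sup>2 + (\<Sum>i<k. G i (\<lambda>i. \<zeta> (tm i)) * (\<zeta> (tm (Suc i)) - \<zeta> (tm i))))"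
      by (elim exE conjE) (rule that; assumption)
    \<comment> \<open>Control is stated for functions of time, the martingale estimate for
      sequences. \<open>idx\<close> translates between the two, and inverts \<open>tm\<close> on
      both sides since the times strictly decrease.\<close>
    define idx where "idx = inv_into {..k} tm"
    have idx: "tm (idx t) = t" "idx t \<le> k" if "t \<in> tm ` {..k}" for t
      using f_inv_into_f[OF that] inv_into_into[OF that] by (auto simp: idx_def)
    have "tm j < tm i" if "i < j" "j \<le> k" for i j
      using that
    proof (induction j rule: less_induct)
      case (less j)
      then obtain j' where j': "j = Suc j'" by (cases j) auto
      then have "tm j < tm j'" using ctrl(2) less.prems by simp
      then show ?case using less.IH[of j'] less.prems j' by (cases "i = j'") auto
    qed
    then have inj: "inj_on tm {..k}"
      by (intro linorder_inj_onI) (auto, metis less_irrefl)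
    have idx': "idx (tm i) = i" if "i \<le> k" for i
      unfolding idx_def using inv_into_f_f[OF inj] that by simp
    have times: "fst (snd S) j \<in> tm ` {..k}" "snd (snd S) j \<in> tm ` {..k}" if "S \<in> J' n" "j < fst S" for S j
      using ctrl(4) that by (auto simp: split_beta' dest!: bspec[of _ _ S])
    have "(\<integral>\<^sup>+x. \<Phi> n x \<partial>bessel_measure lam) = (\<integral>\<^sup>+x. (SUP S\<in>J' n. \<Sum>j<fst S.
        ennreal (\<bar>poisson_real lam (tm (idx (fst (snd S) j))) g x - poisson_real lam (tm (idx (snd (snd S) j))) g x\<bar> powr p)) \<partial>bessel_measure lam)"
      unfolding \<Phi>_def h_def increments_def bessel_poisson_of_real
    proof (intro nn_integral_cong SUP_cong refl)
      fix x S assume S: "S \<in> J' n"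
      have "ennreal (\<Sum>j<fst S. cmod (complex_of_real (poisson_real lam (fst (snd S) j) g x) - complex_of_real (poisson_real lam (snd (snd S) j) g x)) powr p)
        = (\<Sum>j<fst S. ennreal (cmod (complex_of_real (poisson_real lam (fst (snd S) j) g x) - complex_of_real (poisson_real lam (snd (snd S) j) g x)) powr p))"
        by (rule sum_ennreal[symmetric]) simp
      also have "\<dots> = (\<Sum>j<fst S. ennreal (\<bar>poisson_real lam (tm (idx (fst (snd S) j))) g x - poisson_real lam (tm (idx (snd (snd S) j))) g x\<bar> powr p))"
        using S by (intro sum.cong refl) (simp add: idx(1) times flip: of_real_diff)
      finally show "ennreal (\<Sum>j<fst S. cmod (complex_of_real (poisson_real lam (fst (snd S) j) g x) - complex_of_real (poisson_real lam (snd (snd S) j) g x)) powr p)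
        = (\<Sum>j<fst S. ennreal (\<bar>poisson_real lam (tm (idx (fst (snd S) j))) g x - poisson_real lam (tm (idx (snd (snd S) j))) g x\<bar> powr p))" .
    qed
    also have "\<dots> \<le> ?R"
    proof (rule poisson_finite_family_bound[where M = M and G = G and n = k])
      fix z :: "nat \<Rightarrow> real" and S assume S: "S \<in> J' n" and z: "\<And>i. i \<le> k \<Longrightarrow> z i \<in> {0..M}"
      have "\<forall>i\<le>k. z (idx (tm i)) \<in> {0..M}" using z idx' by simp
      then have "\<forall>(N, e', e)\<in>J' n.
        (\<Sum>j<N. \<bar>z (idx (e' j)) - z (idx (e j))\<bar> powr p)
          \<le> C * M powr (p - 2) * (z (idx (tm k)))\<^sup>2 + (\<Sum>i<k. G i (\<lambda>i. z (idx (tm i))) * (z (idx (tm (Suc i))) - z (idx (tm i))))"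
        using ctrl(5)[rule_format, of "\<lambda>t. z (idx t)"] by blast
      then have "(\<Sum>j<fst S. \<bar>z (idx (fst (snd S) j)) - z (idx (snd (snd S) j))\<bar> powr p)
          \<le> C * M powr (p - 2) * (z (idx (tm k)))\<^sup>2 + (\<Sum>i<k. G i (\<lambda>i. z (idx (tm i))) * (z (idx (tm (Suc i))) - z (idx (tm i))))"
        using S by (auto simp: split_beta')
      also have "(\<Sum>i<k. G i (\<lambda>i. z (idx (tm i))) * (z (idx (tm (Suc i))) - z (idx (tm i)))) = (\<Sum>i<k. G i z * (z (Suc i) - z i))"
      proof (rule sum.cong)
        fix i assume i: "i \<in> {..<k}"
        have "G i (\<lambda>i. z (idx (tm i))) = G i z"
          by (rule ctrl(1)[unfolded predictable_def, rule_format]) (use i idx' in auto)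
        then show "G i (\<lambda>i. z (idx (tm i))) * (z (idx (tm (Suc i))) - z (idx (tm i))) = G i z * (z (Suc i) - z i)"
          using i idx' by simp
      qed simp
      finally show "(\<Sum>j<fst S. \<bar>z (idx (fst (snd S) j)) - z (idx (snd (snd S) j))\<bar> powr p)
         \<le> C * M powr (p - 2) * (z k)\<^sup>2 + (\<Sum>i<k. G i z * (z (Suc i) - z i))"
        by (simp add: idx')
    qed (use lam g b ctrl p C J'(1,2)[of n] idx times in auto)
    finally show ?thesis .
  qed
  have sup: "(SUP n. \<Phi> n x) = (SUP S\<in>\<F>. ennreal (h S x))" if "0 < x" for x
    unfolding J(4)[OF that] \<Phi>_def by (subst JU) (simp add: SUP_UNION)
  show ?thesis
  proof (intro exI[of _ "\<lambda>x. SUP n. \<Phi> n x"] conjI allI impI sup)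
    show "(\<lambda>x. SUP n. \<Phi> n x) \<in> borel_measurable (bessel_measure lam)"
      using \<Phi>m by (intro borel_measurable_SUP) auto
    show "(\<integral>\<^sup>+x. (SUP n. \<Phi> n x) \<partial>bessel_measure lam) \<le> ?R"
      by (subst nn_integral_monotone_convergence_SUP[OF inc \<Phi>m]) (intro SUP_least bound)
  qed
qed

text \<open>\<open>M\<close> enters the final bound only through \<open>M * \<beta>\<close> and
  \<open>M * \<mu>\<close>, because the exponents \<open>1 - p\<close>, \<open>p - 2\<close> and 2
  add up to 1. For an atom \<open>M\<close> is \<open>1 / \<mu>\<close> and \<beta> a fixed multiple
  of \<mu>, so the bound does not depend on the interval.\<close>

lemma family_op_local_bound:
  fixes g :: "real \<Rightarrow> real"
  assumes lam: "0 < lam" and g: "integrable (bessel_measure lam) g"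
    and b: "\<And>y. 0 < y \<Longrightarrow> 0 \<le> g y \<and> g y \<le> M" and M: "0 < M"
    and F: "nonoverlapping \<F>" "\<F> \<noteq> {}" "controlled p C \<F>" and p: "1 \<le> p" and C: "0 \<le> C"
    and B: "B \<in> sets (bessel_measure lam)" "emeasure (bessel_measure lam) B \<le> ennreal \<beta>" "0 \<le> \<beta>"
    and \<mu>: "(\<integral>\<^sup>+x. ennreal ((g x)\<^sup>2) \<partial>bessel_measure lam) \<le> ennreal (M\<^sup>2 * \<mu>)" "0 \<le> \<mu>"
  shows "(\<integral>\<^sup>+x\<in>B. family_op p \<F> (bessel_poisson lam) (\<lambda>y. complex_of_real (g y)) x \<partial>bessel_measure lam)
     \<le> ennreal (M * \<beta> + poisson_const lam powr p * C * (M * \<mu>))"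
proof -
  let ?inc = "increments (bessel_poisson lam) (\<lambda>y. complex_of_real (g y))"
  obtain \<Phi> where \<Phi>[measurable]: "\<Phi> \<in> borel_measurable (bessel_measure lam)"
    and \<Phi>eq: "\<And>x. 0 < x \<Longrightarrow> \<Phi> x = (SUP S\<in>\<F>. ennreal (\<Sum>j<fst S. cmod (?inc x S j) powr p))"
    and \<Phi>int: "(\<integral>\<^sup>+x. \<Phi> x \<partial>bessel_measure lam)
     \<le> ennreal (poisson_const lam powr p) * (ennreal (C * M powr (p - 2)) * (\<integral>\<^sup>+x. ennreal ((g x)\<^sup>2) \<partial>bessel_measure lam))"
    using family_power_bound[OF lam g b M F p C] by blast
  have [measurable]: "B \<in> sets (bessel_measure lam)" by (rule B(1))
  \<comment> \<open>\<open>v \<le> M + v\<^sup>p M\<^sup>1\<^sup>-\<^sup>p\<close> replaces Hoelder's inequality on \<open>B\<close>.\<close>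
  have pw: "family_op p \<F> (bessel_poisson lam) (\<lambda>y. complex_of_real (g y)) x \<le> ennreal M + ennreal (M powr (1 - p)) * \<Phi> x" if x: "0 < x" for x
    unfolding family_op_def
  proof (rule SUP_least)
    fix S assume S: "S \<in> \<F>"
    define v where "v = lp_norm p (fst S) (?inc x S)"
    have vp: "v powr p = (\<Sum>j<fst S. cmod (?inc x S j) powr p)" unfolding v_def using p by (intro lp_norm_powr) simp
    have v0: "0 \<le> v" by (simp add: v_def)
    have "v \<le> M + M powr (1 - p) * v powr p"
    proof (cases "v \<le> M")
      case False
      then have "v powr (1 - p) \<le> M powr (1 - p)" using M p by (intro powr_mono2') auto
      then have "v powr (1 - p) * v powr p \<le> M powr (1 - p) * v powr p" by (intro mult_right_mono) auto
      moreover have "v powr (1 - p) * v powr p = v" using False M by (simp flip: powr_add)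
      ultimately show ?thesis using M by linarith
    qed (use M in \<open>simp add: add_increasing2\<close>)
    then have "ennreal v \<le> ennreal (M + M powr (1 - p) * v powr p)" by (rule ennreal_leI)
    also have "\<dots> = ennreal M + ennreal (M powr (1 - p)) * ennreal (v powr p)"
      using M by (simp add: ennreal_plus ennreal_mult)
    also have "ennreal (v powr p) \<le> \<Phi> x" unfolding vp \<Phi>eq[OF x] by (rule SUP_upper[OF S])
    finally show "ennreal (lp_norm p (fst S) (?inc x S)) \<le> ennreal M + ennreal (M powr (1 - p)) * \<Phi> x"
      by (simp add: v_def add_left_mono mult_left_mono)
  qed
  have "(\<integral>\<^sup>+x\<in>B. family_op p \<F> (bessel_poisson lam) (\<lambda>y. complex_of_real (g y)) x \<partial>bessel_measure lam)
     \<le> (\<integral>\<^sup>+x. ennreal M * indicator B x + ennreal (M powr (1 - p)) * \<Phi> x \<partial>bessel_measure lam)"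
  proof (rule nn_integral_mono)
    fix x assume "x \<in> space (bessel_measure lam)"
    then show "family_op p \<F> (bessel_poisson lam) (\<lambda>y. complex_of_real (g y)) x * indicator B x
      \<le> ennreal M * indicator B x + ennreal (M powr (1 - p)) * \<Phi> x"
      using pw[of x] by (auto simp: indicator_def)
  qed
  also have "\<dots> = ennreal M * emeasure (bessel_measure lam) B + ennreal (M powr (1 - p)) * (\<integral>\<^sup>+x. \<Phi> x \<partial>bessel_measure lam)"
    by (subst nn_integral_add) (auto simp: nn_integral_cmult)
  also have "\<dots> \<le> ennreal M * ennreal \<beta> + ennreal (M powr (1 - p)) * (ennreal (poisson_const lam powr p) * (ennreal (C * M powr (p - 2)) * ennreal (M\<^sup>2 * \<mu>)))"
    by (intro add_mono mult_left_mono B order_trans[OF \<Phi>int] \<mu>) auto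
  also have "\<dots> = ennreal (M * \<beta> + M powr (1 - p) * (poisson_const lam powr p * (C * M powr (p - 2) * (M\<^sup>2 * \<mu>))))"
    using M C \<mu>(2) B(3) by (simp add: ennreal_plus ennreal_mult)
  also have "M powr (1 - p) * (poisson_const lam powr p * (C * M powr (p - 2) * (M\<^sup>2 * \<mu>)))
     = poisson_const lam powr p * C * ((M powr (1 - p) * M powr (p - 2) * M\<^sup>2) * \<mu>)"
    by (simp only: mult_ac)
  also have "M powr (1 - p) * M powr (p - 2) * M\<^sup>2 = M"
  proof -
    have "M powr (1 - p) * M powr (p - 2) = M powr (- 1)" by (simp flip: powr_add)
    then show ?thesis using M by (simp add: powr_minus_divide power2_eq_square)
  qed
  finally show ?thesis .
qed

section \<open>The estimate away from the support of an atom\<close>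

lemma poisson_kernel_chord:
  "bessel_poisson_kernel lam t x y
     = 2 * lam / pi * (LINT \<theta>:{0..pi}|lborel. sin \<theta> powr (2 * lam - 1) * (t / (chord (cos \<theta>) x y + t\<^sup>2) powr (lam + 1)))"
proof -
  have e: "x\<^sup>2 + y\<^sup>2 + t\<^sup>2 - 2 * x * y * cos \<theta> = chord (cos \<theta>) x y + t\<^sup>2" for \<theta> by (simp add: chord_def)
  have "bessel_poisson_kernel lam t x y
     = 2 * lam / pi * (t * (LINT \<theta>:{0..pi}|lborel. sin \<theta> powr (2 * lam - 1) / (chord (cos \<theta>) x y + t\<^sup>2) powr (lam + 1)))"
    unfolding bessel_poisson_kernel_def e by simp
  then show ?thesis
    by (simp only: set_integral_mult_right[symmetric]) (simp add: mult_ac)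
qed

text \<open>Since \<open>f\<close> increases, the gaps between the intervals only help. The
  induction keeps the last lower endpoint, as \<open>- f (e' m)\<close>, against which the next
  interval telescopes.\<close>

lemma nonoverlapping_telescope:
  fixes e e' :: "nat \<Rightarrow> real" and f :: "real \<Rightarrow> real"
  assumes "mono f" "\<And>t. 0 \<le> t \<Longrightarrow> 0 \<le> f t \<and> f t \<le> K"
    and "\<And>j. j < N \<Longrightarrow> 0 < e' j \<and> e' j \<le> e j" "\<And>j. Suc j < N \<Longrightarrow> e (Suc j) \<le> e' j"
  shows "(\<Sum>j<N. f (e j) - f (e' j)) \<le> K"
proof (cases N)
  case 0
  then show ?thesis using assms(2)[of 0] by simp
next
  case (Suc n)
  have "(\<Sum>j<Suc m. f (e j) - f (e' j)) \<le> K - f (e' m)" if "m \<le> n" for m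
    using that
  proof (induction m)
    case 0
    have "0 < e' 0 \<and> e' 0 \<le> e 0" using assms(3)[of 0] Suc by simp
    then show ?case using assms(2)[of "e 0"] by simp
  next
    case (Suc m)
    then have "f (e (Suc m)) \<le> f (e' m)" using assms(4)[of m] \<open>N = Suc n\<close> by (intro monoD[OF assms(1)]) simp
    then show ?case using Suc by simp
  qed
  from this[of n] have "(\<Sum>j<N. f (e j) - f (e' j)) \<le> K - f (e' n)" using Suc by simp
  moreover have "0 \<le> f (e' n)" using assms(2)[of "e' n"] assms(3)[of n] Suc by simp
  ultimately show ?thesis by linarith
qed

lemma arctan_bounds: "0 \<le> t \<Longrightarrow> 0 \<le> arctan t \<and> arctan t \<le> pi / 2"
  using arctan_ubound[of t] by (simp add: less_imp_le)

text \<open>The sum over the time intervals is taken under the integral over \<theta>, where the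
  arctan differences add up to at most \<open>pi / 2\<close>. The remaining factor
  \<open>r / Q \<theta> powr (lam + 1)\<close> is, apart from the sine weight, exactly the integrand
  of the Poisson kernel at time \<open>r\<close> centred at \<open>c\<close>.\<close>

lemma poisson_kernel_mixed_sum:
  assumes lam: "0 < lam" and pos: "0 < x" "0 < y" "0 < c" and r: "0 < r" "\<bar>y - c\<bar> \<le> r" "3 * r \<le> \<bar>x - c\<bar>"
    and e: "\<And>j. j < N \<Longrightarrow> 0 < e' j \<and> e' j \<le> e j" "\<And>j. Suc j < N \<Longrightarrow> e (Suc j) \<le> e' j"
  shows "(\<Sum>j<N. \<bar>(bessel_poisson_kernel lam (e' j) x y - bessel_poisson_kernel lam (e j) x y)
      - (bessel_poisson_kernel lam (e' j) x c - bessel_poisson_kernel lam (e j) x c)\<bar>)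
    \<le> mixed_const lam * (pi / 2) * bessel_poisson_kernel lam r x c"
proof -
  let ?w = "\<lambda>\<theta>. sin \<theta> powr (2 * lam - 1)"
  define Q where "Q \<theta> = chord (cos \<theta>) x c + r\<^sup>2" for \<theta>
  define \<phi> where "\<phi> t z \<theta> = t / (chord (cos \<theta>) x z + t\<^sup>2) powr (lam + 1)" for t z \<theta>
  define a where "a j \<theta> = arctan (e j / sqrt (Q \<theta>)) - arctan (e' j / sqrt (Q \<theta>))" for j \<theta>
  define m where "m j \<theta> = r * (mixed_const lam / Q \<theta> powr (lam + 1) * a j \<theta>)" for j \<theta>
  have mc: "0 < mixed_const lam" using lam by (simp add: mixed_const_def)
  have chm: "(\<lambda>\<theta>. chord (cos \<theta>) x z) \<in> borel_measurable borel" for z unfolding chord_def by measurable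
  have [measurable]: "Q \<in> borel_measurable borel" unfolding Q_def using chm by measurable
  have r2: "0 < r\<^sup>2" using r by simp
  have ch0: "0 \<le> chord (cos \<theta>) x z" if "0 < z" for \<theta> z
    by (rule order_trans[OF zero_le_power2 chord_ge]) (use pos that in auto)
  have Qr: "r\<^sup>2 \<le> Q \<theta>" for \<theta> using ch0[OF pos(3)] by (simp add: Q_def)
  have Q0: "0 < Q \<theta>" for \<theta> using Qr[of \<theta>] r2 by linarith
  have \<phi>i: "set_integrable lborel {0..pi} (\<lambda>\<theta>. ?w \<theta> * \<phi> t z \<theta>)" if "0 < t" "0 < z" for t z
  proof (rule sine_weight_mult_integrable[OF lam])
    show "\<phi> t z \<in> borel_measurable borel" unfolding \<phi>_def using chm[of z] by measurable
    fix \<theta>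
    have t2: "0 < t\<^sup>2" "t\<^sup>2 \<le> chord (cos \<theta>) x z + t\<^sup>2" using that ch0[of z] by simp_all
    then have "(t\<^sup>2) powr (lam + 1) \<le> (chord (cos \<theta>) x z + t\<^sup>2) powr (lam + 1)" using lam by (intro powr_mono2) auto
    then show "\<bar>\<phi> t z \<theta>\<bar> \<le> t / (t\<^sup>2) powr (lam + 1)"
      using that t2 unfolding \<phi>_def by (auto intro!: divide_left_mono mult_pos_pos)
  qed
  have a_bd: "0 \<le> a j \<theta> \<and> a j \<theta> \<le> pi / 2" if "j < N" for j \<theta>
  proof -
    have le: "0 \<le> e' j / sqrt (Q \<theta>)" "e' j / sqrt (Q \<theta>) \<le> e j / sqrt (Q \<theta>)"
      using e(1)[OF that] Q0[of \<theta>] by (auto intro!: divide_right_mono divide_nonneg_nonneg)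
    show ?thesis
      unfolding a_def
      using arctan_monotone'[OF le(2)] arctan_bounds[OF le(1)] arctan_bounds[OF order_trans[OF le]] by linarith
  qed
  have Qp: "0 \<le> r * (mixed_const lam / Q \<theta> powr (lam + 1)) \<and> r * (mixed_const lam / Q \<theta> powr (lam + 1)) \<le> r * (mixed_const lam / (r\<^sup>2) powr (lam + 1))" for \<theta>
  proof -
    have "(r\<^sup>2) powr (lam + 1) \<le> Q \<theta> powr (lam + 1)" using lam Qr r2 by (intro powr_mono2) auto
    then show ?thesis using r mc Q0[of \<theta>] by (auto intro!: mult_left_mono divide_left_mono mult_pos_pos)
  qed
  have mi: "set_integrable lborel {0..pi} (\<lambda>\<theta>. ?w \<theta> * m j \<theta>)" if "j < N" for j
  proof (rule sine_weight_mult_integrable[OF lam])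
    show "m j \<in> borel_measurable borel" unfolding m_def a_def by measurable
    fix \<theta>
    have "\<bar>m j \<theta>\<bar> = r * (mixed_const lam / Q \<theta> powr (lam + 1)) * a j \<theta>"
      using Qp[of \<theta>] a_bd[OF that, of \<theta>] r mc unfolding m_def mult.assoc[symmetric] by (simp add: abs_mult)
    also have "\<dots> \<le> r * (mixed_const lam / (r\<^sup>2) powr (lam + 1)) * (pi / 2)"
      by (rule mult_mono[OF conjunct2[OF Qp] conjunct2[OF a_bd[OF that]]
            order_trans[OF conjunct1[OF Qp] conjunct2[OF Qp]] conjunct1[OF a_bd[OF that]]])
    finally show "\<bar>m j \<theta>\<bar> \<le> r * (mixed_const lam / (r\<^sup>2) powr (lam + 1)) * (pi / 2)" .
  qed
  have l0: "0 \<le> 2 * lam / pi" using lam by simp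
  have each: "\<bar>(bessel_poisson_kernel lam (e' j) x y - bessel_poisson_kernel lam (e j) x y)
      - (bessel_poisson_kernel lam (e' j) x c - bessel_poisson_kernel lam (e j) x c)\<bar>
    \<le> 2 * lam / pi * (LINT \<theta>:{0..pi}|lborel. ?w \<theta> * m j \<theta>)" if j: "j < N" for j
  proof -
    have ej: "0 < e' j" "0 < e j" "e' j \<le> e j" using e(1)[OF j] by auto
    let ?d = "\<lambda>\<theta>. (?w \<theta> * \<phi> (e' j) y \<theta> - ?w \<theta> * \<phi> (e j) y \<theta>) - (?w \<theta> * \<phi> (e' j) c \<theta> - ?w \<theta> * \<phi> (e j) c \<theta>)"
    have di: "set_integrable lborel {0..pi} ?d"
      by (intro set_integral_diff(1) \<phi>i ej pos)
    have eq: "(bessel_poisson_kernel lam (e' j) x y - bessel_poisson_kernel lam (e j) x y)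
      - (bessel_poisson_kernel lam (e' j) x c - bessel_poisson_kernel lam (e j) x c)
      = 2 * lam / pi * (LINT \<theta>:{0..pi}|lborel. ?d \<theta>)"
      unfolding poisson_kernel_chord \<phi>_def[symmetric]
      by (simp only: set_integral_diff \<phi>i ej pos right_diff_distrib)
    have "\<bar>(bessel_poisson_kernel lam (e' j) x y - bessel_poisson_kernel lam (e j) x y)
      - (bessel_poisson_kernel lam (e' j) x c - bessel_poisson_kernel lam (e j) x c)\<bar>
      = 2 * lam / pi * \<bar>LINT \<theta>:{0..pi}|lborel. ?d \<theta>\<bar>"
      unfolding eq by (simp only: abs_mult abs_of_nonneg[OF l0])
    also have "\<dots> \<le> 2 * lam / pi * (LINT \<theta>:{0..pi}|lborel. ?w \<theta> * m j \<theta>)"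
    proof (rule mult_left_mono[OF _ l0])
      have "\<bar>LINT \<theta>:{0..pi}|lborel. ?d \<theta>\<bar> \<le> (LINT \<theta>:{0..pi}|lborel. \<bar>?d \<theta>\<bar>)"
        using set_integral_norm_bound[OF di] by (simp only: real_norm_def)
      also have "\<dots> \<le> (LINT \<theta>:{0..pi}|lborel. ?w \<theta> * m j \<theta>)"
      proof (rule set_integral_mono)
        show "set_integrable lborel {0..pi} (\<lambda>\<theta>. \<bar>?d \<theta>\<bar>)" using set_integrable_norm[OF di] by (simp only: real_norm_def)
        fix \<theta>
        have "?d \<theta> = ?w \<theta> * ((\<phi> (e' j) y \<theta> - \<phi> (e j) y \<theta>) - (\<phi> (e' j) c \<theta> - \<phi> (e j) c \<theta>))"
          by (simp add: algebra_simps)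
        then have "\<bar>?d \<theta>\<bar> = ?w \<theta> * \<bar>(\<phi> (e' j) y \<theta> - \<phi> (e j) y \<theta>) - (\<phi> (e' j) c \<theta> - \<phi> (e j) c \<theta>)\<bar>"
          by (simp add: abs_mult)
        also have "\<dots> \<le> ?w \<theta> * m j \<theta>"
          unfolding \<phi>_def m_def a_def Q_def using pos r ej lam
          by (intro mult_left_mono poisson_profile_mixed_difference) auto
        finally show "\<bar>?d \<theta>\<bar> \<le> ?w \<theta> * m j \<theta>" .
      qed (rule mi[OF j])
      finally show "\<bar>LINT \<theta>:{0..pi}|lborel. ?d \<theta>\<bar> \<le> (LINT \<theta>:{0..pi}|lborel. ?w \<theta> * m j \<theta>)" .
    qed
    finally show ?thesis .
  qed
  have "(\<Sum>j<N. \<bar>(bessel_poisson_kernel lam (e' j) x y - bessel_poisson_kernel lam (e j) x y)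
      - (bessel_poisson_kernel lam (e' j) x c - bessel_poisson_kernel lam (e j) x c)\<bar>)
    \<le> (\<Sum>j<N. 2 * lam / pi * (LINT \<theta>:{0..pi}|lborel. ?w \<theta> * m j \<theta>))"
    by (intro sum_mono each) simp
  also have "\<dots> = 2 * lam / pi * (LINT \<theta>:{0..pi}|lborel. (\<Sum>j<N. ?w \<theta> * m j \<theta>))"
  proof -
    have "(LINT \<theta>:{0..pi}|lborel. (\<Sum>j<N. ?w \<theta> * m j \<theta>)) = (\<Sum>j<N. LINT \<theta>:{0..pi}|lborel. ?w \<theta> * m j \<theta>)"
      using mi unfolding set_lebesgue_integral_def set_integrable_def scaleR_sum_right
      by (intro Bochner_Integration.integral_sum) blast
    then show ?thesis by (simp add: sum_distrib_left)
  qed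
  also have "\<dots> \<le> 2 * lam / pi * (LINT \<theta>:{0..pi}|lborel. mixed_const lam * (pi / 2) * (?w \<theta> * \<phi> r c \<theta>))"
  proof (intro mult_left_mono l0 set_integral_mono)
    show "set_integrable lborel {0..pi} (\<lambda>\<theta>. \<Sum>j<N. ?w \<theta> * m j \<theta>)"
      using mi unfolding set_integrable_def scaleR_sum_right
      by (intro Bochner_Integration.integrable_sum) blast
    show "set_integrable lborel {0..pi} (\<lambda>\<theta>. mixed_const lam * (pi / 2) * (?w \<theta> * \<phi> r c \<theta>))"
      by (intro set_integrable_mult_right \<phi>i r pos)
    fix \<theta>
    have "mono (\<lambda>t. arctan (t / sqrt (Q \<theta>)))"
      using Q0[of \<theta>] by (intro monoI arctan_monotone' divide_right_mono) auto
    moreover have "0 \<le> arctan (t / sqrt (Q \<theta>)) \<and> arctan (t / sqrt (Q \<theta>)) \<le> pi / 2" if "0 \<le> t" for t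
      using that Q0[of \<theta>] by (intro arctan_bounds) simp
    ultimately have "(\<Sum>j<N. a j \<theta>) \<le> pi / 2"
      unfolding a_def
      by (rule nonoverlapping_telescope[where f = "\<lambda>t. arctan (t / sqrt (Q \<theta>))" and e = e and e' = e'])
        (assumption, erule e(1), erule e(2))
    then have "?w \<theta> * (r * (mixed_const lam / Q \<theta> powr (lam + 1))) * (\<Sum>j<N. a j \<theta>)
      \<le> ?w \<theta> * (r * (mixed_const lam / Q \<theta> powr (lam + 1))) * (pi / 2)"
      by (rule mult_left_mono[OF _ mult_nonneg_nonneg[OF powr_ge_zero conjunct1[OF Qp]]])
    moreover have "(\<Sum>j<N. ?w \<theta> * m j \<theta>) = ?w \<theta> * (r * (mixed_const lam / Q \<theta> powr (lam + 1))) * (\<Sum>j<N. a j \<theta>)"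
      by (simp only: m_def sum_distrib_left mult.assoc)
    moreover have "mixed_const lam * (pi / 2) * (?w \<theta> * \<phi> r c \<theta>) = ?w \<theta> * (r * (mixed_const lam / Q \<theta> powr (lam + 1))) * (pi / 2)"
      unfolding \<phi>_def Q_def by (simp add: mult_ac)
    ultimately show "(\<Sum>j<N. ?w \<theta> * m j \<theta>) \<le> mixed_const lam * (pi / 2) * (?w \<theta> * \<phi> r c \<theta>)"
      by (simp only:)
  qed
  also have "\<dots> = mixed_const lam * (pi / 2) * bessel_poisson_kernel lam r x c"
    unfolding poisson_kernel_chord \<phi>_def[symmetric] by simp
  finally show ?thesis .
qed

text \<open>The vanishing mean of \<open>a\<close> allows the kernel increment at the centre
  \<open>c\<close> to be subtracted inside the integral, which leaves mixed differences. The
  \<open>p\<close>-norm is bounded by the plain sum, so one estimate serves every exponent.\<close>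

lemma family_op_nonlocal_pointwise:
  fixes a :: "real \<Rightarrow> complex"
  assumes lam: "0 < lam" and F: "nonoverlapping \<F>" and p: "1 \<le> p" and a: "integrable (bessel_measure lam) a"
    and supp: "AE y in bessel_measure lam. \<bar>y - c\<bar> \<le> r \<or> a y = 0" and mean: "(LINT y|bessel_measure lam. a y) = 0"
    and norm: "(LINT y|bessel_measure lam. cmod (a y)) \<le> 1"
    and pos: "0 < c" "0 < r" "0 < x" "3 * r \<le> \<bar>x - c\<bar>"
  shows "family_op p \<F> (bessel_poisson lam) a x \<le> ennreal (mixed_const lam * (pi / 2) * bessel_poisson_kernel lam r x c)"
  unfolding family_op_def
proof (intro SUP_least ennreal_leI)
  fix S assume S: "S \<in> \<F>"
  define N where "N = fst S"
  define e' where "e' = fst (snd S)"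
  define e where "e = snd (snd S)"
  have e: "\<And>j. j < N \<Longrightarrow> 0 < e' j \<and> e' j \<le> e j" "\<And>j. Suc j < N \<Longrightarrow> e (Suc j) \<le> e' j"
    using F S by (auto simp: nonoverlapping_def N_def e'_def e_def split_beta' dest!: bspec[of _ _ S])
  define d where "d j y = bessel_poisson_kernel lam (e' j) x y - bessel_poisson_kernel lam (e j) x y" for j y
  define R where "R = mixed_const lam * (pi / 2) * bessel_poisson_kernel lam r x c"
  have R0: "0 \<le> R"
    unfolding R_def using lam pos by (intro mult_nonneg_nonneg poisson_kernel_nonneg) (auto simp: mixed_const_def)
  have di: "integrable (bessel_measure lam) (\<lambda>y. (d j y - d j c) *\<^sub>R a y)" if j: "j < N" for j
  proof -
    have "integrable (bessel_measure lam) (\<lambda>y. (bessel_poisson_kernel lam (e' j) x y *\<^sub>R a y - bessel_poisson_kernel lam (e j) x y *\<^sub>R a y) - d j c *\<^sub>R a y)"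
      using e(1)[OF j] by (intro Bochner_Integration.integrable_diff poisson_integrable lam pos a integrable_scaleR_right) auto
    then show ?thesis by (simp add: d_def scaleR_left_diff_distrib)
  qed
  have "lp_norm p N (increments (bessel_poisson lam) a x S) \<le> (\<Sum>j<N. cmod (increments (bessel_poisson lam) a x S j))"
    by (rule lp_norm_le_sum[OF p])
  also have "\<dots> \<le> (\<Sum>j<N. LINT y|bessel_measure lam. \<bar>d j y - d j c\<bar> * cmod (a y))"
  proof (rule sum_mono)
    fix j assume "j \<in> {..<N}"
    then have j: "j < N" by simp
    have t: "0 < e' j" "0 < e j" using e(1)[OF j] by auto
    have "increments (bessel_poisson lam) a x S j
      = (LINT y|bessel_measure lam. bessel_poisson_kernel lam (e' j) x y *\<^sub>R a y) - (LINT y|bessel_measure lam. bessel_poisson_kernel lam (e j) x y *\<^sub>R a y)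
        - (LINT y|bessel_measure lam. d j c *\<^sub>R a y)"
      using mean by (simp add: increments_def bessel_poisson_def e'_def e_def)
    also have "\<dots> = (LINT y|bessel_measure lam. (bessel_poisson_kernel lam (e' j) x y *\<^sub>R a y - bessel_poisson_kernel lam (e j) x y *\<^sub>R a y) - d j c *\<^sub>R a y)"
      using poisson_integrable[OF lam t(1) pos(3) a] poisson_integrable[OF lam t(2) pos(3) a] a
      by (simp add: Bochner_Integration.integral_diff)
    also have "\<dots> = (LINT y|bessel_measure lam. (d j y - d j c) *\<^sub>R a y)"
      by (simp add: d_def scaleR_left_diff_distrib)
    finally show "cmod (increments (bessel_poisson lam) a x S j) \<le> (LINT y|bessel_measure lam. \<bar>d j y - d j c\<bar> * cmod (a y))"
      using integral_norm_bound[of "bessel_measure lam" "\<lambda>y. (d j y - d j c) *\<^sub>R a y"] by simp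
  qed
  also have "\<dots> = (LINT y|bessel_measure lam. (\<Sum>j<N. \<bar>d j y - d j c\<bar> * cmod (a y)))"
    using integrable_norm[OF di] by (intro Bochner_Integration.integral_sum[symmetric]) auto
  also have "\<dots> \<le> (LINT y|bessel_measure lam. R * cmod (a y))"
  proof (rule integral_mono_AE)
    show "integrable (bessel_measure lam) (\<lambda>y. \<Sum>j<N. \<bar>d j y - d j c\<bar> * cmod (a y))"
      using integrable_norm[OF di] by (intro Bochner_Integration.integrable_sum) auto
    show "integrable (bessel_measure lam) (\<lambda>y. R * cmod (a y))" using a by simp
    show "AE y in bessel_measure lam. (\<Sum>j<N. \<bar>d j y - d j c\<bar> * cmod (a y)) \<le> R * cmod (a y)"
      using supp AE_space
    proof eventually_elim
      case (elim y)
      show ?case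
      proof (cases "a y = 0")
        case False
        then have "\<bar>y - c\<bar> \<le> r" "0 < y" using elim by auto
        then have "(\<Sum>j<N. \<bar>d j y - d j c\<bar>) \<le> R"
          unfolding d_def R_def using pos lam e by (intro poisson_kernel_mixed_sum) auto
        then show ?thesis by (simp add: mult_right_mono flip: sum_distrib_right)
      qed simp
    qed
  qed
  also have "\<dots> = R * (LINT y|bessel_measure lam. cmod (a y))" by simp
  also have "\<dots> \<le> R * 1" by (rule mult_left_mono[OF norm R0])
  finally show "lp_norm p (fst S) (increments (bessel_poisson lam) a x S) \<le> mixed_const lam * (pi / 2) * bessel_poisson_kernel lam r x c"
    by (simp add: N_def R_def)
qed

text \<open>The far part is dominated by one Poisson kernel at time \<open>r\<close>, whose total
  mass is the same for all \<open>r\<close> and \<open>c\<close>.\<close>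

lemma family_op_nonlocal_bound:
  fixes a :: "real \<Rightarrow> complex"
  assumes lam: "0 < lam" and F: "nonoverlapping \<F>" and p: "1 \<le> p" and a: "integrable (bessel_measure lam) a"
    and supp: "AE y in bessel_measure lam. \<bar>y - c\<bar> \<le> r \<or> a y = 0" and mean: "(LINT y|bessel_measure lam. a y) = 0"
    and norm: "(LINT y|bessel_measure lam. cmod (a y)) \<le> 1" and pos: "0 < c" "0 < r"
  shows "(\<integral>\<^sup>+x\<in>{x. 3 * r \<le> \<bar>x - c\<bar>}. family_op p \<F> (bessel_poisson lam) a x \<partial>bessel_measure lam)
    \<le> ennreal (mixed_const lam * (pi / 2) * poisson_const lam)"
proof -
  have mc: "0 \<le> mixed_const lam * (pi / 2)" using lam by (simp add: mixed_const_def)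
  have "(\<integral>\<^sup>+x\<in>{x. 3 * r \<le> \<bar>x - c\<bar>}. family_op p \<F> (bessel_poisson lam) a x \<partial>bessel_measure lam)
    \<le> (\<integral>\<^sup>+x. ennreal (mixed_const lam * (pi / 2)) * ennreal (bessel_poisson_kernel lam r x c) \<partial>bessel_measure lam)"
  proof (rule nn_integral_mono)
    fix x assume "x \<in> space (bessel_measure lam)"
    then show "family_op p \<F> (bessel_poisson lam) a x * indicator {x. 3 * r \<le> \<bar>x - c\<bar>} x
       \<le> ennreal (mixed_const lam * (pi / 2)) * ennreal (bessel_poisson_kernel lam r x c)"
      unfolding ennreal_mult'[OF mc, symmetric]
      using family_op_nonlocal_pointwise[OF lam F p a supp mean norm pos, of x] by (auto simp: indicator_def)
  qed
  also have "\<dots> = ennreal (mixed_const lam * (pi / 2)) * (\<integral>\<^sup>+x. ennreal (bessel_poisson_kernel lam r x c) \<partial>bessel_measure lam)"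
    by (intro nn_integral_cmult measurable_compose[OF _ measurable_ennreal] poisson_kernel_measurable measurable_bessel_id measurable_const) simp
  also have "\<dots> = ennreal (mixed_const lam * (pi / 2) * poisson_const lam)"
    unfolding poisson_kernel_mass[OF lam pos(2,1)] by (rule ennreal_mult'[OF mc, symmetric])
  finally show ?thesis .
qed

lemma increments_linear_combination:
  fixes f :: "nat \<Rightarrow> real \<Rightarrow> complex"
  assumes lam: "0 < lam" and x: "0 < x" and F: "nonoverlapping \<F>" "S \<in> \<F>" "j < fst S"
    and f: "\<And>i. i < n \<Longrightarrow> integrable (bessel_measure lam) (f i)"
  shows "increments (bessel_poisson lam) (\<lambda>y. \<Sum>i<n. \<alpha> i * f i y) x S j = (\<Sum>i<n. \<alpha> i * increments (bessel_poisson lam) (f i) x S j)"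
proof -
  have "bessel_poisson lam t (\<lambda>y. \<Sum>i<n. \<alpha> i * f i y) x = (\<Sum>i<n. \<alpha> i * bessel_poisson lam t (f i) x)" if t: "0 < t" for t
  proof -
    have "bessel_poisson lam t (\<lambda>y. \<Sum>i<n. \<alpha> i * f i y) x = (LINT y|bessel_measure lam. (\<Sum>i<n. \<alpha> i * (bessel_poisson_kernel lam t x y *\<^sub>R f i y)))"
      unfolding bessel_poisson_def by (simp add: scaleR_sum_right)
    also have "\<dots> = (\<Sum>i<n. LINT y|bessel_measure lam. \<alpha> i * (bessel_poisson_kernel lam t x y *\<^sub>R f i y))"
      by (intro Bochner_Integration.integral_sum integrable_mult_right poisson_integrable lam t x f) simp
    also have "\<dots> = (\<Sum>i<n. \<alpha> i * bessel_poisson lam t (f i) x)"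
      unfolding bessel_poisson_def by (intro sum.cong refl integral_mult_right_zero)
    finally show ?thesis .
  qed
  then show ?thesis
    unfolding increments_def using nonoverlapping_times[OF F] by (simp add: sum_subtractf right_diff_distrib)
qed

text \<open>Stated for a single member \<open>S\<close>, because in the passage to infinite sums the
  remainder is controlled for each fixed \<open>S\<close>, not uniformly over the family.\<close>

lemma family_op_linear_combination:
  fixes f :: "nat \<Rightarrow> real \<Rightarrow> complex"
  assumes lam: "0 < lam" and x: "0 < x" and F: "nonoverlapping \<F>" and p: "1 \<le> p"
    and f: "\<And>i. i < n \<Longrightarrow> integrable (bessel_measure lam) (f i)" and S: "S \<in> \<F>"
  shows "ennreal (lp_norm p (fst S) (increments (bessel_poisson lam) (\<lambda>y. \<Sum>i<n. \<alpha> i * f i y) x S))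
    \<le> (\<Sum>i<n. ennreal (cmod (\<alpha> i)) * family_op p \<F> (bessel_poisson lam) (f i) x)"
proof -
  have "lp_norm p (fst S) (increments (bessel_poisson lam) (\<lambda>y. \<Sum>i<n. \<alpha> i * f i y) x S)
     = lp_norm p (fst S) (\<lambda>j. \<Sum>i<n. \<alpha> i * increments (bessel_poisson lam) (f i) x S j)"
    by (intro lp_norm_cong increments_linear_combination[OF lam x F S _ f])
  also have "\<dots> \<le> (\<Sum>i<n. lp_norm p (fst S) (\<lambda>j. \<alpha> i * increments (bessel_poisson lam) (f i) x S j))"
    by (rule lp_norm_sum[OF p])
  also have "\<dots> = (\<Sum>i<n. cmod (\<alpha> i) * lp_norm p (fst S) (increments (bessel_poisson lam) (f i) x S))"
    using p by (simp add: lp_norm_scale)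
  finally have "ennreal (lp_norm p (fst S) (increments (bessel_poisson lam) (\<lambda>y. \<Sum>i<n. \<alpha> i * f i y) x S))
     \<le> ennreal (\<Sum>i<n. cmod (\<alpha> i) * lp_norm p (fst S) (increments (bessel_poisson lam) (f i) x S))"
    by (rule ennreal_leI)
  also have "\<dots> = (\<Sum>i<n. ennreal (cmod (\<alpha> i)) * ennreal (lp_norm p (fst S) (increments (bessel_poisson lam) (f i) x S)))"
    by (subst sum_ennreal[symmetric]) (simp_all add: ennreal_mult)
  also have "\<dots> \<le> (\<Sum>i<n. ennreal (cmod (\<alpha> i)) * family_op p \<F> (bessel_poisson lam) (f i) x)"
    unfolding family_op_def by (intro sum_mono mult_left_mono SUP_upper S) simp
  finally show ?thesis .
qed

section \<open>Atoms and atomic decompositions\<close>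

lemma poisson_cong_AE:
  assumes "AE y in bessel_measure lam. f y = g y" "f \<in> borel_measurable (bessel_measure lam)" "g \<in> borel_measurable (bessel_measure lam)"
  shows "bessel_poisson lam t f x = bessel_poisson lam t g x"
  unfolding bessel_poisson_def
proof (rule integral_cong_AE)
  have k: "(\<lambda>y. bessel_poisson_kernel lam t x y) \<in> borel_measurable (bessel_measure lam)"
    by (intro poisson_kernel_measurable measurable_const measurable_bessel_id) simp
  show "(\<lambda>y. bessel_poisson_kernel lam t x y *\<^sub>R f y) \<in> borel_measurable (bessel_measure lam)"
    "(\<lambda>y. bessel_poisson_kernel lam t x y *\<^sub>R g y) \<in> borel_measurable (bessel_measure lam)"
    using k assms(2,3) by (auto intro: borel_measurable_scaleR)
qed (use assms(1) in auto)

lemma family_op_cong_AE: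
  assumes "AE y in bessel_measure lam. f y = g y" "f \<in> borel_measurable (bessel_measure lam)" "g \<in> borel_measurable (bessel_measure lam)"
  shows "family_op p \<F> (bessel_poisson lam) f = family_op p \<F> (bessel_poisson lam) g"
  unfolding family_op_def increments_def poisson_cong_AE[OF assms] ..

lemma family_op_zero:
  assumes "0 < p"
  shows "family_op p \<F> (bessel_poisson lam) (\<lambda>_. 0) x = 0"
  unfolding family_op_def increments_def bessel_poisson_def lp_norm_def using assms
  by (intro antisym SUP_least) auto

section \<open>Measures of intervals\<close>

lemma emeasure_bessel:
  assumes "A \<in> sets borel"
  shows "emeasure (bessel_measure lam) (A \<inter> {0<..}) = (\<integral>\<^sup>+x\<in>A \<inter> {0<..}. ennreal (x powr (2 * lam)) \<partial>lborel)"
proof -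
  have s: "A \<inter> {0<..} \<in> sets (bessel_measure lam)"
    using measurable_sets[OF measurable_bessel_id assms, of lam] by (simp add: Int_commute)
  have "emeasure (bessel_measure lam) (A \<inter> {0<..}) = (\<integral>\<^sup>+x. indicator (A \<inter> {0<..}) x \<partial>bessel_measure lam)"
    using s by simp
  also have "\<dots> = (\<integral>\<^sup>+x\<in>{0<..}. ennreal (x powr (2 * lam)) * indicator (A \<inter> {0<..}) x \<partial>lborel)"
    using assms by (intro nn_integral_bessel borel_measurable_indicator) auto
  also have "\<dots> = (\<integral>\<^sup>+x\<in>A \<inter> {0<..}. ennreal (x powr (2 * lam)) \<partial>lborel)"
    by (intro nn_integral_cong) (auto simp: indicator_def)
  finally show ?thesis .
qed

lemma sets_bessel:
  assumes "A \<in> sets borel"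
  shows "A \<inter> {0<..} \<in> sets (bessel_measure lam)"
  using measurable_sets[OF measurable_bessel_id assms, of lam] by (simp add: Int_commute)

text \<open>The condition \<open>r \<le> c\<close> keeps the tripled interval below
  \<open>4 * c\<close>, where the weight is at most \<open>4 powr (2 * lam)\<close> times its value
  at \<open>c\<close>.\<close>

lemma emeasure_bessel_ball_le:
  assumes "0 < lam" "0 < r" "r \<le> c"
  shows "emeasure (bessel_measure lam) ({x. \<bar>x - c\<bar> < 3 * r} \<inter> {0<..}) \<le> ennreal (6 * 4 powr (2 * lam) * (r * c powr (2 * lam)))"
proof -
  have s: "{x. \<bar>x - c\<bar> < 3 * r} \<in> sets borel" by measurable
  have "emeasure (bessel_measure lam) ({x. \<bar>x - c\<bar> < 3 * r} \<inter> {0<..})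
    \<le> (\<integral>\<^sup>+x. ennreal ((4 * c) powr (2 * lam)) * indicator {c - 3 * r..c + 3 * r} x \<partial>lborel)"
    unfolding emeasure_bessel[OF s] using assms
    by (intro nn_integral_mono) (auto simp: indicator_def intro!: ennreal_leI powr_mono2)
  also have "\<dots> = ennreal ((4 * c) powr (2 * lam)) * ennreal (6 * r)"
    using assms by (subst nn_integral_cmult_indicator) auto
  also have "\<dots> = ennreal (6 * 4 powr (2 * lam) * (r * c powr (2 * lam)))"
    using assms by (simp add: powr_mult mult_ac flip: ennreal_mult)
  finally show ?thesis .
qed

text \<open>On the right half of the interval the weight is at least its value at the centre.
  Together with \<open>emeasure_bessel_ball_le\<close> this is the doubling property used for
  atoms.\<close>

lemma emeasure_bessel_interval_ge:
  assumes "0 < lam" "0 < r" "r \<le> c"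
  shows "ennreal (r * c powr (2 * lam)) \<le> emeasure (bessel_measure lam) ({c - r<..<c + r} \<inter> {0<..})"
proof -
  have s: "{c - r<..<c + r} \<in> sets borel" by measurable
  have "ennreal (r * c powr (2 * lam)) = ennreal (c powr (2 * lam)) * ennreal r"
    using assms by (simp add: mult.commute flip: ennreal_mult)
  also have "\<dots> = (\<integral>\<^sup>+x. ennreal (c powr (2 * lam)) * indicator {c<..<c + r} x \<partial>lborel)"
    using assms by (subst nn_integral_cmult_indicator) auto
  also have "\<dots> \<le> emeasure (bessel_measure lam) ({c - r<..<c + r} \<inter> {0<..})"
    unfolding emeasure_bessel[OF s] using assms
    by (intro nn_integral_mono) (auto simp: indicator_def intro!: ennreal_leI powr_mono2)
  finally show ?thesis .
qed

lemma bounded_interval_centre: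
  fixes I :: "real set"
  assumes "is_interval I" "bounded I" "I \<subseteq> {0..}" "x \<in> I" "y \<in> I" "x < y"
  obtains c r where "0 < r" "r \<le> c" "{c - r<..<c + r} \<subseteq> I" "I \<subseteq> {c - r..c + r}"
proof -
  define \<alpha> \<beta> where "\<alpha> = Inf I" and "\<beta> = Sup I"
  have bd: "bdd_below I" "bdd_above I" using assms(2) bounded_imp_bdd_below bounded_imp_bdd_above by auto
  have ne: "I \<noteq> {}" using assms by auto
  have sub: "I \<subseteq> {\<alpha>..\<beta>}" using bd by (auto simp: \<alpha>_def \<beta>_def intro: cInf_lower cSup_upper)
  have "\<alpha> \<le> x" "y \<le> \<beta>" using sub assms(4,5) by auto
  then have lt: "\<alpha> < \<beta>" using assms(6) by linarith
  have a0: "0 \<le> \<alpha>" unfolding \<alpha>_def using assms(3) ne by (intro cInf_greatest) auto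
  have inner: "{\<alpha><..<\<beta>} \<subseteq> I"
  proof
    fix z assume z: "z \<in> {\<alpha><..<\<beta>}"
    obtain u where "u \<in> I" "u < z" using z cInf_less_iff[OF ne bd(1)] by (auto simp: \<alpha>_def)
    moreover obtain v where "v \<in> I" "z < v" using z less_cSup_iff[OF ne bd(2)] by (auto simp: \<beta>_def)
    ultimately show "z \<in> I" using assms(1) unfolding is_interval_1 by (meson less_imp_le)
  qed
  show ?thesis
  proof (rule that[of "(\<beta> - \<alpha>) / 2" "(\<alpha> + \<beta>) / 2"])
    have e: "(\<alpha> + \<beta>) / 2 - (\<beta> - \<alpha>) / 2 = \<alpha>" "(\<alpha> + \<beta>) / 2 + (\<beta> - \<alpha>) / 2 = \<beta>" by (simp_all add: field_simps)
    show "{(\<alpha> + \<beta>) / 2 - (\<beta> - \<alpha>) / 2<..<(\<alpha> + \<beta>) / 2 + (\<beta> - \<alpha>) / 2} \<subseteq> I"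
      "I \<subseteq> {(\<alpha> + \<beta>) / 2 - (\<beta> - \<alpha>) / 2..(\<alpha> + \<beta>) / 2 + (\<beta> - \<alpha>) / 2}"
      unfolding e by (fact inner, fact sub)
  qed (use lt a0 in auto)
qed

text \<open>An atom on a null interval vanishes almost everywhere. Otherwise the interval is
  nondegenerate, and replacing it by its closure changes no measure; the radius is at most the
  centre because the interval lies in the closed half line. The bound by \<open>1 / \<mu>\<close>
  then concerns real numbers instead of an essential supremum.\<close>

lemma H1_atom_normal_form:
  assumes lam: "0 < lam" and a: "H1_atom lam a"
  obtains (zero) "AE y in bessel_measure lam. a y = 0"
  | (interval) c r \<mu> where "0 < r" "r \<le> c" "r * c powr (2 * lam) \<le> \<mu>"
      "emeasure (bessel_measure lam) ({c - r..c + r} \<inter> {0<..}) = ennreal \<mu>" "0 < \<mu>"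
      "AE y in bessel_measure lam. y \<in> {c - r..c + r} \<or> a y = 0" "AE y in bessel_measure lam. cmod (a y) \<le> 1 / \<mu>"
proof -
  obtain I where I: "is_interval I" "bounded I" "I \<subseteq> {0..}"
    and supp: "AE x in bessel_measure lam. x \<notin> I \<longrightarrow> a x = 0"
    and ess: "esssup (bessel_measure lam) (\<lambda>x. ennreal (cmod (a x))) \<le> 1 / emeasure (bessel_measure lam) (I \<inter> {0<..})"
    and am: "a \<in> borel_measurable (bessel_measure lam)"
    using a unfolding H1_atom_def by blast
  have Ib: "I \<in> sets borel" using I(1) by (rule real_interval_borel_measurable)
  let ?m = "bessel_measure lam"
  show ?thesis
  proof (cases "emeasure ?m (I \<inter> {0<..}) = 0")
    case True
    have "AE x in ?m. x \<notin> I \<inter> {0<..}"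
      using True sets_bessel[OF Ib] by (intro AE_not_in) (simp add: null_sets_def)
    then have "AE y in ?m. a y = 0"
      using supp AE_space by eventually_elim auto
    then show ?thesis by (rule zero)
  next
    case False
    \<comment> \<open>An interval of positive measure has two distinct points, since single points
      are null.\<close>
    have "\<exists>x\<in>I. \<exists>y\<in>I. x < y"
    proof (rule ccontr)
      assume "\<not> ?thesis"
      then obtain z where "I \<subseteq> {z}" by (metis insertI1 linorder_neqE_linordered_idom subsetI)
      then have "emeasure ?m (I \<inter> {0<..}) \<le> (\<integral>\<^sup>+x. ennreal (z powr (2 * lam)) * indicator {z} x \<partial>lborel)"
        unfolding emeasure_bessel[OF Ib] by (intro nn_integral_mono) (auto simp: indicator_def)
      then show False using False by (simp add: nn_integral_cmult_indicator)
    qed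
    then obtain x y where "x \<in> I" "y \<in> I" "x < y" by blast
    from bounded_interval_centre[OF I this] obtain c r where cr: "0 < r" "r \<le> c" "{c - r<..<c + r} \<subseteq> I" "I \<subseteq> {c - r..c + r}" .
    have eqm: "emeasure ?m (J \<inter> {0<..}) = emeasure ?m ({c - r..c + r} \<inter> {0<..})"
      if J: "J \<in> sets borel" "{c - r<..<c + r} \<subseteq> J" "J \<subseteq> {c - r..c + r}" for J
      unfolding emeasure_bessel[OF J(1)] emeasure_bessel[OF borel_closed[OF closed_atLeastAtMost]]
    proof (rule nn_integral_cong_AE)
      have "AE x in lborel. x \<noteq> c - r \<and> x \<noteq> c + r"
        using AE_lborel_singleton[of "c - r"] AE_lborel_singleton[of "c + r"] by eventually_elim simp
      then show "AE x in lborel. ennreal (x powr (2 * lam)) * indicator (J \<inter> {0<..}) x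
         = ennreal (x powr (2 * lam)) * indicator ({c - r..c + r} \<inter> {0<..}) x"
      proof eventually_elim
        case (elim x)
        then have "x \<in> J \<longleftrightarrow> x \<in> {c - r..c + r}" using J by force
        then show ?case by (simp add: indicator_def)
      qed
    qed
    have fin: "emeasure ?m ({c - r..c + r} \<inter> {0<..}) < \<infinity>"
    proof -
      have "emeasure ?m ({c - r..c + r} \<inter> {0<..}) \<le> emeasure ?m ({x. \<bar>x - c\<bar> < 3 * r} \<inter> {0<..})"
      proof (rule emeasure_mono)
        have "{x. \<bar>x - c\<bar> < 3 * r} \<in> sets borel" by measurable
        then show "{x. \<bar>x - c\<bar> < 3 * r} \<inter> {0<..} \<in> sets ?m" by (rule sets_bessel)
      qed (use cr(1) in auto)
      also have "\<dots> \<le> ennreal (6 * 4 powr (2 * lam) * (r * c powr (2 * lam)))"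
        by (rule emeasure_bessel_ball_le[OF lam cr(1,2)])
      also have "\<dots> < \<infinity>" by simp
      finally show ?thesis .
    qed
    define \<mu> where "\<mu> = measure ?m ({c - r..c + r} \<inter> {0<..})"
    have \<mu>: "emeasure ?m ({c - r..c + r} \<inter> {0<..}) = ennreal \<mu>"
      unfolding \<mu>_def using fin by (intro emeasure_eq_ennreal_measure) simp
    have I\<mu>: "emeasure ?m (I \<inter> {0<..}) = ennreal \<mu>" using eqm[OF Ib cr(3,4)] \<mu> by simp
    have ge: "ennreal (r * c powr (2 * lam)) \<le> ennreal \<mu>"
    proof -
      have "{c - r<..<c + r} \<subseteq> {c - r..c + r}" by (rule subsetI) simp
      from eqm[OF _ subset_refl this] show ?thesis
        using emeasure_bessel_interval_ge[OF lam cr(1,2)] \<mu> by simp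
    qed
    have rc: "0 < r * c powr (2 * lam)" using cr by simp
    have \<mu>ge: "r * c powr (2 * lam) \<le> \<mu>" using ge rc by (simp add: \<mu>_def ennreal_le_iff)
    then have \<mu>0: "0 < \<mu>" using rc by linarith
    have "AE x in ?m. ennreal (cmod (a x)) \<le> esssup ?m (\<lambda>x. ennreal (cmod (a x)))"
      by (rule esssup_AE)
    then have "AE x in ?m. cmod (a x) \<le> 1 / \<mu>"
    proof eventually_elim
      case (elim x)
      also note ess
      also have "1 / emeasure ?m (I \<inter> {0<..}) = ennreal (1 / \<mu>)"
        unfolding I\<mu> using divide_ennreal[of 1 \<mu>] \<mu>0 by simp
      finally show ?case using \<mu>0 by (simp add: ennreal_le_iff)
    qed
    moreover have "AE y in ?m. y \<in> {c - r..c + r} \<or> a y = 0"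
      using supp by eventually_elim (use cr(4) in auto)
    ultimately show ?thesis using interval[OF cr(1,2) \<mu>ge \<mu> \<mu>0] by blast
  qed
qed

text \<open>The factor 4 counts the positive and negative parts of the real and imaginary parts. For
  each of them, \<open>6 * 4 powr (2 * lam)\<close> comes from the tripled interval and the next
  term from the martingale estimate. The last summand is the contribution away from the
  support.\<close>

definition atom_const :: "real \<Rightarrow> real \<Rightarrow> real \<Rightarrow> real" where
  "atom_const lam p C = 4 * (6 * 4 powr (2 * lam) + poisson_const lam powr p * C) + mixed_const lam * (pi / 2) * poisson_const lam"

lemma atom_const_pos: "0 < lam \<Longrightarrow> 0 \<le> C \<Longrightarrow> 0 < atom_const lam p C"
  unfolding atom_const_def mixed_const_def using poisson_const_pos[of lam]
  by (intro add_pos_nonneg mult_pos_pos mult_nonneg_nonneg) auto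

text \<open>Near the support the atom is cut into four nonnegative pieces, since the martingale
  estimate is for values in \<open>[0, M]\<close>. The pieces lose the cancellation, so away from
  the support the atom itself is estimated.\<close>

lemma family_op_atom_bound:
  assumes lam: "0 < lam" and F: "nonoverlapping \<F>" "\<F> \<noteq> {}" "controlled p C \<F>" and p: "1 \<le> p" and C: "0 \<le> C"
    and a: "H1_atom lam a"
  shows "integrable (bessel_measure lam) a"
    and "(\<integral>\<^sup>+x. family_op p \<F> (bessel_poisson lam) a x \<partial>bessel_measure lam) \<le> ennreal (atom_const lam p C)"
proof -
  let ?m = "bessel_measure lam"
  have am[measurable]: "a \<in> borel_measurable ?m" and mean: "(LINT y|?m. a y) = 0"
    using a by (auto simp: H1_atom_def)
  have "integrable ?m a \<and> (\<integral>\<^sup>+x. family_op p \<F> (bessel_poisson lam) a x \<partial>?m) \<le> ennreal (atom_const lam p C)"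
    using lam a
  proof (cases rule: H1_atom_normal_form)
    case zero
    have "integrable ?m a \<longleftrightarrow> integrable ?m (\<lambda>_. 0 :: complex)"
      using zero by (intro integrable_cong_AE) auto
    moreover have "family_op p \<F> (bessel_poisson lam) a = family_op p \<F> (bessel_poisson lam) (\<lambda>_. 0)"
      using zero by (intro family_op_cong_AE) auto
    ultimately show ?thesis using p by (simp add: family_op_zero)
  next
    case (interval c r \<mu>)
    define J where "J = {c - r..c + r} \<inter> {0<..}"
    define M where "M = 1 / \<mu>"
    have M: "0 < M" and M\<mu>: "M * \<mu> = 1" using interval(5) by (simp_all add: M_def)
    have c: "0 < c" using interval(1,2) by linarith
    have J[measurable]: "J \<in> sets ?m" unfolding J_def by (rule sets_bessel) simp
    have Jm: "emeasure ?m J = ennreal \<mu>" using interval(4) by (simp add: J_def)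
    have iJ: "integrable ?m (\<lambda>y. M * indicat_real J y)"
      using Jm by (intro integrable_mult_right integrable_real_indicator) auto
    \<comment> \<open>A version of \<open>a\<close> whose support and size bounds hold everywhere;
      the operator does not distinguish the two.\<close>
    define a' where "a' y = (if y \<in> J \<and> cmod (a y) \<le> M then a y else 0)" for y
    have a'm[measurable]: "a' \<in> borel_measurable ?m" unfolding a'_def by measurable
    have aa': "AE y in ?m. a y = a' y"
      using interval(6,7) AE_space by eventually_elim (auto simp: a'_def J_def M_def)
    have a'M: "cmod (a' y) \<le> M * indicator J y" for y using M by (auto simp: a'_def indicator_def)
    have ia': "integrable ?m a'"
      by (rule Bochner_Integration.integrable_bound[OF iJ]) (use a'M M in \<open>auto intro!: AE_I2 simp: abs_mult\<close>)
    have ia: "integrable ?m a"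
      using integrable_cong_AE[of a ?m a'] aa' ia' by simp
    define g :: "nat \<Rightarrow> real \<Rightarrow> real" where
      "g i y = (if i = 0 then max 0 (Re (a' y)) else if i = 1 then max 0 (- Re (a' y)) else if i = 2 then max 0 (Im (a' y)) else max 0 (- Im (a' y)))" for i y
    define \<alpha> :: "nat \<Rightarrow> complex" where
      "\<alpha> i = (if i = 0 then 1 else if i = 1 then - 1 else if i = 2 then \<i> else - \<i>)" for i
    have \<alpha>1: "cmod (\<alpha> i) = 1" for i by (simp add: \<alpha>_def)
    have a'g: "a' = (\<lambda>y. \<Sum>i<4. \<alpha> i * complex_of_real (g i y))"
    proof
      fix y
      have "(\<Sum>i<4. \<alpha> i * complex_of_real (g i y)) = complex_of_real (g 0 y) - complex_of_real (g 1 y) + \<i> * complex_of_real (g 2 y) - \<i> * complex_of_real (g 3 y)"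
        by (simp add: eval_nat_numeral \<alpha>_def)
      also have "\<dots> = a' y" by (simp add: g_def complex_eq_iff max_def)
      finally show "a' y = (\<Sum>i<4. \<alpha> i * complex_of_real (g i y))" ..
    qed
    have gm[measurable]: "g i \<in> borel_measurable ?m" for i unfolding g_def by measurable
    have gJ: "0 \<le> g i y \<and> g i y \<le> M * indicator J y" for i y
      using a'M[of y] abs_Re_le_cmod[of "a' y"] abs_Im_le_cmod[of "a' y"] M
      by (auto simp: g_def indicator_def split: if_splits)
    have gM: "0 \<le> g i y \<and> g i y \<le> M" for i y
      using gJ[of i y] M by (cases "y \<in> J") auto
    have gi: "integrable ?m (g i)" for i
      by (rule Bochner_Integration.integrable_bound[OF iJ]) (use gJ[of i] M in \<open>auto intro!: AE_I2 simp: abs_mult\<close>)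
    have g2: "(\<integral>\<^sup>+x. ennreal ((g i x)\<^sup>2) \<partial>?m) \<le> ennreal (M\<^sup>2 * \<mu>)" for i
    proof -
      have "(\<integral>\<^sup>+x. ennreal ((g i x)\<^sup>2) \<partial>?m) \<le> (\<integral>\<^sup>+x. ennreal (M\<^sup>2) * indicator J x \<partial>?m)"
      proof (rule nn_integral_mono)
        fix x
        have "(g i x)\<^sup>2 \<le> (M * indicator J x)\<^sup>2" using gJ[of i x] by (intro power_mono) auto
        then show "ennreal ((g i x)\<^sup>2) \<le> ennreal (M\<^sup>2) * indicator J x"
          by (cases "x \<in> J") (auto intro: ennreal_leI)
      qed
      also have "\<dots> = ennreal (M\<^sup>2 * \<mu>)"
        using interval(5) by (simp add: nn_integral_cmult_indicator Jm ennreal_mult)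
      finally show ?thesis .
    qed
    \<comment> \<open>The tripled interval: outside it the condition
      \<open>3 * r \<le> \<bar>x - c\<bar>\<close> of the far estimate holds.\<close>
    define B where "B = {x. \<bar>x - c\<bar> < 3 * r} \<inter> {0::real<..}"
    have "{x. \<bar>x - c\<bar> < 3 * r} \<in> sets borel" by measurable
    then have B[measurable]: "B \<in> sets ?m" unfolding B_def by (rule sets_bessel)
    have Bm: "emeasure ?m B \<le> ennreal (6 * 4 powr (2 * lam) * \<mu>)"
      unfolding B_def using emeasure_bessel_ball_le[OF lam interval(1,2)] interval(3)
      by (elim order_trans) (auto intro!: ennreal_leI mult_left_mono)
    have Tm[measurable]: "family_op p \<F> (bessel_poisson lam) f \<in> borel_measurable ?m" if "integrable ?m f" for f
      using family_op_measurable[OF lam F(1,2) _ that] p by simp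
    have cgi: "integrable ?m (\<lambda>y. complex_of_real (g i y))" for i using gi by simp
    let ?T = "family_op p \<F> (bessel_poisson lam)"
    have Taa': "?T a = ?T a'" by (rule family_op_cong_AE[OF aa' am a'm])
    have "(\<integral>\<^sup>+x\<in>B. ?T a x \<partial>?m) \<le> (\<integral>\<^sup>+x. (\<Sum>i<4. ?T (\<lambda>y. complex_of_real (g i y)) x * indicator B x) \<partial>?m)"
    proof (rule nn_integral_mono)
      fix x assume "x \<in> space ?m"
      then have x: "0 < x" by simp
      have "?T a x \<le> (\<Sum>i<4. ?T (\<lambda>y. complex_of_real (g i y)) x)"
        unfolding Taa' a'g
        by (subst family_op_def, intro SUP_least order_trans[OF family_op_linear_combination[OF lam x F(1) p cgi]])
          (simp_all add: \<alpha>1)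
      then show "?T a x * indicator B x \<le> (\<Sum>i<4. ?T (\<lambda>y. complex_of_real (g i y)) x * indicator B x)"
        by (auto simp: indicator_def)
    qed
    also have "\<dots> = (\<Sum>i<4. \<integral>\<^sup>+x\<in>B. ?T (\<lambda>y. complex_of_real (g i y)) x \<partial>?m)"
      by (intro nn_integral_sum borel_measurable_times_ennreal Tm[OF cgi] borel_measurable_indicator B)
    also have "\<dots> \<le> (\<Sum>i<(4::nat). ennreal (M * (6 * 4 powr (2 * lam) * \<mu>) + poisson_const lam powr p * C * (M * \<mu>)))"
      using interval(5) gM
      by (intro sum_mono family_op_local_bound[OF lam gi _ M F p C B Bm _ g2]) auto
    also have "\<dots> = ennreal (4 * (6 * 4 powr (2 * lam) + poisson_const lam powr p * C))"
    proof -
      have "M * (6 * 4 powr (2 * lam) * \<mu>) = 6 * 4 powr (2 * lam) * (M * \<mu>)" by (simp only: mult_ac)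
      then have X: "M * (6 * 4 powr (2 * lam) * \<mu>) + poisson_const lam powr p * C * (M * \<mu>) = 6 * 4 powr (2 * lam) + poisson_const lam powr p * C"
        by (simp only: M\<mu> mult_1_right)
      show ?thesis unfolding X using C by (subst sum_ennreal) auto
    qed
    finally have loc: "(\<integral>\<^sup>+x\<in>B. ?T a x \<partial>?m) \<le> ennreal (4 * (6 * 4 powr (2 * lam) + poisson_const lam powr p * C))" .
    have "(LINT y|?m. cmod (a y)) \<le> 1"
    proof -
      have "(LINT y|?m. cmod (a y)) \<le> (LINT y|?m. M * indicat_real J y)"
        using aa' a'M by (intro integral_mono_AE integrable_norm ia iJ) (auto elim!: eventually_mono)
      also have "\<dots> = M * \<mu>"
      proof -
        have "J \<inter> {0<..} = J" by (auto simp: J_def)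
        then show ?thesis using Jm interval(5) by (simp add: measure_def)
      qed
      finally show ?thesis by (simp add: M\<mu>)
    qed
    moreover have "AE y in ?m. \<bar>y - c\<bar> \<le> r \<or> a y = 0"
      using interval(6) by eventually_elim auto
    ultimately have far: "(\<integral>\<^sup>+x\<in>{x. 3 * r \<le> \<bar>x - c\<bar>}. ?T a x \<partial>?m) \<le> ennreal (mixed_const lam * (pi / 2) * poisson_const lam)"
      by (intro family_op_nonlocal_bound[OF lam F(1) p ia _ mean _ c interval(1)])
    have fs: "{x. 3 * r \<le> \<bar>x - c\<bar>} \<inter> {0<..} \<in> sets ?m" by (rule sets_bessel) measurable
    have "(\<integral>\<^sup>+x. ?T a x \<partial>?m) \<le> (\<integral>\<^sup>+x. ?T a x * indicator B x + ?T a x * indicator ({x. 3 * r \<le> \<bar>x - c\<bar>} \<inter> {0<..}) x \<partial>?m)"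
      by (intro nn_integral_mono) (auto simp: indicator_def B_def)
    also have "\<dots> = (\<integral>\<^sup>+x\<in>B. ?T a x \<partial>?m) + (\<integral>\<^sup>+x\<in>{x. 3 * r \<le> \<bar>x - c\<bar>} \<inter> {0<..}. ?T a x \<partial>?m)"
      by (intro nn_integral_add borel_measurable_times_ennreal Tm[OF ia] borel_measurable_indicator B fs)
    also have "(\<integral>\<^sup>+x\<in>{x. 3 * r \<le> \<bar>x - c\<bar>} \<inter> {0<..}. ?T a x \<partial>?m) = (\<integral>\<^sup>+x\<in>{x. 3 * r \<le> \<bar>x - c\<bar>}. ?T a x \<partial>?m)"
      by (intro nn_integral_cong) (auto simp: indicator_def)
    also have "(\<integral>\<^sup>+x\<in>B. ?T a x \<partial>?m) + \<dots> \<le> ennreal (4 * (6 * 4 powr (2 * lam) + poisson_const lam powr p * C)) + ennreal (mixed_const lam * (pi / 2) * poisson_const lam)"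
      by (rule add_mono[OF loc far])
    also have "\<dots> = ennreal (atom_const lam p C)"
      unfolding atom_const_def using C lam poisson_const_pos[OF lam]
      by (intro ennreal_plus[symmetric]) (auto simp: mixed_const_def)
    finally show ?thesis using ia by simp
  qed
  then show "integrable ?m a" "(\<integral>\<^sup>+x. family_op p \<F> (bessel_poisson lam) a x \<partial>?m) \<le> ennreal (atom_const lam p C)"
    by simp_all
qed

text \<open>For one member \<open>S\<close> only finitely many Poisson operators occur, each bounded
  from L^1 to bounded functions by \<open>poisson_bound\<close>. Convergence of the partial sums in
  L^1 therefore makes the remainder vanish at every point \<open>x\<close>, and the supremum over
  \<open>S\<close> is taken only afterwards.\<close>

lemma family_op_le_atomic_sum:
  assumes lam: "0 < lam" and F: "nonoverlapping \<F>" "\<F> \<noteq> {}" "controlled p C \<F>" and p: "1 \<le> p" and C: "0 \<le> C"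
    and f: "integrable (bessel_measure lam) f" and dec: "H1_decomposition lam f \<alpha> a" and x: "0 < x"
  shows "family_op p \<F> (bessel_poisson lam) f x \<le> (\<Sum>j. ennreal (cmod (\<alpha> j)) * family_op p \<F> (bessel_poisson lam) (a j) x)"
    (is "_ \<le> ?L")
  unfolding family_op_def[of p \<F> "bessel_poisson lam" f]
proof (rule SUP_least)
  fix S assume S: "S \<in> \<F>"
  let ?m = "bessel_measure lam"
  have atoms: "H1_atom lam (a j)" for j using dec by (simp add: H1_decomposition_def)
  have ia: "integrable ?m (a j)" for j by (rule family_op_atom_bound(1)[OF lam F p C atoms])
  define s where "s n y = (\<Sum>j<n. \<alpha> j * a j y)" for n y
  have isn: "integrable ?m (s n)" for n
    unfolding s_def by (intro Bochner_Integration.integrable_sum integrable_mult_right ia)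
  define \<delta> where "\<delta> n = (LINT y|?m. cmod (f y - s n y))" for n
  have ifs: "integrable ?m (\<lambda>y. f y - s n y)" for n using f isn by simp
  have \<delta>0: "0 \<le> \<delta> n" for n by (simp add: \<delta>_def)
  have "(\<lambda>n. ennreal (\<delta> n)) \<longlonglongrightarrow> 0"
  proof -
    have "ennreal (\<delta> n) = (\<integral>\<^sup>+y. ennreal (cmod (f y - s n y)) \<partial>?m)" for n
      unfolding \<delta>_def by (intro nn_integral_eq_integral[symmetric] integrable_norm ifs) simp
    then show ?thesis using dec by (simp add: H1_decomposition_def s_def)
  qed
  then have \<delta>lim: "\<delta> \<longlonglongrightarrow> 0" using \<delta>0 by (simp add: ennreal_tendsto_0_iff)
  \<comment> \<open>Depends on \<open>S\<close>, whose times may be arbitrarily small, but not on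
    the number \<open>n\<close> of atoms.\<close>
  define D where "D = (\<Sum>j<fst S. poisson_bound lam (fst (snd S) j) + poisson_bound lam (snd (snd S) j))"
  have le: "ennreal (lp_norm p (fst S) (increments (bessel_poisson lam) f x S)) \<le> ?L + ennreal (D * \<delta> n)" for n
  proof -
    let ?I = "\<lambda>h. increments (bessel_poisson lam) h x S"
    have split: "?I f j = ?I (s n) j + ?I (\<lambda>y. f y - s n y) j" if j: "j < fst S" for j
    proof -
      have "?I (\<lambda>y. \<Sum>i<2. 1 * (if i = (0::nat) then s n else (\<lambda>y. f y - s n y)) y) j
        = (\<Sum>i<2. 1 * ?I (if i = (0::nat) then s n else (\<lambda>y. f y - s n y)) j)"
        using isn ifs by (intro increments_linear_combination[OF lam x F(1) S j]) auto
      then show ?thesis by (simp add: numeral_2_eq_2)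
    qed
    have rem: "lp_norm p (fst S) (?I (\<lambda>y. f y - s n y)) \<le> D * \<delta> n"
    proof -
      have "lp_norm p (fst S) (?I (\<lambda>y. f y - s n y)) \<le> (\<Sum>j<fst S. cmod (?I (\<lambda>y. f y - s n y) j))"
        by (rule lp_norm_le_sum[OF p])
      also have "\<dots> \<le> (\<Sum>j<fst S. (poisson_bound lam (fst (snd S) j) + poisson_bound lam (snd (snd S) j)) * \<delta> n)"
      proof (rule sum_mono)
        fix j assume "j \<in> {..<fst S}"
        then have t: "0 < fst (snd S) j" "0 < snd (snd S) j" using nonoverlapping_times[OF F(1) S, of j] by auto
        have "cmod (?I (\<lambda>y. f y - s n y) j) \<le> cmod (bessel_poisson lam (fst (snd S) j) (\<lambda>y. f y - s n y) x) + cmod (bessel_poisson lam (snd (snd S) j) (\<lambda>y. f y - s n y) x)"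
          unfolding increments_def by (rule norm_triangle_ineq4)
        also have "\<dots> \<le> poisson_bound lam (fst (snd S) j) * \<delta> n + poisson_bound lam (snd (snd S) j) * \<delta> n"
          unfolding \<delta>_def by (intro add_mono poisson_le lam t x ifs)
        finally show "cmod (?I (\<lambda>y. f y - s n y) j) \<le> (poisson_bound lam (fst (snd S) j) + poisson_bound lam (snd (snd S) j)) * \<delta> n"
          by (simp add: distrib_right)
      qed
      also have "\<dots> = D * \<delta> n" by (simp add: D_def sum_distrib_right)
      finally show ?thesis .
    qed
    have "lp_norm p (fst S) (?I f) = lp_norm p (fst S) (\<lambda>j. ?I (s n) j + ?I (\<lambda>y. f y - s n y) j)"
      by (rule lp_norm_cong) (rule split)
    also have "\<dots> \<le> lp_norm p (fst S) (?I (s n)) + D * \<delta> n"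
      using lp_norm_triangle[OF p, of "fst S" "?I (s n)" "?I (\<lambda>y. f y - s n y)"] rem by linarith
    finally have "ennreal (lp_norm p (fst S) (?I f)) \<le> ennreal (lp_norm p (fst S) (?I (s n)) + D * \<delta> n)"
      by (rule ennreal_leI)
    also have "\<dots> = ennreal (lp_norm p (fst S) (?I (s n))) + ennreal (D * \<delta> n)"
      using order_trans[OF lp_norm_nonneg rem] by (intro ennreal_plus) auto
    also have "ennreal (lp_norm p (fst S) (?I (s n))) \<le> (\<Sum>j<n. ennreal (cmod (\<alpha> j)) * family_op p \<F> (bessel_poisson lam) (a j) x)"
      unfolding s_def by (rule family_op_linear_combination[OF lam x F(1) p ia S])
    also have "\<dots> \<le> ?L" by (intro sum_le_suminf) auto
    finally show ?thesis by (simp add: add_right_mono)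
  qed
  have "(\<lambda>n. ?L + ennreal (D * \<delta> n)) \<longlonglongrightarrow> ?L + ennreal (D * 0)"
    by (intro tendsto_add tendsto_const tendsto_ennrealI tendsto_mult \<delta>lim)
  then show "ennreal (lp_norm p (fst S) (increments (bessel_poisson lam) f x S)) \<le> ?L"
    using le by (intro LIMSEQ_le_const[where X = "\<lambda>n. ?L + ennreal (D * \<delta> n)"]) auto
qed

text \<open>The constant depends only on \<open>lam\<close>, \<open>p\<close> and \<open>C\<close>.
  The same bound thus holds for every decomposition of \<open>f\<close> and passes to the
  infimum.\<close>

lemma bounded_family_op:
  assumes lam: "0 < lam" and F: "nonoverlapping \<F>" "\<F> \<noteq> {}" "controlled p C \<F>" and p: "1 \<le> p" and C: "0 \<le> C"
  shows "bounded_H1_L1 lam (family_op p \<F> (bessel_poisson lam))"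
  unfolding bounded_H1_L1_def
proof (intro exI[of _ "atom_const lam p C"] conjI ballI)
  let ?m = "bessel_measure lam" and ?T = "family_op p \<F> (bessel_poisson lam)"
  show C0: "0 < atom_const lam p C" by (rule atom_const_pos[OF lam C])
  fix f assume f: "f \<in> H1_space lam"
  then have fi: "integrable ?m f" and ex: "\<exists>\<alpha> a. H1_decomposition lam f \<alpha> a" by (auto simp: H1_space_def)
  have Tm: "?T h \<in> borel_measurable ?m" if "integrable ?m h" for h
    using family_op_measurable[OF lam F(1,2) _ that] p by simp
  show "?T f \<in> borel_measurable ?m" by (rule Tm[OF fi])
  have bound: "(\<integral>\<^sup>+x. ?T f x \<partial>?m) \<le> ennreal (atom_const lam p C * (\<Sum>j. cmod (\<alpha> j)))" if dec: "H1_decomposition lam f \<alpha> a" for \<alpha> a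
  proof -
    have atoms: "H1_atom lam (a j)" for j using dec by (simp add: H1_decomposition_def)
    note ab = family_op_atom_bound[OF lam F p C atoms]
    have sm: "summable (\<lambda>j. cmod (\<alpha> j))" using dec by (simp add: H1_decomposition_def)
    have "(\<integral>\<^sup>+x. ?T f x \<partial>?m) \<le> (\<integral>\<^sup>+x. (\<Sum>j. ennreal (cmod (\<alpha> j)) * ?T (a j) x) \<partial>?m)"
      by (intro nn_integral_mono family_op_le_atomic_sum[OF lam F p C fi dec]) simp
    also have "\<dots> = (\<Sum>j. \<integral>\<^sup>+x. ennreal (cmod (\<alpha> j)) * ?T (a j) x \<partial>?m)"
      by (intro nn_integral_suminf borel_measurable_times_ennreal Tm ab(1) measurable_const) simp
    also have "\<dots> = (\<Sum>j. ennreal (cmod (\<alpha> j)) * (\<integral>\<^sup>+x. ?T (a j) x \<partial>?m))"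
      by (intro suminf_cong nn_integral_cmult Tm ab(1))
    also have "\<dots> \<le> (\<Sum>j. ennreal (cmod (\<alpha> j)) * ennreal (atom_const lam p C))"
      by (intro suminf_le mult_left_mono ab(2)) auto
    also have "\<dots> = (\<Sum>j. ennreal (cmod (\<alpha> j))) * ennreal (atom_const lam p C)"
      by (rule ennreal_suminf_multc)
    also have "(\<Sum>j. ennreal (cmod (\<alpha> j))) = ennreal (\<Sum>j. cmod (\<alpha> j))"
      by (intro suminf_ennreal2 sm) simp
    also have "\<dots> * ennreal (atom_const lam p C) = ennreal (atom_const lam p C * (\<Sum>j. cmod (\<alpha> j)))"
      using C0 suminf_nonneg[OF sm] by (simp add: ennreal_mult mult.commute)
    finally show ?thesis .
  qed
  let ?X = "{\<Sum>j. cmod (\<alpha> j) | \<alpha> a. H1_decomposition lam f \<alpha> a}"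
  \<comment> \<open>The integral is finite, by the bound from any one decomposition, so the estimate
    can be rearranged in real numbers before the infimum is taken.\<close>
  define v where "v = enn2real (\<integral>\<^sup>+x. ?T f x \<partial>?m)"
  have v: "(\<integral>\<^sup>+x. ?T f x \<partial>?m) = ennreal v"
  proof -
    obtain \<alpha> a where "H1_decomposition lam f \<alpha> a" using ex by blast
    from bound[OF this] show ?thesis unfolding v_def by (auto simp: ennreal_enn2real_if top_unique)
  qed
  have "v / atom_const lam p C \<le> Inf ?X"
  proof (rule cInf_greatest)
    show "?X \<noteq> {}" using ex by blast
    fix s assume "s \<in> ?X"
    then obtain \<alpha> a where dec: "H1_decomposition lam f \<alpha> a" and s: "s = (\<Sum>j. cmod (\<alpha> j))" by blast
    have "0 \<le> s" unfolding s using dec by (intro suminf_nonneg) (auto simp: H1_decomposition_def)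
    then have "v \<le> atom_const lam p C * s"
      using bound[OF dec] C0 unfolding v s[symmetric] by (simp add: ennreal_le_iff)
    then show "v / atom_const lam p C \<le> s" using C0 by (simp add: field_simps)
  qed
  then have "v \<le> atom_const lam p C * H1_norm lam f" using C0 by (simp add: H1_norm_def field_simps)
  then show "(\<integral>\<^sup>+x. ?T f x \<partial>?m) \<le> ennreal (atom_const lam p C * H1_norm lam f)"
    unfolding v by (rule ennreal_leI)
qed

section \<open>The variation and oscillation operators\<close>

lemma ennreal_powr_mono: "u \<le> v \<Longrightarrow> 0 < p \<Longrightarrow> ennreal_powr u p \<le> ennreal_powr v p"
  by (cases u; cases v) (auto simp: ennreal_powr_def top_unique intro!: ennreal_leI powr_mono2)

lemma ennreal_powr_ennreal: "0 \<le> r \<Longrightarrow> ennreal_powr (ennreal r) p = ennreal (r powr p)"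
  by (simp add: ennreal_powr_def)

lemma ennreal_powr_inverse: "0 < p \<Longrightarrow> ennreal_powr (ennreal_powr u p) (1 / p) = u"
  by (cases u) (auto simp: ennreal_powr_def powr_powr)

text \<open>For \<open>0 < p\<close> the power is an order isomorphism of
  \<open>[0, \<infinity>]\<close> with inverse exponent \<open>1 / p\<close>, hence commutes with
  suprema.\<close>

lemma ennreal_powr_SUP:
  assumes p: "0 < p"
  shows "ennreal_powr (SUP i\<in>A. F i) p = (SUP i\<in>A. ennreal_powr (F i) p)"
proof (rule antisym)
  let ?y = "SUP i\<in>A. ennreal_powr (F i) p"
  have "F i \<le> ennreal_powr ?y (1 / p)" if "i \<in> A" for i
    using ennreal_powr_mono[OF SUP_upper[OF that, of "\<lambda>i. ennreal_powr (F i) p"], of "1 / p"] p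
    by (simp add: ennreal_powr_inverse)
  then have "(SUP i\<in>A. F i) \<le> ennreal_powr ?y (1 / p)" by (rule SUP_least)
  then have "ennreal_powr (SUP i\<in>A. F i) p \<le> ennreal_powr (ennreal_powr ?y (1 / p)) p"
    using p by (intro ennreal_powr_mono) auto
  also have "\<dots> = ?y" using ennreal_powr_inverse[of "1 / p" ?y] p by simp
  finally show "ennreal_powr (SUP i\<in>A. F i) p \<le> ?y" .
  show "?y \<le> ennreal_powr (SUP i\<in>A. F i) p"
    using p by (intro SUP_least ennreal_powr_mono SUP_upper) auto
qed

lemma ennreal_lp_norm:
  assumes "0 < p"
  shows "ennreal (lp_norm p N v) = ennreal_powr (\<Sum>j<N. ennreal (cmod (v j) powr p)) (1 / p)"
  by (subst sum_ennreal) (simp_all add: lp_norm_def ennreal_powr_ennreal sum_nonneg)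

section \<open>The variation operator\<close>

definition variation_family :: "intervals set" where
  "variation_family = {(N, \<lambda>j. s (Suc j), s) | N s. decseq s \<and> (\<forall>j. 0 < s j) \<and> s \<longlonglongrightarrow> 0}"

text \<open>A sum of nonnegative terms is the supremum of its partial sums, and the outer power
  commutes with suprema; so the initial segments of the sequences give the same value.\<close>

lemma variation_op_eq_family_op:
  assumes p: "0 < p"
  shows "variation_op p P f x = family_op p variation_family P f x"
proof -
  let ?D = "{s :: nat \<Rightarrow> real. decseq s \<and> (\<forall>j. 0 < s j) \<and> s \<longlonglongrightarrow> 0}"
  have "variation_op p P f x = (SUP s\<in>?D. SUP N. ennreal (lp_norm p N (\<lambda>j. P (s (Suc j)) f x - P (s j) f x)))"
    unfolding variation_op_def using p
    by (simp add: suminf_eq_SUP ennreal_powr_SUP ennreal_lp_norm)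
  also have "\<dots> = family_op p variation_family P f x"
  proof (rule antisym)
    show "(SUP s\<in>?D. SUP N. ennreal (lp_norm p N (\<lambda>j. P (s (Suc j)) f x - P (s j) f x))) \<le> family_op p variation_family P f x"
    proof (intro SUP_least)
      fix s :: "nat \<Rightarrow> real" and N assume "s \<in> ?D"
      then have m: "(N, \<lambda>j. s (Suc j), s) \<in> variation_family" by (auto simp: variation_family_def)
      show "ennreal (lp_norm p N (\<lambda>j. P (s (Suc j)) f x - P (s j) f x)) \<le> family_op p variation_family P f x"
        unfolding family_op_def by (rule SUP_upper2[OF m]) (simp add: increments_def[abs_def])
    qed
    show "family_op p variation_family P f x \<le> (SUP s\<in>?D. SUP N. ennreal (lp_norm p N (\<lambda>j. P (s (Suc j)) f x - P (s j) f x)))"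
      unfolding family_op_def
    proof (rule SUP_least)
      fix S assume "S \<in> variation_family"
      then obtain N s where S: "S = (N, \<lambda>j. s (Suc j), s)" "s \<in> ?D" by (auto simp: variation_family_def)
      have "ennreal (lp_norm p (fst S) (increments P f x S)) = ennreal (lp_norm p N (\<lambda>j. P (s (Suc j)) f x - P (s j) f x))"
        by (simp add: S(1) increments_def[abs_def])
      also have "\<dots> \<le> (SUP s\<in>?D. SUP N. ennreal (lp_norm p N (\<lambda>j. P (s (Suc j)) f x - P (s j) f x)))"
        by (intro SUP_upper2[OF S(2)] SUP_upper2[of N]) auto
      finally show "ennreal (lp_norm p (fst S) (increments P f x S)) \<le> (SUP s\<in>?D. SUP N. ennreal (lp_norm p N (\<lambda>j. P (s (Suc j)) f x - P (s j) f x)))" .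
    qed
  qed
  finally show ?thesis .
qed

lemma nonoverlapping_variation_family: "nonoverlapping variation_family"
  by (auto simp: nonoverlapping_def variation_family_def decseq_Suc_iff)

lemma variation_family_nonempty: "variation_family \<noteq> {}"
proof -
  have "(0, \<lambda>j. inverse (real (Suc (Suc j))), \<lambda>j. inverse (real (Suc j))) \<in> variation_family"
    unfolding variation_family_def
    using LIMSEQ_inverse_real_of_nat
    by (intro CollectI exI[of _ 0] exI[of _ "\<lambda>j. inverse (real (Suc j))"]) (auto simp: decseq_def intro!: le_imp_inverse_le)
  then show ?thesis by blast
qed

lemma decreasing_enumeration:
  fixes X :: "real set"
  assumes "finite X" "X \<noteq> {}"
  obtains tm :: "nat \<Rightarrow> real" and n where "\<And>i. i < n \<Longrightarrow> tm (Suc i) < tm i" "tm ` {..n} = X"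
proof -
  define xs where "xs = rev (sorted_list_of_set X)"
  have xs: "set xs = X" "xs \<noteq> []" using assms by (auto simp: xs_def)
  have sw: "sorted_wrt (>) xs"
    using strict_sorted_list_of_set[of X] by (simp add: xs_def sorted_wrt_rev)
  show ?thesis
  proof (rule that[of "length xs - 1" "\<lambda>i. xs ! i"])
    show "xs ! Suc i < xs ! i" if "i < length xs - 1" for i
      using sorted_wrt_nth_less[OF sw, of i "Suc i"] that by simp
    have "{..length xs - 1} = {..<length xs}" using xs(2) by (cases xs) auto
    then show "(!) xs ` {..length xs - 1} = X" using xs(1) by (auto simp: set_conv_nth)
  qed
qed

lemma decreasing_less:
  fixes tm :: "nat \<Rightarrow> real"
  assumes "\<And>i. i < n \<Longrightarrow> tm (Suc i) < tm i" "i < j" "j \<le> n"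
  shows "tm j < tm i"
  using assms(2,3)
proof (induction j rule: less_induct)
  case (less j)
  then obtain j' where j': "j = Suc j'" by (cases j) auto
  then have "tm j < tm j'" using assms(1) less.prems by simp
  then show ?case using less.IH[of j'] less.prems j' by (cases "i = j'") auto
qed

lemma decreasing_le_iff:
  fixes tm :: "nat \<Rightarrow> real"
  assumes "\<And>i. i < n \<Longrightarrow> tm (Suc i) < tm i" "i \<le> n" "j \<le> n"
  shows "tm j \<le> tm i \<longleftrightarrow> i \<le> j"
  using decreasing_less[of n tm i j] decreasing_less[of n tm j i] assms
  by (cases i j rule: linorder_cases) auto

text \<open>All times of the finite subfamily are merged into one decreasing list \<open>tm\<close>.
  Each sequence becomes a nondecreasing sequence of indices \<sigma>, and
  \<open>variation_controlled\<close> applies to all of them with one \<open>G\<close>.\<close>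

lemma variation_family_controlled:
  assumes p: "2 < p"
  shows "controlled p (4 powr p / (1 - (1/2) powr (p - 2))) variation_family"
  unfolding controlled_def
proof (intro allI impI)
  fix M :: real and A assume M: "0 < M" and A: "A \<subseteq> variation_family" "finite A" "A \<noteq> {}"
  let ?C = "4 powr p / (1 - (1/2) powr (p - 2))"
  \<comment> \<open>There is one more endpoint than there are intervals, hence
    \<open>{..fst S}\<close>.\<close>
  define X where "X = (\<Union>S\<in>A. snd (snd S) ` {..fst S})"
  have X: "finite X" "X \<noteq> {}" using A by (auto simp: X_def)
  obtain tm n where tm: "\<And>i. i < n \<Longrightarrow> tm (Suc i) < tm i" "tm ` {..n} = X"
    using decreasing_enumeration[OF X] by blast
  have pos: "0 < t" if "t \<in> X" for t using that A(1) by (auto simp: X_def variation_family_def)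
  obtain G where G: "predictable G"
    "\<And>n z s N. (\<And>i. i \<le> n \<Longrightarrow> z i \<in> {0..M}) \<Longrightarrow> (\<And>j. j < N \<Longrightarrow> s j \<le> s (Suc j)) \<Longrightarrow> s N \<le> n \<Longrightarrow>
      (\<Sum>j<N. \<bar>z (s (Suc j)) - z (s j)\<bar> powr p) \<le> ?C * M powr (p - 2) * (z n)\<^sup>2 + (\<Sum>i<n. G i z * (z (Suc i) - z i))"
    using variation_controlled[OF p M] by blast
  have mem: "\<exists>s. S = (fst S, \<lambda>j. s (Suc j), s) \<and> decseq s \<and> (\<forall>j\<le>fst S. s j \<in> X)" if S: "S \<in> A" for S
  proof -
    obtain N s where s: "S = (N, \<lambda>j. s (Suc j), s)" "decseq s" using S A(1) by (auto simp: variation_family_def)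
    moreover have "s j \<in> X" if "j \<le> N" for j
      unfolding X_def by (rule UN_I[OF S]) (use s(1) that in auto)
    ultimately show ?thesis by auto
  qed
  have SX: "fst (snd S) j \<in> X" "snd (snd S) j \<in> X" if S: "S \<in> A" and j: "j < fst S" for S j
  proof -
    obtain s where s: "S = (fst S, \<lambda>j. s (Suc j), s)" "\<forall>j\<le>fst S. s j \<in> X" using mem[OF S] by blast
    have "fst (snd S) j = s (Suc j)" "snd (snd S) j = s j" by (subst s(1), simp)+
    then show "fst (snd S) j \<in> X" "snd (snd S) j \<in> X" using s(2) j by auto
  qed
  have main: "(\<Sum>j<fst S. \<bar>\<zeta> (fst (snd S) j) - \<zeta> (snd (snd S) j)\<bar> powr p)
      \<le> ?C * M powr (p - 2) * (\<zeta> (tm n))\<^sup>2 + (\<Sum>i<n. G i (\<lambda>i. \<zeta> (tm i)) * (\<zeta> (tm (Suc i)) - \<zeta> (tm i)))"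
    if S: "S \<in> A" and \<zeta>: "\<forall>i\<le>n. \<zeta> (tm i) \<in> {0..M}" for S \<zeta>
  proof -
    obtain s where s: "S = (fst S, \<lambda>j. s (Suc j), s)" "decseq s" "\<forall>j\<le>fst S. s j \<in> X" using mem[OF S] by blast
    then have "\<forall>j\<le>fst S. \<exists>i\<le>n. s j = tm i" unfolding tm(2)[symmetric] by auto
    then obtain \<sigma> where \<sigma>: "\<And>j. j \<le> fst S \<Longrightarrow> \<sigma> j \<le> n \<and> s j = tm (\<sigma> j)" by metis
    have mono: "\<sigma> j \<le> \<sigma> (Suc j)" if "j < fst S" for j
      using decreasing_le_iff[of n tm "\<sigma> j" "\<sigma> (Suc j)", OF tm(1)] \<sigma>[of j] \<sigma>[of "Suc j"] that decseq_SucD[OF s(2), of j] by auto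
    have "(\<Sum>j<fst S. \<bar>\<zeta> (fst (snd S) j) - \<zeta> (snd (snd S) j)\<bar> powr p) = (\<Sum>j<fst S. \<bar>\<zeta> (tm (\<sigma> (Suc j))) - \<zeta> (tm (\<sigma> j))\<bar> powr p)"
    proof (rule sum.cong)
      fix j assume "j \<in> {..<fst S}"
      then have "s j = tm (\<sigma> j)" "s (Suc j) = tm (\<sigma> (Suc j))" using \<sigma>[of j] \<sigma>[of "Suc j"] by auto
      moreover have "fst (snd S) j = s (Suc j)" "snd (snd S) j = s j" by (subst s(1), simp)+
      ultimately show "\<bar>\<zeta> (fst (snd S) j) - \<zeta> (snd (snd S) j)\<bar> powr p = \<bar>\<zeta> (tm (\<sigma> (Suc j))) - \<zeta> (tm (\<sigma> j))\<bar> powr p" by simp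
    qed simp
    also have "\<dots> \<le> ?C * M powr (p - 2) * (\<zeta> (tm n))\<^sup>2 + (\<Sum>i<n. G i (\<lambda>i. \<zeta> (tm i)) * (\<zeta> (tm (Suc i)) - \<zeta> (tm i)))"
      using G(2)[of n "\<lambda>i. \<zeta> (tm i)" "fst S" \<sigma>] \<zeta> mono \<sigma>[of "fst S"] by simp
    finally show ?thesis .
  qed
  show "\<exists>n tm G. predictable G \<and> (\<forall>i<n. tm (Suc i) < tm i) \<and> (\<forall>i\<le>n. 0 < tm i) \<and>
     (\<forall>(N, e', e)\<in>A. \<forall>j<N. e' j \<in> tm ` {..n} \<and> e j \<in> tm ` {..n}) \<and>
     (\<forall>\<zeta>. (\<forall>i\<le>n. \<zeta> (tm i) \<in> {0..M}) \<longrightarrow> (\<forall>(N, e', e)\<in>A.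
        (\<Sum>j<N. \<bar>\<zeta> (e' j) - \<zeta> (e j)\<bar> powr p)
          \<le> ?C * M powr (p - 2) * (\<zeta> (tm n))\<^sup>2 + (\<Sum>i<n. G i (\<lambda>i. \<zeta> (tm i)) * (\<zeta> (tm (Suc i)) - \<zeta> (tm i)))))"
  proof (intro exI[of _ n] exI[of _ tm] exI[of _ G] conjI allI impI)
    show "\<forall>(N, e', e)\<in>A. \<forall>j<N. e' j \<in> tm ` {..n} \<and> e j \<in> tm ` {..n}"
      unfolding tm(2) split_beta' using SX by blast
    fix \<zeta> :: "real \<Rightarrow> real" assume "\<forall>i\<le>n. \<zeta> (tm i) \<in> {0..M}"
    then show "\<forall>(N, e', e)\<in>A. (\<Sum>j<N. \<bar>\<zeta> (e' j) - \<zeta> (e j)\<bar> powr p)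
          \<le> ?C * M powr (p - 2) * (\<zeta> (tm n))\<^sup>2 + (\<Sum>i<n. G i (\<lambda>i. \<zeta> (tm i)) * (\<zeta> (tm (Suc i)) - \<zeta> (tm i)))"
      unfolding split_beta' using main by blast
  qed (use G(1) tm pos in auto)
qed

section \<open>The oscillation operator\<close>

definition oscillation_family :: "(nat \<Rightarrow> real) \<Rightarrow> intervals set" where
  "oscillation_family t = {(N, e', e). \<forall>j<N. t (Suc j) \<le> e' j \<and> e' j \<le> e j \<and> e j \<le> t j}"

text \<open>The index may be chosen independently in each summand, so a sum of suprema is bounded by
  any bound for the sums along choice functions \<open>c\<close>. The summand \<open>b\<close>
  collects the terms already chosen during the induction.\<close>

lemma sum_SUP_le:
  fixes F :: "nat \<Rightarrow> 'i \<Rightarrow> ennreal"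
  assumes "\<And>j. A j \<noteq> {}" "\<And>c. (\<And>j. c j \<in> A j) \<Longrightarrow> b + (\<Sum>j<N. F j (c j)) \<le> y"
  shows "b + (\<Sum>j<N. SUP a\<in>A j. F j a) \<le> y"
  using assms(2)
proof (induction N arbitrary: b)
  case 0
  have "\<forall>j. \<exists>a. a \<in> A j" using assms(1) by blast
  then obtain c where "\<forall>j. c j \<in> A j" using choice[of "\<lambda>j a. a \<in> A j"] by blast
  then have c: "c j \<in> A j" for j by blast
  from "0"[of c, OF c] show ?case by simp
next
  case (Suc N)
  have "(SUP a\<in>A N. (b + (\<Sum>j<N. SUP a\<in>A j. F j a)) + F N a) \<le> y"
  proof (rule SUP_least)
    fix a assume a: "a \<in> A N"
    have "(b + F N a) + (\<Sum>j<N. SUP a\<in>A j. F j a) \<le> y"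
    proof (rule Suc.IH)
      fix c assume c: "\<And>j. c j \<in> A j"
      have "b + (\<Sum>j<Suc N. F j ((c(N := a)) j)) \<le> y"
        by (rule Suc.prems) (use c a in auto)
      then show "(b + F N a) + (\<Sum>j<N. F j (c j)) \<le> y" by (simp add: ac_simps)
    qed
    then show "(b + (\<Sum>j<N. SUP a\<in>A j. F j a)) + F N a \<le> y" by (simp add: ac_simps)
  qed
  then have "(b + (\<Sum>j<N. SUP a\<in>A j. F j a)) + (SUP a\<in>A N. F N a) \<le> y"
    by (subst ennreal_SUP_add_right[OF assms(1)])
  then show ?case by (simp only: sum.lessThan_Suc add.assoc)
qed

lemma oscillation_op_eq_family_op:
  assumes t: "decseq t"
  shows "oscillation_op t P f x = family_op 2 (oscillation_family t) P f x"
proof -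
  define E where "E j = {q :: real \<times> real. t (Suc j) \<le> fst q \<and> fst q \<le> snd q \<and> snd q \<le> t j}" for j
  define v where "v q = ennreal (cmod (P (fst q) f x - P (snd q) f x) powr 2)" for q
  \<comment> \<open>Degenerate pairs belong to \<open>E j\<close> and contribute zero. They supply a
    choice for every block, also where \<open>t\<close> repeats a value.\<close>
  have ne: "E j \<noteq> {}" for j
  proof -
    have "(t j, t j) \<in> E j" using decseq_SucD[OF t] by (auto simp: E_def)
    then show ?thesis by blast
  qed
  have sup: "(SUP (e', e) \<in> {(e', e). t (Suc j) \<le> e' \<and> e' < e \<and> e \<le> t j}. ennreal ((cmod (P e' f x - P e f x))\<^sup>2)) = (SUP q\<in>E j. v q)" for j
  proof (rule antisym)
    show "(SUP (e', e) \<in> {(e', e). t (Suc j) \<le> e' \<and> e' < e \<and> e \<le> t j}. ennreal ((cmod (P e' f x - P e f x))\<^sup>2)) \<le> (SUP q\<in>E j. v q)"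
    proof (rule SUP_least)
      fix q assume "q \<in> {(e', e). t (Suc j) \<le> e' \<and> e' < e \<and> e \<le> t j}"
      then have "q \<in> E j" by (auto simp: E_def)
      then show "(case q of (e', e) \<Rightarrow> ennreal ((cmod (P e' f x - P e f x))\<^sup>2)) \<le> (SUP q\<in>E j. v q)"
        by (rule SUP_upper2) (simp add: v_def split_beta')
    qed
    show "(SUP q\<in>E j. v q) \<le> (SUP (e', e) \<in> {(e', e). t (Suc j) \<le> e' \<and> e' < e \<and> e \<le> t j}. ennreal ((cmod (P e' f x - P e f x))\<^sup>2))"
    proof (rule SUP_least)
      fix q assume q: "q \<in> E j"
      show "v q \<le> (SUP (e', e) \<in> {(e', e). t (Suc j) \<le> e' \<and> e' < e \<and> e \<le> t j}. ennreal ((cmod (P e' f x - P e f x))\<^sup>2))"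
      proof (cases "fst q = snd q")
        case True
        then show ?thesis by (simp add: v_def)
      next
        case False
        then have "q \<in> {(e', e). t (Suc j) \<le> e' \<and> e' < e \<and> e \<le> t j}" using q by (auto simp: E_def)
        then show ?thesis by (rule SUP_upper2) (simp add: v_def split_beta')
      qed
    qed
  qed
  have "oscillation_op t P f x = (SUP N. ennreal_powr (\<Sum>j<N. SUP q\<in>E j. v q) (1 / 2))"
    unfolding oscillation_op_def sup by (simp add: suminf_eq_SUP ennreal_powr_SUP)
  also have "\<dots> = family_op 2 (oscillation_family t) P f x"
  proof (rule antisym)
    let ?Y = "family_op 2 (oscillation_family t) P f x"
    show "(SUP N. ennreal_powr (\<Sum>j<N. SUP q\<in>E j. v q) (1 / 2)) \<le> ?Y"
    proof (rule SUP_least)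
      fix N
      have "0 + (\<Sum>j<N. SUP q\<in>E j. v q) \<le> ennreal_powr ?Y 2"
      proof (rule sum_SUP_le[OF ne])
        fix c assume c: "\<And>j. c j \<in> E j"
        let ?S = "(N, \<lambda>j. fst (c j), \<lambda>j. snd (c j))"
        have "?S \<in> oscillation_family t" using c by (auto simp: oscillation_family_def E_def)
        then have "ennreal (lp_norm 2 N (increments P f x ?S)) \<le> ?Y"
          unfolding family_op_def by (rule SUP_upper2) simp
        then have "ennreal_powr (ennreal_powr (\<Sum>j<N. v (c j)) (1 / 2)) 2 \<le> ennreal_powr ?Y 2"
          by (intro ennreal_powr_mono) (simp_all add: ennreal_lp_norm increments_def v_def)
        then show "0 + (\<Sum>j<N. v (c j)) \<le> ennreal_powr ?Y 2"
          using ennreal_powr_inverse[of "1 / 2" "\<Sum>j<N. v (c j)"] by simp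
      qed
      then have "ennreal_powr (\<Sum>j<N. SUP q\<in>E j. v q) (1 / 2) \<le> ennreal_powr (ennreal_powr ?Y 2) (1 / 2)"
        by (intro ennreal_powr_mono) simp_all
      then show "ennreal_powr (\<Sum>j<N. SUP q\<in>E j. v q) (1 / 2) \<le> ?Y"
        using ennreal_powr_inverse[of 2 ?Y] by simp
    qed
    show "?Y \<le> (SUP N. ennreal_powr (\<Sum>j<N. SUP q\<in>E j. v q) (1 / 2))"
      unfolding family_op_def
    proof (rule SUP_least)
      fix S assume S: "S \<in> oscillation_family t"
      have q: "(fst (snd S) j, snd (snd S) j) \<in> E j" if "j < fst S" for j
        using S that by (auto simp: oscillation_family_def E_def)
      have "ennreal (lp_norm 2 (fst S) (increments P f x S)) = ennreal_powr (\<Sum>j<fst S. v (fst (snd S) j, snd (snd S) j)) (1 / 2)"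
        by (simp add: ennreal_lp_norm increments_def v_def)
      also have "\<dots> \<le> ennreal_powr (\<Sum>j<fst S. SUP q\<in>E j. v q) (1 / 2)"
        using q by (intro ennreal_powr_mono sum_mono SUP_upper) auto
      also have "\<dots> \<le> (SUP N. ennreal_powr (\<Sum>j<N. SUP q\<in>E j. v q) (1 / 2))"
        by (rule SUP_upper) simp
      finally show "ennreal (lp_norm 2 (fst S) (increments P f x S)) \<le> (SUP N. ennreal_powr (\<Sum>j<N. SUP q\<in>E j. v q) (1 / 2))" .
    qed
  qed
  finally show ?thesis .
qed

lemma nonoverlapping_oscillation_family:
  assumes "\<And>j. 0 < t j"
  shows "nonoverlapping (oscillation_family t)"
  unfolding nonoverlapping_def split_beta'
proof (intro ballI conjI allI impI)
  fix S j assume S: "S \<in> oscillation_family t"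
  have E: "t (Suc i) \<le> fst (snd S) i" "fst (snd S) i \<le> snd (snd S) i" "snd (snd S) i \<le> t i" if "i < fst S" for i
    using S that by (auto simp: oscillation_family_def)
  show "0 < fst (snd S) j" "fst (snd S) j \<le> snd (snd S) j" if "j < fst S"
    using E[OF that] assms[of "Suc j"] by auto
  show "snd (snd S) (Suc j) \<le> fst (snd S) j" if "Suc j < fst S"
    using E(3)[OF that] E(1)[of j] that by simp
qed

lemma oscillation_family_nonempty: "oscillation_family t \<noteq> {}"
proof -
  have "(0, t, t) \<in> oscillation_family t" by (simp add: oscillation_family_def)
  then show ?thesis by blast
qed

text \<open>The merged list of times contains the boundaries \<open>t 0\<close> up to
  \<open>t L\<close>, so the blocks of \<open>oscillation_controlled\<close> are ranges of indices.
  The extreme times of the list are \<open>t 0\<close> and \<open>t L\<close>, which gives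
  \<open>b 0 = 0\<close> and \<open>b L = n\<close>. At exponent 2 the power of \<open>M\<close> in
  \<open>controlled\<close> is 1.\<close>

lemma oscillation_family_controlled:
  assumes t: "decseq t" "\<And>j. 0 < t j"
  shows "controlled 2 16 (oscillation_family t)"
  unfolding controlled_def
proof (intro allI impI)
  fix M :: real and A assume M: "0 < M" and A: "A \<subseteq> oscillation_family t" "finite A" "A \<noteq> {}"
  \<comment> \<open>Members of \<open>A\<close> may have different numbers of intervals; the blocks
    are laid out for the largest.\<close>
  define L where "L = Max (fst ` A)"
  have L: "fst S \<le> L" if "S \<in> A" for S using that A(2) by (simp add: L_def)
  define X where "X = t ` {..L} \<union> (\<Union>S\<in>A. fst (snd S) ` {..<fst S} \<union> snd (snd S) ` {..<fst S})"
  have X: "finite X" "X \<noteq> {}" using A by (auto simp: X_def)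
  have SE: "t (Suc j) \<le> fst (snd S) j" "fst (snd S) j \<le> snd (snd S) j" "snd (snd S) j \<le> t j" if "S \<in> A" "j < fst S" for S j
    using that A(1) by (auto simp: oscillation_family_def)
  have tle: "t j \<le> t i" if "i \<le> j" for i j using decseqD[OF t(1) that] .
  have XL: "t L \<le> q \<and> q \<le> t 0" if q: "q \<in> X" for q
  proof -
    consider j where "j \<le> L" "q = t j" | S j where "S \<in> A" "j < fst S" "q = fst (snd S) j \<or> q = snd (snd S) j"
      using q by (auto simp: X_def)
    then show ?thesis
    proof cases
      case 1
      then show ?thesis using tle by simp
    next
      case 2
      then show ?thesis using SE[OF 2(1,2)] tle[of "Suc j" L] tle[of 0 j] L[OF 2(1)] by auto
    qed
  qed
  obtain tm n where tm: "\<And>i. i < n \<Longrightarrow> tm (Suc i) < tm i" "tm ` {..n} = X"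
    using decreasing_enumeration[OF X] by blast
  note le_iff = decreasing_le_iff[where tm = tm and n = n, OF tm(1)]
  have "\<forall>q\<in>X. \<exists>i\<le>n. q = tm i" unfolding tm(2)[symmetric] by auto
  then obtain idx where idx: "\<And>q. q \<in> X \<Longrightarrow> idx q \<le> n \<and> q = tm (idx q)" by metis
  have idx_le: "idx q \<le> idx q'" if "q \<in> X" "q' \<in> X" "q' \<le> q" for q q'
    using le_iff[of "idx q" "idx q'"] idx[OF that(1)] idx[OF that(2)] that(3) by metis
  have tX: "t j \<in> X" if "j \<le> L" for j using that by (auto simp: X_def)
  have SX: "fst (snd S) j \<in> X" "snd (snd S) j \<in> X" if "S \<in> A" "j < fst S" for S j
    using that by (auto simp: X_def)
  define b where "b j = idx (t j)" for j
  have b1: "b j \<le> b (Suc j)" if "j < L" for j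
    unfolding b_def using that tle[of j "Suc j"] by (intro idx_le tX) auto
  have b2: "b 0 = 0"
  proof -
    have "tm 0 \<le> tm (b 0)" using XL[of "tm 0"] idx[OF tX[of 0]] tm(2) by (auto simp: b_def)
    then show ?thesis using le_iff[of "b 0" 0] idx[OF tX[of 0]] by (simp add: b_def)
  qed
  have b3: "b L = n"
  proof -
    have "tm (b L) \<le> tm n" using XL[of "tm n"] idx[OF tX[of L]] tm(2) by (auto simp: b_def)
    then have "n \<le> b L" using le_iff[of n "b L"] idx[OF tX[of L]] by (simp add: b_def)
    moreover have "b L \<le> n" using idx[OF tX[of L]] by (simp add: b_def)
    ultimately show ?thesis by simp
  qed
  obtain G where G: "predictable G"
    "\<And>z N' k l. N' \<le> L \<Longrightarrow> (\<And>j. j < N' \<Longrightarrow> {k j, l j} \<subseteq> {b j..b (Suc j)}) \<Longrightarrow>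
      (\<Sum>j<N'. (z (k j) - z (l j))\<^sup>2) \<le> 16 * (z n)\<^sup>2 + (\<Sum>i<n. G i z * (z (Suc i) - z i))"
    using oscillation_controlled[of L b n, OF b1 b2 b3] by blast
  have main: "(\<Sum>j<fst S. \<bar>\<zeta> (fst (snd S) j) - \<zeta> (snd (snd S) j)\<bar> powr 2)
      \<le> 16 * M powr (2 - 2) * (\<zeta> (tm n))\<^sup>2 + (\<Sum>i<n. G i (\<lambda>i. \<zeta> (tm i)) * (\<zeta> (tm (Suc i)) - \<zeta> (tm i)))"
    if S: "S \<in> A" for S \<zeta>
  proof -
    have "(\<Sum>j<fst S. \<bar>\<zeta> (fst (snd S) j) - \<zeta> (snd (snd S) j)\<bar> powr 2)
      = (\<Sum>j<fst S. (\<zeta> (tm (idx (fst (snd S) j))) - \<zeta> (tm (idx (snd (snd S) j))))\<^sup>2)"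
    proof (rule sum.cong)
      fix j assume "j \<in> {..<fst S}"
      then have "fst (snd S) j = tm (idx (fst (snd S) j))" "snd (snd S) j = tm (idx (snd (snd S) j))"
        using idx[OF SX(1)[OF S, of j]] idx[OF SX(2)[OF S, of j]] by auto
      then show "\<bar>\<zeta> (fst (snd S) j) - \<zeta> (snd (snd S) j)\<bar> powr 2 = (\<zeta> (tm (idx (fst (snd S) j))) - \<zeta> (tm (idx (snd (snd S) j))))\<^sup>2"
        by (metis abs_ge_zero power2_abs powr_numeral)
    qed simp
    also have "\<dots> \<le> 16 * (\<zeta> (tm n))\<^sup>2 + (\<Sum>i<n. G i (\<lambda>i. \<zeta> (tm i)) * (\<zeta> (tm (Suc i)) - \<zeta> (tm i)))"
    proof (rule G(2)[where z = "\<lambda>i. \<zeta> (tm i)"])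
      show "fst S \<le> L" by (rule L[OF S])
      fix j assume j: "j < fst S"
      then have jL: "Suc j \<le> L" using L[OF S] by simp
      show "{idx (fst (snd S) j), idx (snd (snd S) j)} \<subseteq> {b j..b (Suc j)}"
        using SE[OF S j] SX[OF S j] tX[OF jL] tX[of j] jL by (auto simp: b_def intro!: idx_le)
    qed
    finally show ?thesis using M by simp
  qed
  show "\<exists>n tm G. predictable G \<and> (\<forall>i<n. tm (Suc i) < tm i) \<and> (\<forall>i\<le>n. 0 < tm i) \<and>
     (\<forall>(N, e', e)\<in>A. \<forall>j<N. e' j \<in> tm ` {..n} \<and> e j \<in> tm ` {..n}) \<and>
     (\<forall>\<zeta>. (\<forall>i\<le>n. \<zeta> (tm i) \<in> {0..M}) \<longrightarrow> (\<forall>(N, e', e)\<in>A.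
        (\<Sum>j<N. \<bar>\<zeta> (e' j) - \<zeta> (e j)\<bar> powr 2)
          \<le> 16 * M powr (2 - 2) * (\<zeta> (tm n))\<^sup>2 + (\<Sum>i<n. G i (\<lambda>i. \<zeta> (tm i)) * (\<zeta> (tm (Suc i)) - \<zeta> (tm i)))))"
  proof (intro exI[of _ n] exI[of _ tm] exI[of _ G] conjI allI impI)
    show "0 < tm i" if "i \<le> n" for i
    proof -
      have "tm i \<in> X" using tm(2) that by blast
      then show ?thesis using XL t(2)[of L] by fastforce
    qed
    show "\<forall>(N, e', e)\<in>A. \<forall>j<N. e' j \<in> tm ` {..n} \<and> e j \<in> tm ` {..n}"
      unfolding tm(2) split_beta' using SX by blast
    fix \<zeta> :: "real \<Rightarrow> real"
    show "\<forall>(N, e', e)\<in>A. (\<Sum>j<N. \<bar>\<zeta> (e' j) - \<zeta> (e j)\<bar> powr 2)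
          \<le> 16 * M powr (2 - 2) * (\<zeta> (tm n))\<^sup>2 + (\<Sum>i<n. G i (\<lambda>i. \<zeta> (tm i)) * (\<zeta> (tm (Suc i)) - \<zeta> (tm i)))"
      unfolding split_beta' using main by blast
  qed (use G(1) tm in auto)
qed

theorem theorem1p3:
  fixes lam \<rho> :: real and t :: "nat \<Rightarrow> real"
  assumes "0 < lam" and "2 < \<rho>"
    and "decseq t" and "\<And>j. 0 < t j" and "t \<longlonglongrightarrow> 0"
  shows "bounded_H1_L1 lam (oscillation_op t (bessel_poisson lam)) \<and>
         bounded_H1_L1 lam (variation_op \<rho> (bessel_poisson lam))"
proof
  have "oscillation_op t (bessel_poisson lam) = family_op 2 (oscillation_family t) (bessel_poisson lam)"
    by (intro ext oscillation_op_eq_family_op assms)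
  then show "bounded_H1_L1 lam (oscillation_op t (bessel_poisson lam))"
    using bounded_family_op[OF assms(1) nonoverlapping_oscillation_family[OF assms(4)] oscillation_family_nonempty
        oscillation_family_controlled[OF assms(3,4)]] by simp
  \<comment> \<open>The geometric ratio is below 1, so the control constant is nonnegative.\<close>
  have "(1/2::real) powr (\<rho> - 2) < 1" using assms(2) by (simp add: powr_def ln_div)
  then have C: "0 \<le> 4 powr \<rho> / (1 - (1/2) powr (\<rho> - 2))" by simp
  have "variation_op \<rho> (bessel_poisson lam) = family_op \<rho> variation_family (bessel_poisson lam)"
    using assms(2) by (intro ext variation_op_eq_family_op) simp
  then show "bounded_H1_L1 lam (variation_op \<rho> (bessel_poisson lam))"
    using bounded_family_op[OF assms(1) nonoverlapping_variation_family variation_family_nonempty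
        variation_family_controlled[OF assms(2)] _ C] assms(2) by simp
qed

end
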